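(* Let $d\ge 2$. There exist two sequences $(\Omega_{1,n})_{n\in\mathbb{N}}$ and $(\Omega_{2,n})_{n\in\mathbb{N}}$ of smooth domains in $\mathbb{R}^d$ such that for every $q>0$ $$F_q(\Omega_{1,n})\to 0\qquad\text{and}\qquad F_q(\Omega_{2,n})\to+\infty\qquad\text{as }n\to\infty .$$ In particular, for every $q>0$, $$\inf\{F_q(\Omega)\ :\ \Omega\in\mathcal{A}_{all},\ \Omega\text{ smooth}\}=0,\qquad \sup\{F_q(\Omega)\ :\ \Omega\in\mathcal{A}_{all},\ \Omega\text{ smooth}\}=+\infty .$$
   Context: $\mathcal{A}_{all}$ is the class of all nonempty open sets $\Omega\subset\mathbb{R}^d$ with finite Lebesgue measure $|\Omega|$; "domain" means an element of this class. For such $\Omega$: - $P(\Omega)=\sup\{\int_\Omega \mathrm{div}\,\phi\,dx : \phi\in C^1_c(\mathbb{R}^d;\mathbb{R}^d),\ \|\phi\|_{L^\infty(\mathbb{R}^d)}\le 1\}$ is the (De Giorgi) perimeter. - $T(\Omega)=\int_\Omega u\,dx$ is the torsional rigidity, where $u\in H^1_0(\Omega)$ is the unique (weak) solution of $-\Delta u=1$ in $\Omega$. Equivalently, $T(\Omega)=\max\{(\int_\Omega u\,dx)^2(\int_\Omega|\nabla u|^2dx)^{-1} : u\in H^1_0(\Omega)\setminus\{0\}\}$. - For $q>0$, $F_q(\Omega)=\dfrac{P(\Omega)\,T(\Omega)^q}{|\Omega|^{\alpha_q}}$ with $\alpha_q=1+q+\dfrac{2q-1}{d}$. *)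

theory Defs
  imports "HOL-Analysis.Analysis"
begin

text \<open>The space \<open>\<real>\<^sup>d\<close> is an arbitrary type of class \<open>euclidean_space\<close>, with \<open>d = DIM('a)\<close>.\<close>

subsection \<open>Differentiable functions\<close>

text \<open>\<open>Ck_on k S f\<close>: the function \<open>f\<close> is of class \<open>C\<^sup>k\<close> on the open set \<open>S\<close>, i.e. all iterated
  directional derivatives up to order \<open>k\<close> exist and are continuous on \<open>S\<close>.\<close>

primrec Ck_on :: "nat \<Rightarrow> 'a::euclidean_space set \<Rightarrow> ('a \<Rightarrow> 'b::real_normed_vector) \<Rightarrow> bool" where
  "Ck_on 0 S f \<longleftrightarrow> continuous_on S f"
| "Ck_on (Suc k) S f \<longleftrightarrow>
     (\<forall>x\<in>S. f differentiable (at x)) \<and> (\<forall>v. Ck_on k S (\<lambda>x. frechet_derivative f (at x) v))"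

definition smooth_on :: "'a::euclidean_space set \<Rightarrow> ('a \<Rightarrow> 'b::real_normed_vector) \<Rightarrow> bool" where
  "smooth_on S f \<longleftrightarrow> (\<forall>k. Ck_on k S f)"

definition supp :: "('a::topological_space \<Rightarrow> 'b::zero) \<Rightarrow> 'a set" where
  "supp f = closure {x. f x \<noteq> 0}"

definition grad :: "('a::euclidean_space \<Rightarrow> real) \<Rightarrow> 'a \<Rightarrow> 'a" where
  "grad f x = (\<Sum>b\<in>Basis. frechet_derivative f (at x) b *\<^sub>R b)"

definition divergence :: "('a::euclidean_space \<Rightarrow> 'a) \<Rightarrow> 'a \<Rightarrow> real" where
  "divergence \<phi> x = (\<Sum>b\<in>Basis. frechet_derivative \<phi> (at x) b \<bullet> b)"

subsection \<open>Domains\<close>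

definition A_all :: "'a::euclidean_space set set" where
  "A_all = {\<Omega>. open \<Omega> \<and> \<Omega> \<noteq> {} \<and> emeasure lborel \<Omega> < \<infinity>}"

text \<open>\<open>C\<^sup>\<infinity>\<close> boundary: near each boundary point, \<open>\<Omega>\<close> is the strict epigraph of a smooth function
  of the \<open>d - 1\<close> variables orthogonal to some unit vector \<open>\<nu>\<close>.  Such a function is encoded as a
  function \<open>\<gamma>\<close> on the whole space that is invariant under translations along \<open>\<nu>\<close>.\<close>

definition smooth_boundary :: "'a::euclidean_space set \<Rightarrow> bool" where
  "smooth_boundary \<Omega> \<longleftrightarrow>
     (\<forall>x\<in>frontier \<Omega>. \<exists>r>0. \<exists>\<nu>. \<exists>\<gamma>::'a \<Rightarrow> real.
        norm \<nu> = 1 \<and> (\<forall>y t. \<gamma> (y + t *\<^sub>R \<nu>) = \<gamma> y) \<and> smooth_on (ball x r) \<gamma> \<and>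
        \<Omega> \<inter> ball x r = {y \<in> ball x r. \<gamma> y < y \<bullet> \<nu>})"

subsection \<open>Perimeter\<close>

text \<open>The test fields are continuous, so their \<open>L\<^sup>\<infinity>\<close> norm is the supremum of the pointwise norm.\<close>

definition perimeter :: "'a::euclidean_space set \<Rightarrow> ereal" where
  "perimeter \<Omega> =
     (SUP \<phi> \<in> {\<phi>::'a \<Rightarrow> 'a. Ck_on 1 UNIV \<phi> \<and> compact (supp \<phi>) \<and> (\<forall>x. norm (\<phi> x) \<le> 1)}.
        ereal (LINT x:\<Omega>|lborel. divergence \<phi> x))"

subsection \<open>Torsional rigidity\<close>

definition test_functions :: "'a::euclidean_space set \<Rightarrow> ('a \<Rightarrow> real) set" where
  "test_functions \<Omega> = {\<phi>. smooth_on UNIV \<phi> \<and> compact (supp \<phi>) \<and> supp \<phi> \<subseteq> \<Omega>}"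

definition L2_on :: "'a::euclidean_space set \<Rightarrow> ('a \<Rightarrow> 'b::euclidean_space) \<Rightarrow> bool" where
  "L2_on \<Omega> u \<longleftrightarrow>
     set_borel_measurable lborel \<Omega> u \<and> set_integrable lborel \<Omega> (\<lambda>x. (norm (u x))\<^sup>2)"

text \<open>Sobolev functions are handled together with their weak gradient, which is unique up to null
  sets: \<open>H1 \<Omega> u g\<close> means \<open>u \<in> H\<^sup>1(\<Omega>)\<close> with weak gradient \<open>g\<close>.\<close>

definition H1 :: "'a::euclidean_space set \<Rightarrow> ('a \<Rightarrow> real) \<Rightarrow> ('a \<Rightarrow> 'a) \<Rightarrow> bool" where
  "H1 \<Omega> u g \<longleftrightarrow> L2_on \<Omega> u \<and> L2_on \<Omega> g \<and>
     (\<forall>\<phi>\<in>test_functions \<Omega>.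
        (LINT x:\<Omega>|lborel. u x *\<^sub>R grad \<phi> x) = - (LINT x:\<Omega>|lborel. \<phi> x *\<^sub>R g x))"

text \<open>\<open>H\<^sup>1\<^sub>0(\<Omega>)\<close> is the closure of the test functions in \<open>H\<^sup>1(\<Omega>)\<close>.\<close>

definition H10 :: "'a::euclidean_space set \<Rightarrow> ('a \<Rightarrow> real) \<Rightarrow> ('a \<Rightarrow> 'a) \<Rightarrow> bool" where
  "H10 \<Omega> u g \<longleftrightarrow> H1 \<Omega> u g \<and>
     (\<exists>\<phi>. (\<forall>n. \<phi> n \<in> test_functions \<Omega>) \<and>
        (\<lambda>n::nat. (LINT x:\<Omega>|lborel. (\<phi> n x - u x)\<^sup>2)
                + (LINT x:\<Omega>|lborel. (norm (grad (\<phi> n) x - g x))\<^sup>2)) \<longlonglongrightarrow> 0)"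

text \<open>Weak solution in \<open>H\<^sup>1\<^sub>0(\<Omega>)\<close> of \<open>-\<Delta>u = 1\<close>, with weak gradient \<open>g\<close>.\<close>

definition torsion_function :: "'a::euclidean_space set \<Rightarrow> ('a \<Rightarrow> real) \<Rightarrow> ('a \<Rightarrow> 'a) \<Rightarrow> bool" where
  "torsion_function \<Omega> u g \<longleftrightarrow> H10 \<Omega> u g \<and>
     (\<forall>\<phi>\<in>test_functions \<Omega>. (LINT x:\<Omega>|lborel. g x \<bullet> grad \<phi> x) = (LINT x:\<Omega>|lborel. \<phi> x))"

text \<open>The torsion function exists and is unique up to null sets for every \<open>\<Omega> \<in> A_all\<close>, so the
  description below is well defined there.\<close>

definition torsion :: "'a::euclidean_space set \<Rightarrow> real" where
  "torsion \<Omega> = (THE T. \<exists>u g. torsion_function \<Omega> u g \<and> T = (LINT x:\<Omega>|lborel. u x))"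

subsection \<open>The shape functional\<close>

definition alpha :: "'a::euclidean_space itself \<Rightarrow> real \<Rightarrow> real" where
  "alpha _ q = 1 + q + (2 * q - 1) / real DIM('a)"

text \<open>Extended-real valued, since the perimeter may be infinite.\<close>

definition F :: "real \<Rightarrow> 'a::euclidean_space set \<Rightarrow> ereal" where
  "F q \<Omega> = perimeter \<Omega> * ereal (torsion \<Omega> powr q)
             / ereal (measure lborel \<Omega> powr alpha TYPE('a) q)"

end

theory Submission
  imports Defs
begin

text \<open>Domains need not be connected. For \<open>F\<^sub>q \<rightarrow> \<infinity>\<close>, add to the unit ball \<open>m\<^sup>d\<close> far-apart balls of
  radius \<open>1/m\<close>: the volume stays bounded, the torsion is at least that of the unit ball, and the
  perimeter grows like \<open>m\<close>.

  For \<open>F\<^sub>q \<rightarrow> 0\<close>, remove from the unit ball a closed ball of radius \<open>r = m\<^sup>-\<^sup>d\<close> in each cell of a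
  cubic lattice of mesh \<open>h = m\<^sup>1\<^sup>-\<^sup>d\<close>. Since \<open>r\<^sup>d\<^sup>-\<^sup>1 = h\<^sup>d\<close>, the holes add only a bounded amount to the
  perimeter. On a cell \<open>Q\<close>, a function vanishing on the hole satisfies
  \<open>\<integral>\<^sub>Q \<phi> \<le> C h (h\<^sup>d (h/r)\<^sup>d\<^sup>-\<^sup>1)\<^sup>1\<^sup>/\<^sup>2 (\<integral>\<^sub>Q |\<nabla>\<phi>|\<^sup>2)\<^sup>1\<^sup>/\<^sup>2\<close>; summing over the cells, and treating the boundary
  layer of width of order \<open>h\<close> by the Poincare inequality, gives
  \<open>\<integral> \<phi> \<le> C h\<^sup>1\<^sup>/\<^sup>2 (\<integral> |\<nabla>\<phi>|\<^sup>2)\<^sup>1\<^sup>/\<^sup>2\<close> for every test function, i.e. torsion at most \<open>C\<^sup>2 h\<close>.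

  Torsion functions are obtained by minimising \<open>\<integral> |\<nabla>\<phi>|\<^sup>2 / 2 - \<integral> \<phi>\<close>: minimising sequences are
  Cauchy by the parallelogram law.\<close>

subsection \<open>Smooth functions\<close>

text \<open>One pair of sequences serves all q because q enters only through exponents: along each
  sequence two of the quantities P, T, |\<Omega>| are bounded in the favourable direction and the
  third one decides; q > 0 and \<alpha>_q > 0 make the powers monotone.

  The holes must destroy T without raising P. About h^(-d) holes of radius r cost perimeter h^(-d)
  r^(d-1), while the cell estimate bounds T by a multiple of h^2 (h/r)^(d-1). Keeping the perimeter
  bounded forces r^(d-1) to be at most of order h^d, and equality turns the second quantity into h.
  The powers of m make this balance exact.

  Neither surface measure nor an explicit torsion function is used. P is bounded above through the
  volume of \<Omega> \<Delta> (\<Omega> + v) divided by |v|, and below by one explicit field; T is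
  bounded on both sides by inequalities for test functions alone.\<close>

lemma Ck_on_cong_imp:
  assumes "open S" "\<And>x. x \<in> S \<Longrightarrow> f x = g x" "Ck_on k S f"
  shows "Ck_on k S g"
  using assms(2,3)
proof (induction k arbitrary: f g)
  case 0
  then show ?case by (simp cong: continuous_on_cong)
next
  case (Suc k)
  have tr: "(f has_derivative D) (at x) \<longleftrightarrow> (g has_derivative D) (at x)" if "x \<in> S" for x D
    using has_derivative_transform_within_open[of f D x UNIV S g]
      has_derivative_transform_within_open[of g D x UNIV S f] that assms(1) Suc.prems(1) by auto
  have fd: "frechet_derivative f (at x) = frechet_derivative g (at x)" if "x \<in> S" for x
    unfolding frechet_derivative_def using tr[OF that] by simp
  have "g differentiable (at x)" if "x \<in> S" for x
    using Suc.prems(2) that tr[OF that] unfolding Ck_on.simps differentiable_def by blast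
  moreover have "Ck_on k S (\<lambda>x. frechet_derivative g (at x) v)" for v
    by (rule Suc.IH[of "\<lambda>x. frechet_derivative f (at x) v"]) (use Suc.prems fd in auto)
  ultimately show ?case by simp
qed

text \<open>An explicit derivative is enough: it determines \<open>frechet_derivative\<close> on the
  open set, and \<open>Ck_on_cong_imp\<close> carries the regularity over.\<close>

lemma Ck_on_SucI:
  assumes "open S" "\<And>x. x \<in> S \<Longrightarrow> (f has_derivative D x) (at x)" "\<And>v. Ck_on k S (\<lambda>x. D x v)"
  shows "Ck_on (Suc k) S f"
proof -
  have "Ck_on k S (\<lambda>x. frechet_derivative f (at x) v)" for v
    by (rule Ck_on_cong_imp[OF assms(1) _ assms(3)[of v]])
      (simp add: frechet_derivative_at[OF assms(2), symmetric])
  then show ?thesis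
    using assms(2) by (auto simp: differentiable_def)
qed

lemma Ck_on_SucD:
  assumes "Ck_on (Suc k) S f" "x \<in> S"
  shows "(f has_derivative frechet_derivative f (at x)) (at x)"
  using assms by (simp add: frechet_derivative_works)

lemma Ck_on_add:
  assumes "open S" "Ck_on k S f" "Ck_on k S g"
  shows "Ck_on k S (\<lambda>x. f x + g x)"
  using assms(2,3)
proof (induction k arbitrary: f g)
  case 0
  then show ?case by (simp add: continuous_on_add)
next
  case (Suc k)
  show ?case
  proof (rule Ck_on_SucI[OF assms(1)])
    show "((\<lambda>x. f x + g x) has_derivative
        (\<lambda>v. frechet_derivative f (at x) v + frechet_derivative g (at x) v)) (at x)" if "x \<in> S" for x
      using Ck_on_SucD[OF Suc.prems(1) that] Ck_on_SucD[OF Suc.prems(2) that]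
      by (rule has_derivative_add)
    show "Ck_on k S (\<lambda>x. frechet_derivative f (at x) v + frechet_derivative g (at x) v)" for v
      by (rule Suc.IH) (use Suc.prems in simp_all)
  qed
qed

lemma Ck_on_scaleR:
  assumes "open S" "Ck_on k S f"
  shows "Ck_on k S (\<lambda>x. c *\<^sub>R f x)"
  using assms(2)
proof (induction k arbitrary: f)
  case 0
  then show ?case by (simp add: continuous_on_scaleR)
next
  case (Suc k)
  show ?case
  proof (rule Ck_on_SucI[OF assms(1)])
    show "((\<lambda>x. c *\<^sub>R f x) has_derivative
        (\<lambda>v. c *\<^sub>R frechet_derivative f (at x) v)) (at x)" if "x \<in> S" for x
      using Ck_on_SucD[OF Suc.prems that] by (rule has_derivative_scaleR_right)
    show "Ck_on k S (\<lambda>x. c *\<^sub>R frechet_derivative f (at x) v)" for v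
      by (rule Suc.IH) (use Suc.prems in simp)
  qed
qed

lemma Ck_on_1I:
  assumes "open S" "\<And>x. x \<in> S \<Longrightarrow> (f has_derivative D x) (at x)" "\<And>v. continuous_on S (\<lambda>x. D x v)"
  shows "Ck_on 1 S f"
  using Ck_on_SucI[of S f D 0] assms by simp

section \<open>Smoothness of compositions with polynomials\<close>

lemma real_polynomial_function_derivative:
  fixes p :: "'a::real_normed_vector \<Rightarrow> real"
  assumes "real_polynomial_function p"
  shows "\<exists>D. (\<forall>x. (p has_derivative D x) (at x)) \<and> (\<forall>v. real_polynomial_function (\<lambda>x. D x v))"
  using assms
proof induction
  case (linear f)
  then show ?case
    by (intro exI[of _ "\<lambda>_. f"])
      (auto simp: bounded_linear_imp_has_derivative real_polynomial_function.intros(2))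
next
  case (const c)
  then show ?case
    by (intro exI[of _ "\<lambda>_ _. 0"]) auto
next
  case (add f g)
  then obtain D E where
    "\<forall>x. (f has_derivative D x) (at x)" "\<forall>v. real_polynomial_function (\<lambda>x. D x v)"
    "\<forall>x. (g has_derivative E x) (at x)" "\<forall>v. real_polynomial_function (\<lambda>x. E x v)"
    by blast
  then show ?case
    by (intro exI[of _ "\<lambda>x v. D x v + E x v"]) (auto intro: has_derivative_add)
next
  case (mult f g)
  then obtain D E where
    "\<forall>x. (f has_derivative D x) (at x)" "\<forall>v. real_polynomial_function (\<lambda>x. D x v)"
    "\<forall>x. (g has_derivative E x) (at x)" "\<forall>v. real_polynomial_function (\<lambda>x. E x v)"
    by blast
  moreover from this have "\<forall>v. real_polynomial_function (\<lambda>x. f x * E x v + D x v * g x)"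
    by (intro allI real_polynomial_function.intros(3,4) mult.hyps) simp_all
  ultimately show ?case
    by (intro exI[of _ "\<lambda>x v. f x * E x v + D x v * g x"]) (auto intro: has_derivative_mult)
qed

lemma smooth_on_compose_polynomial:
  fixes q :: "'a::euclidean_space \<Rightarrow> real" and \<H> :: "(real \<Rightarrow> real) set"
  assumes "open S" and q: "real_polynomial_function q" "\<And>x. x \<in> S \<Longrightarrow> q x \<in> T"
    and \<H>: "\<And>h. h \<in> \<H> \<Longrightarrow> \<exists>h'\<in>\<H>. \<forall>t\<in>T. (h has_real_derivative h' t) (at t)"
    and "h \<in> \<H>"
  shows "smooth_on S (\<lambda>x. h (q x))"
proof -
  have "Ck_on k S (\<lambda>x. m x * h (q x))"
    if "real_polynomial_function m" "h \<in> \<H>" for k m h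
    using that
  proof (induction k arbitrary: m h)
    case 0
    obtain h' where h': "\<forall>t\<in>T. (h has_real_derivative h' t) (at t)"
      using \<H>[OF 0(2)] by blast
    have "continuous_on T h"
      using h' by (meson DERIV_isCont continuous_at_imp_continuous_on)
    moreover have "continuous_on S q" "continuous_on S m"
      using q(1) 0(1) by (simp_all add: continuous_on_polymonial_function real_polynomial_function_eq)
    ultimately have "continuous_on S (\<lambda>x. h (q x))" "continuous_on S m"
      using q(2) by (auto intro: continuous_on_compose2[of T h S q])
    then show ?case
      by (simp add: continuous_on_mult)
  next
    case (Suc k)
    obtain h' where h': "h' \<in> \<H>" "\<forall>t\<in>T. (h has_real_derivative h' t) (at t)"
      using \<H>[OF Suc.prems(2)] by blast
    obtain D where D: "\<forall>x. (q has_derivative D x) (at x)"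
      "\<forall>v. real_polynomial_function (\<lambda>x. D x v)"
      using real_polynomial_function_derivative[OF q(1)] by blast
    obtain E where E: "\<forall>x. (m has_derivative E x) (at x)"
      "\<forall>v. real_polynomial_function (\<lambda>x. E x v)"
      using real_polynomial_function_derivative[OF Suc.prems(1)] by blast
    show ?case
    proof (rule Ck_on_SucI[OF \<open>open S\<close>])
      fix x assume "x \<in> S"
      then have "(h has_derivative (\<lambda>u. h' (q x) * u)) (at (q x))"
        using h' q(2) by (auto simp: has_field_derivative_def)
      then have "((\<lambda>x. h (q x)) has_derivative (\<lambda>v. h' (q x) * D x v)) (at x)"
        using has_derivative_compose[of q "D x" x UNIV h] D by simp
      from has_derivative_mult[OF spec[OF E(1)] this]
      show "((\<lambda>x. m x * h (q x)) has_derivative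
          (\<lambda>v. (m x * D x v) * h' (q x) + E x v * h (q x))) (at x)"
        by (simp add: ac_simps)
    next
      fix v
      show "Ck_on k S (\<lambda>x. m x * D x v * h' (q x) + E x v * h (q x))"
        using D(2) E(2) Suc.prems h'(1)
        by (intro Ck_on_add[OF \<open>open S\<close>] Suc.IH) auto
    qed
  qed
  from this[OF real_polynomial_function.intros(2)[of 1] \<open>h \<in> \<H>\<close>]
  show ?thesis by (simp add: smooth_on_def)
qed

section \<open>A smooth bump function\<close>

text \<open>With an arbitrary polynomial \<open>p\<close> the family is closed under
  differentiation, as \<open>smooth_on_compose_polynomial\<close> demands; \<open>p = 1\<close> is
  the usual flat function exp(-1/t).\<close>

definition flat_exp :: "real poly \<Rightarrow> real \<Rightarrow> real" where
  "flat_exp p t = (if t > 0 then poly p (1/t) * exp (- (1/t)) else 0)"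

lemma poly_exp_decay: "((\<lambda>s. poly p s * exp (- s)) \<longlongrightarrow> (0::real)) at_top"
proof -
  have "((\<lambda>s. \<Sum>i\<le>degree p. coeff p i * (s ^ i / exp s)) \<longlongrightarrow> (\<Sum>i\<le>degree p. coeff p i * 0)) at_top"
    by (intro tendsto_intros tendsto_power_div_exp_0)
  then show ?thesis
    by (simp add: poly_altdef sum_distrib_right exp_minus divide_inverse mult.assoc)
qed

text \<open>Put s = 1/t. Then d/dt is -s^2 d/ds, which maps p(s) exp(-s) to s^2 (p - p')(s) exp(-s);
  \<open>monom 1 2\<close> is the factor s^2. At t = 0 the right difference quotient is s p(s)
  exp(-s), which tends to 0 as s grows.\<close>

lemma flat_exp_deriv:
  "(flat_exp p has_real_derivative flat_exp (monom 1 2 * (p - pderiv p)) t) (at t)"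
proof (cases t "0::real" rule: linorder_cases)
  case less
  have "((\<lambda>_. 0) has_real_derivative 0) (at t)" by simp
  then have "(flat_exp p has_real_derivative 0) (at t)"
    by (rule has_field_derivative_transform_within_open[of _ _ _ "{..<0}"])
      (use less in \<open>auto simp: flat_exp_def\<close>)
  then show ?thesis using less by (simp add: flat_exp_def)
next
  case greater
  have "((\<lambda>t. poly p (1/t) * exp (- (1/t))) has_real_derivative
       poly (monom 1 2 * (p - pderiv p)) (1/t) * exp (- (1/t))) (at t)"
    using greater
    by (auto intro!: derivative_eq_intros DERIV_chain2[OF poly_DERIV]
        simp: poly_monom field_simps power2_eq_square)
  then have "(flat_exp p has_real_derivative poly (monom 1 2 * (p - pderiv p)) (1/t) * exp (- (1/t))) (at t)"
    by (rule has_field_derivative_transform_within_open[of _ _ _ "{0<..}"])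
      (use greater in \<open>auto simp: flat_exp_def\<close>)
  then show ?thesis using greater by (simp add: flat_exp_def)
next
  case equal
  have "((\<lambda>t. poly (pCons 0 p) (inverse t) * exp (- inverse t)) \<longlongrightarrow> 0) (at_right (0::real))"
    by (rule filterlim_compose[OF poly_exp_decay filterlim_inverse_at_top_right])
  then have "((\<lambda>t. flat_exp p t / t) \<longlongrightarrow> 0) (at_right 0)"
    by (rule Lim_transform_eventually)
      (auto simp: eventually_at_filter flat_exp_def field_simps)
  moreover have "((\<lambda>t. flat_exp p t / t) \<longlongrightarrow> 0) (at_left 0)"
    by (rule tendsto_eventually) (auto simp: eventually_at_filter flat_exp_def)
  ultimately have "((\<lambda>t. flat_exp p t / t) \<longlongrightarrow> 0) (at 0)"
    by (simp add: filterlim_split_at)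
  then show ?thesis
    using equal by (simp add: DERIV_def flat_exp_def)
qed

lemma real_polynomial_function_norm_sq:
  "real_polynomial_function (\<lambda>x::'a::euclidean_space. (norm (x - c))\<^sup>2)"
proof -
  have "real_polynomial_function (\<lambda>x::'a. (x \<bullet> b + - (c \<bullet> b)) * (x \<bullet> b + - (c \<bullet> b)))" for b
    by (intro real_polynomial_function.intros bounded_linear_inner_left)
  then have "real_polynomial_function (\<lambda>x::'a. \<Sum>b\<in>Basis. (x \<bullet> b + - (c \<bullet> b)) * (x \<bullet> b + - (c \<bullet> b)))"
    by (intro real_polynomial_function_sum) auto
  moreover have "(\<Sum>b\<in>Basis. (x \<bullet> b + - (c \<bullet> b)) * (x \<bullet> b + - (c \<bullet> b))) = (norm (x - c))\<^sup>2" for x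
    unfolding power2_norm_eq_inner by (subst euclidean_inner) (simp add: inner_diff_left)
  ultimately show ?thesis by simp
qed

lemma ex_bump:
  "\<exists>\<phi>\<in>test_functions (ball 0 1 :: 'a::euclidean_space set). (\<forall>x. \<phi> x \<ge> 0) \<and> \<phi> 0 > 0"
proof -
  \<comment> \<open>The constant 1/4 confines the support to the closed ball of radius 1/2, hence to
    a compact subset of the open unit ball.\<close>
  define \<phi> :: "'a \<Rightarrow> real" where "\<phi> x = flat_exp 1 (1/4 + - (norm (x - 0))\<^sup>2)" for x
  have "smooth_on UNIV \<phi>"
    unfolding \<phi>_def
  proof (rule smooth_on_compose_polynomial[where \<H> = "range flat_exp" and T = UNIV and h = "flat_exp 1"])
    show "real_polynomial_function (\<lambda>x::'a. 1/4 + - (norm (x - 0))\<^sup>2)"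
      by (intro real_polynomial_function.intros(2,3) real_polynomial_function_minus
          real_polynomial_function_norm_sq)
    show "\<exists>h'\<in>range flat_exp. \<forall>t\<in>UNIV. (h has_real_derivative h' t) (at t)"
      if "h \<in> range flat_exp" for h
      using that flat_exp_deriv by blast
  qed auto
  moreover have "norm x \<le> 1/2" if "\<phi> x \<noteq> 0" for x
  proof -
    have "(norm x)\<^sup>2 \<le> (1/2)\<^sup>2"
      using that by (auto simp: \<phi>_def flat_exp_def power2_eq_square split: if_splits)
    then show ?thesis by (rule power2_le_imp_le) auto
  qed
  then have "supp \<phi> \<subseteq> cball 0 (1/2)"
    unfolding supp_def by (intro closure_minimal) auto
  then have "compact (supp \<phi>)" "supp \<phi> \<subseteq> ball 0 1"
    using closed_Int_compact[of "supp \<phi>" "cball 0 (1/2)"]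
    by (auto simp: supp_def inf.absorb1)
  moreover have "\<phi> x \<ge> 0" for x
    by (auto simp: \<phi>_def flat_exp_def)
  moreover have "\<phi> 0 > 0"
    by (auto simp: \<phi>_def flat_exp_def)
  ultimately show ?thesis
    by (auto simp: test_functions_def)
qed

subsection \<open>Square-integrable functions and integration by parts\<close>

text \<open>Functions on a domain are handled as functions on the whole space that vanish off it, so
  one measure serves all domains; multiplication by \<open>indicator \<Omega>\<close> is the bridge
  to \<open>L2_on\<close>.\<close>

definition sq_integrable :: "'a measure \<Rightarrow> ('a \<Rightarrow> 'b::euclidean_space) \<Rightarrow> bool" where
  "sq_integrable M f \<longleftrightarrow> f \<in> borel_measurable M \<and> integrable M (\<lambda>x. (norm (f x))\<^sup>2)"

definition L2_norm :: "'a measure \<Rightarrow> ('a \<Rightarrow> 'b::euclidean_space) \<Rightarrow> real" where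
  "L2_norm M f = sqrt (\<integral>x. (norm (f x))\<^sup>2 \<partial>M)"

lemma L2_norm_nonneg [simp]: "L2_norm M f \<ge> 0"
  by (simp add: L2_norm_def)

lemma L2_norm_power2: "(L2_norm M f)\<^sup>2 = (\<integral>x. (norm (f x))\<^sup>2 \<partial>M)"
  by (simp add: L2_norm_def)

lemma sq_integrable_measurable [measurable_dest]:
  "sq_integrable M f \<Longrightarrow> f \<in> borel_measurable M"
  by (simp add: sq_integrable_def)

lemma sq_integrable_norm: "sq_integrable M f \<Longrightarrow> sq_integrable M (\<lambda>x. norm (f x))"
  by (auto simp: sq_integrable_def)

lemma L2_norm_norm: "L2_norm M (\<lambda>x. norm (f x)) = L2_norm M f"
  by (simp add: L2_norm_def)

lemma sq_integrable_minus: "sq_integrable M f \<Longrightarrow> sq_integrable M (\<lambda>x. - f x)"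
  by (simp add: sq_integrable_def)

lemma sq_integrable_add:
  assumes "sq_integrable M f" "sq_integrable M g"
  shows "sq_integrable M (\<lambda>x. f x + g x)"
  unfolding sq_integrable_def
proof
  have m [measurable]: "f \<in> borel_measurable M" "g \<in> borel_measurable M"
    using assms by (auto simp: sq_integrable_def)
  show "(\<lambda>x. f x + g x) \<in> borel_measurable M" by simp
  have i: "integrable M (\<lambda>x. 2 * (norm (f x))\<^sup>2 + 2 * (norm (g x))\<^sup>2)"
    using assms by (auto simp: sq_integrable_def)
  show "integrable M (\<lambda>x. (norm (f x + g x))\<^sup>2)"
  proof (rule Bochner_Integration.integrable_bound[OF i])
    show "AE x in M. norm ((norm (f x + g x))\<^sup>2) \<le> norm (2 * (norm (f x))\<^sup>2 + 2 * (norm (g x))\<^sup>2)"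
    proof (rule AE_I2)
      fix x
      have "(norm (f x + g x))\<^sup>2 \<le> (norm (f x) + norm (g x))\<^sup>2"
        by (intro power_mono norm_triangle_ineq) auto
      also have "\<dots> \<le> 2 * (norm (f x))\<^sup>2 + 2 * (norm (g x))\<^sup>2"
        using zero_le_power2[of "norm (f x) - norm (g x)"]
        by (simp add: power2_eq_square algebra_simps)
      finally show "norm ((norm (f x + g x))\<^sup>2) \<le> norm (2 * (norm (f x))\<^sup>2 + 2 * (norm (g x))\<^sup>2)"
        by simp
    qed
  qed simp
qed

lemma sq_integrable_diff:
  assumes "sq_integrable M f" "sq_integrable M g"
  shows "sq_integrable M (\<lambda>x. f x - g x)"
  using sq_integrable_add[OF assms(1) sq_integrable_minus[OF assms(2)]] by simp

lemma sq_integrable_inner: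
  assumes "sq_integrable M f" "sq_integrable M g"
  shows "integrable M (\<lambda>x. f x \<bullet> g x)"
proof -
  have m [measurable]: "f \<in> borel_measurable M" "g \<in> borel_measurable M"
    using assms by (auto simp: sq_integrable_def)
  have i: "integrable M (\<lambda>x. (norm (f x))\<^sup>2 + (norm (g x))\<^sup>2)"
    using assms by (auto simp: sq_integrable_def)
  show ?thesis
  proof (rule Bochner_Integration.integrable_bound[OF i])
    show "AE x in M. norm (f x \<bullet> g x) \<le> norm ((norm (f x))\<^sup>2 + (norm (g x))\<^sup>2)"
    proof (rule AE_I2)
      fix x
      have "\<bar>f x \<bullet> g x\<bar> \<le> norm (f x) * norm (g x)"
        by (rule Cauchy_Schwarz_ineq2)
      also have "\<dots> \<le> (norm (f x))\<^sup>2 + (norm (g x))\<^sup>2"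
        using zero_le_power2[of "norm (f x) - norm (g x)"] mult_nonneg_nonneg[OF norm_ge_zero[of "f x"] norm_ge_zero[of "g x"]]
        unfolding power2_eq_square ring_distribs mult.commute[of "norm (g x)" "norm (f x)"] by linarith
      finally show "norm (f x \<bullet> g x) \<le> norm ((norm (f x))\<^sup>2 + (norm (g x))\<^sup>2)"
        by simp
    qed
  qed simp
qed

text \<open>The one expansion behind the Cauchy-Schwarz inequality, the triangle inequality and the
  first and second variation of the torsion energy.\<close>

lemma L2_norm_add_scaled:
  assumes "sq_integrable M f" "sq_integrable M g"
  shows "(L2_norm M (\<lambda>x. f x + t *\<^sub>R g x))\<^sup>2
       = (L2_norm M f)\<^sup>2 + 2 * t * (\<integral>x. f x \<bullet> g x \<partial>M) + t\<^sup>2 * (L2_norm M g)\<^sup>2"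
proof -
  have [simp]: "integrable M (\<lambda>x. (norm (f x))\<^sup>2)" "integrable M (\<lambda>x. (norm (g x))\<^sup>2)"
    "integrable M (\<lambda>x. f x \<bullet> g x)"
    using assms sq_integrable_inner by (auto simp: sq_integrable_def)
  have "(norm (f x + t *\<^sub>R g x))\<^sup>2 = (norm (f x))\<^sup>2 + 2 * t * (f x \<bullet> g x) + t\<^sup>2 * (norm (g x))\<^sup>2" for x
    unfolding power2_norm_eq_inner by (simp add: inner_simps inner_commute algebra_simps power2_eq_square)
  then show ?thesis
    by (simp add: L2_norm_power2)
qed

lemma integral_Cauchy_Schwarz:
  assumes "sq_integrable M f" "sq_integrable M g"
  shows "\<bar>\<integral>x. f x \<bullet> g x \<partial>M\<bar> \<le> L2_norm M f * L2_norm M g"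
proof -
  let ?a = "(L2_norm M f)\<^sup>2" and ?b = "\<integral>x. f x \<bullet> g x \<partial>M" and ?c = "(L2_norm M g)\<^sup>2"
  have q: "0 \<le> ?a + 2 * t * ?b + t\<^sup>2 * ?c" for t
    using L2_norm_add_scaled[OF assms, of t] by (metis zero_le_power2)
  have "?b\<^sup>2 \<le> ?a * ?c"
  \<comment> \<open>For \<open>?c > 0\<close> the quadratic is evaluated at its minimum t = -b/c.
    For \<open>?c = 0\<close> it is affine in t, and a nonzero b would make it equal to -1 at t =
    -(a + 1)/(2b).\<close>
  proof (cases "?c = 0")
    case True
    have "?b = 0"
    proof (rule ccontr)
      assume b: "?b \<noteq> 0"
      have "0 \<le> ?a + 2 * (- (?a + 1) / (2 * ?b)) * ?b"
        using q[of "- (?a + 1) / (2 * ?b)"] True by simp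
      with b show False by (simp add: field_simps)
    qed
    with True show ?thesis by simp
  next
    case False
    then have "?c > 0" by simp
    have "0 \<le> (?a + 2 * (- ?b / ?c) * ?b + (- ?b / ?c)\<^sup>2 * ?c) * ?c"
      by (rule mult_nonneg_nonneg[OF q]) simp
    also have "\<dots> = ?a * ?c - ?b\<^sup>2"
      using False by (simp add: algebra_simps power_divide) (simp add: power2_eq_square)
    finally show ?thesis by simp
  qed
  then have "?b\<^sup>2 \<le> (L2_norm M f * L2_norm M g)\<^sup>2"
    by (simp add: power_mult_distrib)
  then show ?thesis
    by (metis L2_norm_nonneg abs_le_square_iff abs_of_nonneg mult_nonneg_nonneg)
qed

lemma L2_norm_triangle:
  assumes "sq_integrable M f" "sq_integrable M g"
  shows "L2_norm M (\<lambda>x. f x + g x) \<le> L2_norm M f + L2_norm M g"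
proof (rule power2_le_imp_le)
  show "(L2_norm M (\<lambda>x. f x + g x))\<^sup>2 \<le> (L2_norm M f + L2_norm M g)\<^sup>2"
    using L2_norm_add_scaled[OF assms, of 1] integral_Cauchy_Schwarz[OF assms]
    by (simp add: power2_sum)
qed simp

lemma L2_norm_diff_commute: "L2_norm M (\<lambda>x. f x - g x) = L2_norm M (\<lambda>x. g x - f x)"
  by (simp add: L2_norm_def norm_minus_commute)

lemma L2_norm_diff_ge:
  assumes "sq_integrable M f" "sq_integrable M g"
  shows "\<bar>L2_norm M f - L2_norm M g\<bar> \<le> L2_norm M (\<lambda>x. f x - g x)"
  using L2_norm_triangle[OF sq_integrable_diff[OF assms] assms(2)]
    L2_norm_triangle[OF sq_integrable_diff[OF assms(2,1)] assms(1)]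
  by (simp add: L2_norm_diff_commute[of M g f])

lemma sq_integrable_indicator:
  assumes "\<Omega> \<in> sets M" "emeasure M \<Omega> < \<infinity>"
  shows "sq_integrable M (indicator \<Omega> :: _ \<Rightarrow> real)"
    and "L2_norm M (indicator \<Omega> :: _ \<Rightarrow> real) = sqrt (measure M \<Omega>)"
proof -
  have "(norm (indicator \<Omega> x :: real))\<^sup>2 = indicator \<Omega> x" for x
    by (simp add: indicator_def)
  then show "sq_integrable M (indicator \<Omega> :: _ \<Rightarrow> real)"
    "L2_norm M (indicator \<Omega> :: _ \<Rightarrow> real) = sqrt (measure M \<Omega>)"
    using assms by (auto simp: sq_integrable_def L2_norm_def Int_absorb2 sets.sets_into_space)
qed

text \<open>Cauchy-Schwarz against the indicator of a set of finite measure. It passes from L^2 to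
  L^1 bounds, both for completeness and for bounding the energy from below.\<close>

lemma integral_norm_le_L2_norm:
  assumes "sq_integrable M f" "\<Omega> \<in> sets M" "emeasure M \<Omega> < \<infinity>" "\<And>x. x \<notin> \<Omega> \<Longrightarrow> f x = 0"
  shows "integrable M f" "(\<integral>x. norm (f x) \<partial>M) \<le> sqrt (measure M \<Omega>) * L2_norm M f"
proof -
  have eq: "indicator \<Omega> x \<bullet> norm (f x) = norm (f x)" for x
    using assms(4) by (cases "x \<in> \<Omega>") auto
  have "integrable M (\<lambda>x. norm (f x))"
    using sq_integrable_inner[OF sq_integrable_indicator(1)[OF assms(2,3)] sq_integrable_norm[OF assms(1)]]
    unfolding eq .
  then show "integrable M f"
    using sq_integrable_measurable[OF assms(1)] by (simp add: integrable_norm_iff)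
  show "(\<integral>x. norm (f x) \<partial>M) \<le> sqrt (measure M \<Omega>) * L2_norm M f"
    using integral_Cauchy_Schwarz[OF sq_integrable_indicator(1)[OF assms(2,3)] sq_integrable_norm[OF assms(1)]]
    unfolding eq L2_norm_norm sq_integrable_indicator(2)[OF assms(2,3)] by simp
qed

text \<open>Riesz-Fischer on a set of finite measure. There an L^2-Cauchy sequence is L^1-Cauchy, so
  a subsequence converges almost everywhere, and Fatou's lemma identifies its pointwise limit as the
  L^2 limit of the full sequence.\<close>

lemma L2_complete:
  fixes s :: "nat \<Rightarrow> 'a \<Rightarrow> 'b::euclidean_space"
  assumes s: "\<And>n. sq_integrable M (s n)" "\<And>n x. x \<notin> \<Omega> \<Longrightarrow> s n x = 0"
    and \<Omega> [measurable]: "\<Omega> \<in> sets M" and fin: "emeasure M \<Omega> < \<infinity>"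
    and cauchy: "\<And>e. e > 0 \<Longrightarrow> \<exists>N. \<forall>i\<ge>N. \<forall>j\<ge>N. L2_norm M (\<lambda>x. s i x - s j x) < e"
  obtains f where "sq_integrable M f" "\<And>x. x \<notin> \<Omega> \<Longrightarrow> f x = 0"
    "(\<lambda>n. L2_norm M (\<lambda>x. s n x - f x)) \<longlonglongrightarrow> 0"
proof -
  have [measurable]: "s n \<in> borel_measurable M" for n
    using s(1) by (simp add: sq_integrable_def)
  have sqd: "sq_integrable M (\<lambda>x. s i x - s j x)" for i j
    by (intro sq_integrable_diff s)
  have "\<exists>N. \<forall>i\<ge>N. \<forall>j\<ge>N. (\<integral>x. norm (s i x - s j x) \<partial>M) < e" if "e > 0" for e
  proof -
    define k where "k = sqrt (measure M \<Omega>) + 1"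
    have "k > 0" by (auto simp: k_def add_nonneg_pos)
    obtain N where N: "\<forall>i\<ge>N. \<forall>j\<ge>N. L2_norm M (\<lambda>x. s i x - s j x) < e / k"
      using cauchy[of "e / k"] \<open>k > 0\<close> \<open>e > 0\<close> by auto
    have "(\<integral>x. norm (s i x - s j x) \<partial>M) < e" if "i \<ge> N" "j \<ge> N" for i j
    proof -
      have "(\<integral>x. norm (s i x - s j x) \<partial>M) \<le> sqrt (measure M \<Omega>) * L2_norm M (\<lambda>x. s i x - s j x)"
        by (rule integral_norm_le_L2_norm[OF sqd \<Omega> fin]) (simp add: s)
      also have "\<dots> \<le> k * L2_norm M (\<lambda>x. s i x - s j x)"
        by (intro mult_right_mono) (auto simp: k_def)
      also have "\<dots> < e"
        using N that \<open>k > 0\<close> by (auto simp: field_simps)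
      finally show ?thesis .
    qed
    then show ?thesis by blast
  qed
  then obtain r where r: "strict_mono r" "AE x in M. Cauchy (\<lambda>i. s (r i) x)"
    using cauchy_L1_AE_cauchy_subseq[of M s] integral_norm_le_L2_norm(1)[OF s(1) \<Omega> fin s(2)]
    by blast
  define f where "f x = lim (\<lambda>i. s (r i) x)" for x
  \<comment> \<open>\<open>lim\<close> of the zero sequence is 0, so the limit vanishes everywhere
    off \<open>\<Omega>\<close>, not only almost everywhere.\<close>
  have f0: "f x = 0" if "x \<notin> \<Omega>" for x
    using that s(2) by (simp add: f_def)
  have [measurable]: "f \<in> borel_measurable M"
    unfolding f_def by (rule borel_measurable_lim_metric) simp
  have lim: "AE x in M. (\<lambda>i. s (r i) x) \<longlonglongrightarrow> f x"
    using r(2) by eventually_elim (simp add: f_def Cauchy_convergent_iff convergent_LIMSEQ_iff)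
  \<comment> \<open>Fatou along the subsequence with \<open>n\<close> fixed. The same bound shows
    that the difference is square-integrable, whence \<open>f\<close> is.\<close>
  have key: "sq_integrable M (\<lambda>x. s n x - f x) \<and> L2_norm M (\<lambda>x. s n x - f x) \<le> e"
    if "e > 0" "\<forall>i\<ge>N. \<forall>j\<ge>N. L2_norm M (\<lambda>x. s i x - s j x) < e" "n \<ge> N" for e N n
  proof -
    have "(\<integral>\<^sup>+x. ennreal ((norm (s n x - f x))\<^sup>2) \<partial>M)
        = (\<integral>\<^sup>+x. liminf (\<lambda>k. ennreal ((norm (s n x - s (r k) x))\<^sup>2)) \<partial>M)"
    proof (rule nn_integral_cong_AE, use lim in eventually_elim)
      fix x assume "(\<lambda>i. s (r i) x) \<longlonglongrightarrow> f x"
      then have "(\<lambda>k. ennreal ((norm (s n x - s (r k) x))\<^sup>2)) \<longlonglongrightarrow> ennreal ((norm (s n x - f x))\<^sup>2)"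
        by (intro tendsto_ennrealI tendsto_intros)
      then show "ennreal ((norm (s n x - f x))\<^sup>2) = liminf (\<lambda>k. ennreal ((norm (s n x - s (r k) x))\<^sup>2))"
        by (rule lim_imp_Liminf[OF trivial_limit_sequentially, symmetric])
    qed
    also have "\<dots> \<le> liminf (\<lambda>k. \<integral>\<^sup>+x. ennreal ((norm (s n x - s (r k) x))\<^sup>2) \<partial>M)"
      by (rule nn_integral_liminf) simp
    also have "\<dots> \<le> limsup (\<lambda>k. \<integral>\<^sup>+x. ennreal ((norm (s n x - s (r k) x))\<^sup>2) \<partial>M)"
      by (rule Liminf_le_Limsup) simp
    also have "\<dots> \<le> ennreal (e\<^sup>2)"
    proof (rule Limsup_bounded, rule eventually_sequentiallyI[of N])
      fix k assume "k \<ge> N"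
      then have "r k \<ge> N"
        using seq_suble[OF r(1), of k] by simp
      have "(\<integral>\<^sup>+x. ennreal ((norm (s n x - s (r k) x))\<^sup>2) \<partial>M) = ennreal ((L2_norm M (\<lambda>x. s n x - s (r k) x))\<^sup>2)"
        unfolding L2_norm_power2 using sqd by (intro nn_integral_eq_integral) (auto simp: sq_integrable_def)
      also have "\<dots> \<le> ennreal (e\<^sup>2)"
        using that \<open>r k \<ge> N\<close> by (intro ennreal_leI power_mono) (auto intro: less_imp_le)
      finally show "(\<integral>\<^sup>+x. ennreal ((norm (s n x - s (r k) x))\<^sup>2) \<partial>M) \<le> ennreal (e\<^sup>2)" .
    qed
    finally have le: "(\<integral>\<^sup>+x. ennreal ((norm (s n x - f x))\<^sup>2) \<partial>M) \<le> ennreal (e\<^sup>2)" .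
    then have int: "integrable M (\<lambda>x. (norm (s n x - f x))\<^sup>2)"
      by (intro integrableI_bounded) (auto intro: le_less_trans)
    have "ennreal ((L2_norm M (\<lambda>x. s n x - f x))\<^sup>2) \<le> ennreal (e\<^sup>2)"
      using le unfolding L2_norm_power2 by (subst (asm) nn_integral_eq_integral[OF int]) auto
    then have "(L2_norm M (\<lambda>x. s n x - f x))\<^sup>2 \<le> e\<^sup>2"
      by simp
    then have "L2_norm M (\<lambda>x. s n x - f x) \<le> e"
      by (rule power2_le_imp_le) (use that(1) in simp)
    with int show ?thesis
      by (simp add: sq_integrable_def)
  qed
  have "sq_integrable M f"
  proof -
    obtain N where "\<forall>i\<ge>N. \<forall>j\<ge>N. L2_norm M (\<lambda>x. s i x - s j x) < 1"
      using cauchy[of 1] by auto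
    then have "sq_integrable M (\<lambda>x. s N x - f x)"
      using key[of 1 N N] by simp
    from sq_integrable_diff[OF s(1)[of N] this] show ?thesis by simp
  qed
  moreover have "(\<lambda>n. L2_norm M (\<lambda>x. s n x - f x)) \<longlonglongrightarrow> 0"
  proof (rule LIMSEQ_I)
    fix e :: real assume "e > 0"
    then obtain N where "\<forall>i\<ge>N. \<forall>j\<ge>N. L2_norm M (\<lambda>x. s i x - s j x) < e / 2"
      using cauchy[of "e/2"] by auto
    then have "L2_norm M (\<lambda>x. s n x - f x) \<le> e / 2" if "n \<ge> N" for n
      using key[of "e/2" N n] \<open>e > 0\<close> that by simp
    then show "\<exists>N. \<forall>n\<ge>N. norm (L2_norm M (\<lambda>x. s n x - f x) - 0) < e"
      using \<open>e > 0\<close> by (intro exI[of _ N]) force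
  qed
  ultimately show ?thesis
    using f0 that by blast
qed

section \<open>Difference quotients and vanishing integrals of derivatives\<close>

lemma integrable_continuous_bounded_support:
  fixes f :: "'a::euclidean_space \<Rightarrow> 'b::{banach, second_countable_topology}"
  assumes "continuous_on UNIV f" "\<And>x. x \<notin> cball 0 R \<Longrightarrow> f x = 0"
  shows "integrable lborel f"
proof -
  have "integrable lborel (\<lambda>x. indicator (cball 0 R) x *\<^sub>R f x)"
    by (rule borel_integrable_compact) (auto intro: continuous_on_subset[OF assms(1)])
  moreover have "indicator (cball 0 R) x *\<^sub>R f x = f x" for x
    using assms(2)[of x] by (auto simp: indicator_def)
  ultimately show ?thesis by simp
qed

text \<open>Dominated convergence. With \<open>\<Omega>\<close> the whole space it yields
  integration by parts; with a domain it turns the integrated divergence into a limit of volume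
  differences.\<close>

lemma integral_difference_quotient:
  fixes \<psi> :: "'a::euclidean_space \<Rightarrow> real"
  assumes D: "\<And>x. (\<psi> has_derivative D x) (at x)" and contD: "continuous_on UNIV (\<lambda>x. D x b)"
    and zero: "\<And>x. x \<notin> cball 0 R \<Longrightarrow> \<psi> x = 0"
    and [measurable]: "\<Omega> \<in> sets lborel"
  shows "((\<lambda>n. LBINT x. indicator \<Omega> x * ((\<psi> (x + (1 / real (Suc n)) *\<^sub>R b) - \<psi> x) * real (Suc n)))
     \<longlonglongrightarrow> (LBINT x. indicator \<Omega> x * D x b))"
proof -
  define t where "t n = 1 / real (Suc n)" for n
  have t: "t n > 0" "t n \<le> 1" for n
    by (simp_all add: t_def)
  have tlim: "t \<longlonglongrightarrow> 0"
    unfolding t_def[abs_def] using LIMSEQ_inverse_real_of_nat by (simp only: inverse_eq_divide)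
  have "continuous_on UNIV \<psi>"
    by (intro continuous_at_imp_continuous_on ballI has_derivative_continuous[OF D])
  then have [measurable]: "\<psi> \<in> borel_measurable borel" "(\<lambda>x. D x b) \<in> borel_measurable borel"
    using contD by (auto intro: borel_measurable_continuous_onI)
  have line: "((\<lambda>s. \<psi> (x + s *\<^sub>R b)) has_real_derivative D (x + s *\<^sub>R b) b) (at s)" for x s
  proof -
    have "((\<lambda>s. x + s *\<^sub>R b) has_derivative (\<lambda>u. u *\<^sub>R b)) (at s)"
      by (auto intro!: derivative_eq_intros)
    from has_derivative_compose[OF this D]
    have "((\<lambda>s. \<psi> (x + s *\<^sub>R b)) has_derivative (\<lambda>u. D (x + s *\<^sub>R b) (u *\<^sub>R b))) (at s)" .
    moreover have "D (x + s *\<^sub>R b) (u *\<^sub>R b) = D (x + s *\<^sub>R b) b * u" for u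
      using has_derivative_bounded_linear[OF D] by (simp add: linear_simps)
    ultimately show ?thesis
      by (simp add: has_field_derivative_def)
  qed
  \<comment> \<open>The quotients vanish off the ball of radius \<open>R + norm b\<close>, and the
    mean value theorem evaluates the derivative up to \<open>norm b\<close> further out; hence the
    factor 2.\<close>
  have "bounded ((\<lambda>x. D x b) ` cball 0 (R + 2 * norm b))"
    by (intro compact_imp_bounded compact_continuous_image continuous_on_subset[OF contD]) auto
  then obtain K where K: "K > 0" "\<And>x. x \<in> cball 0 (R + 2 * norm b) \<Longrightarrow> \<bar>D x b\<bar> \<le> K"
    unfolding bounded_pos by auto
  have tb: "norm (s *\<^sub>R b) \<le> norm b" if "0 \<le> s" "s \<le> t n" for s n
    using that t(2)[of n] by (auto intro!: mult_left_le_one_le)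
  have bound: "\<bar>(\<psi> (x + t n *\<^sub>R b) - \<psi> x) * real (Suc n)\<bar> \<le> K * indicator (cball 0 (R + norm b)) x" for x n
  proof (cases "x \<in> cball 0 (R + norm b)")
    case True
    obtain z where z: "0 < z" "z < t n" "\<psi> (x + t n *\<^sub>R b) - \<psi> (x + 0 *\<^sub>R b) = (t n - 0) * D (x + z *\<^sub>R b) b"
      using MVT2[OF t(1)[of n], of "\<lambda>s. \<psi> (x + s *\<^sub>R b)" "\<lambda>s. D (x + s *\<^sub>R b) b"] line by blast
    have "norm (x + z *\<^sub>R b) \<le> R + norm b + norm b"
      using norm_triangle_ineq[of x "z *\<^sub>R b"] tb[of z n] z True by auto
    then have "\<bar>D (x + z *\<^sub>R b) b\<bar> \<le> K"
      by (intro K) auto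
    then show ?thesis
      using z(3) True by (simp add: t_def)
  next
    case False
    have "norm x \<le> norm (x + t n *\<^sub>R b) + norm (t n *\<^sub>R b)"
      using norm_triangle_ineq4[of "x + t n *\<^sub>R b" "t n *\<^sub>R b"] by simp
    then have "norm (x + t n *\<^sub>R b) > R" "norm x > R"
      using False tb[of "t n" n] t(1)[of n] norm_ge_zero[of b] by (auto simp: not_le simp del: norm_ge_zero norm_scaleR)
    then show ?thesis
      using zero[of x] zero[of "x + t n *\<^sub>R b"] K(1) by (auto simp: indicator_def)
  qed
  have "(\<lambda>n. LBINT x. indicator \<Omega> x * ((\<psi> (x + t n *\<^sub>R b) - \<psi> x) * real (Suc n)))
     \<longlonglongrightarrow> (LBINT x. indicator \<Omega> x * D x b)"
  proof (rule integral_dominated_convergence[where w = "\<lambda>x. K * indicator (cball 0 (R + norm b)) x"])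
    show "integrable lborel (\<lambda>x. K * indicator (cball 0 (R + norm b)) x)"
      using emeasure_lborel_cball_finite[of 0 "R + norm b"] by (auto intro!: integrable_real_indicator)
    show "AE x in lborel. (\<lambda>n. indicator \<Omega> x * ((\<psi> (x + t n *\<^sub>R b) - \<psi> x) * real (Suc n)))
         \<longlonglongrightarrow> indicator \<Omega> x * D x b"
    proof (rule AE_I2, rule tendsto_mult_left)
      fix x
      have "((\<lambda>h. (\<psi> (x + h *\<^sub>R b) - \<psi> x) / h) \<longlongrightarrow> D x b) (at 0)"
        using line[of x 0] by (simp add: DERIV_def)
      moreover have "filterlim t (at 0) sequentially"
        using t(1) tlim by (auto simp: filterlim_at intro!: always_eventually less_imp_neq[symmetric])
      ultimately have "(\<lambda>n. (\<psi> (x + t n *\<^sub>R b) - \<psi> x) / t n) \<longlonglongrightarrow> D x b"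
        by (rule filterlim_compose)
      then show "(\<lambda>n. (\<psi> (x + t n *\<^sub>R b) - \<psi> x) * real (Suc n)) \<longlonglongrightarrow> D x b"
        by (simp add: t_def)
    qed
    show "AE x in lborel. norm (indicator \<Omega> x * ((\<psi> (x + t n *\<^sub>R b) - \<psi> x) * real (Suc n)))
        \<le> K * indicator (cball 0 (R + norm b)) x" for n
    proof (rule AE_I2)
      fix x
      show "norm (indicator \<Omega> x * ((\<psi> (x + t n *\<^sub>R b) - \<psi> x) * real (Suc n)))
        \<le> K * indicator (cball 0 (R + norm b)) x"
        using bound[of x n] K(1) by (cases "x \<in> \<Omega>") auto
    qed
    show "(\<lambda>x. indicator \<Omega> x * ((\<psi> (x + t n *\<^sub>R b) - \<psi> x) * real (Suc n))) \<in> borel_measurable lborel" for n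
      by measurable
    show "(\<lambda>x. indicator \<Omega> x * D x b) \<in> borel_measurable lborel"
      by measurable
  qed
  then show ?thesis unfolding t_def .
qed

lemma integral_translate_lborel:
  fixes f :: "'a::euclidean_space \<Rightarrow> 'b::{banach, second_countable_topology}"
  assumes [measurable]: "f \<in> borel_measurable borel"
  shows "(LBINT x. f (x + c)) = (LBINT x. f x)"
proof -
  have "(LBINT x. f x) = (\<integral>x. f x \<partial>(distr lborel borel ((+) c)))"
    by (simp add: lborel_distr_plus)
  also have "\<dots> = (LBINT x. f (c + x))"
    by (rule integral_distr) auto
  finally show ?thesis by (simp add: add.commute)
qed

lemma integrable_translate_lborel:
  fixes f :: "'a::euclidean_space \<Rightarrow> 'b::{banach, second_countable_topology}"
  assumes "integrable lborel f"
  shows "integrable lborel (\<lambda>x. f (x + c))"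
proof -
  have "integrable (distr lborel borel ((+) c)) f"
    using assms by (simp add: lborel_distr_plus)
  then have "integrable lborel (\<lambda>x. f (c + x))"
    by (subst (asm) integrable_distr_eq) (use assms in auto)
  then show ?thesis by (simp add: add.commute)
qed

text \<open>By translation invariance every difference quotient has integral 0, and so has the
  limit. All integration by parts below comes from applying this to a product.\<close>

lemma integral_directional_derivative_eq_0:
  fixes \<psi> :: "'a::euclidean_space \<Rightarrow> real"
  assumes D: "\<And>x. (\<psi> has_derivative D x) (at x)" and contD: "continuous_on UNIV (\<lambda>x. D x b)"
    and zero: "\<And>x. x \<notin> cball 0 R \<Longrightarrow> \<psi> x = 0"
  shows "(LBINT x. D x b) = 0"
proof -
  have "continuous_on UNIV \<psi>"
    by (intro continuous_at_imp_continuous_on ballI has_derivative_continuous[OF D])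
  then have i: "integrable lborel \<psi>"
    using zero by (rule integrable_continuous_bounded_support)
  have "(LBINT x. indicator UNIV x * ((\<psi> (x + (1 / real (Suc n)) *\<^sub>R b) - \<psi> x) * real (Suc n))) = 0" for n
    using i integrable_translate_lborel[OF i] integral_translate_lborel[of \<psi>] by simp
  then show ?thesis
    using integral_difference_quotient[OF assms, where \<Omega> = UNIV] by (simp add: LIMSEQ_const_iff)
qed

subsection \<open>Test functions\<close>

lemma L2_tendsto_inner:
  assumes "\<And>n. sq_integrable M (f n)" "sq_integrable M g" "sq_integrable M h"
    and lim: "(\<lambda>n::nat. L2_norm M (\<lambda>x. f n x - g x)) \<longlonglongrightarrow> 0"
  shows "(\<lambda>n. \<integral>x. f n x \<bullet> h x \<partial>M) \<longlonglongrightarrow> (\<integral>x. g x \<bullet> h x \<partial>M)"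
proof -
  have "(\<lambda>n. (\<integral>x. f n x \<bullet> h x \<partial>M) - (\<integral>x. g x \<bullet> h x \<partial>M)) \<longlonglongrightarrow> 0"
  proof (rule Lim_null_comparison)
    show "(\<lambda>n. L2_norm M (\<lambda>x. f n x - g x) * L2_norm M h) \<longlonglongrightarrow> 0"
      using tendsto_mult_left_zero[OF lim] .
    have "(\<integral>x. f n x \<bullet> h x \<partial>M) - (\<integral>x. g x \<bullet> h x \<partial>M) = (\<integral>x. (f n x - g x) \<bullet> h x \<partial>M)" for n
      using assms by (simp add: sq_integrable_inner inner_diff_left)
    then show "\<forall>\<^sub>F n in sequentially. norm ((\<integral>x. f n x \<bullet> h x \<partial>M) - (\<integral>x. g x \<bullet> h x \<partial>M))
        \<le> L2_norm M (\<lambda>x. f n x - g x) * L2_norm M h"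
      using integral_Cauchy_Schwarz[OF sq_integrable_diff[OF assms(1,2)] assms(3)]
      by (intro always_eventually) simp
  qed
  then show ?thesis
    by (simp add: LIM_zero_iff)
qed

lemma L2_tendsto_norm:
  assumes "\<And>n. sq_integrable M (f n)" "sq_integrable M g"
    and lim: "(\<lambda>n::nat. L2_norm M (\<lambda>x. f n x - g x)) \<longlonglongrightarrow> 0"
  shows "(\<lambda>n. L2_norm M (f n)) \<longlonglongrightarrow> L2_norm M g"
proof -
  have "(\<lambda>n. L2_norm M (f n) - L2_norm M g) \<longlonglongrightarrow> 0"
    by (rule Lim_null_comparison[OF _ lim]) (use L2_norm_diff_ge[OF assms(1,2)] in auto)
  then show ?thesis
    by (simp add: LIM_zero_iff)
qed

lemma sq_integrable_continuous_bounded_support: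
  fixes f :: "'a::euclidean_space \<Rightarrow> 'b::euclidean_space"
  assumes "continuous_on UNIV f" "\<And>x. x \<notin> cball 0 R \<Longrightarrow> f x = 0"
  shows "sq_integrable lborel f"
  unfolding sq_integrable_def
proof
  show "f \<in> borel_measurable lborel"
    using assms(1) by (simp add: borel_measurable_continuous_onI)
  show "integrable lborel (\<lambda>x. (norm (f x))\<^sup>2)"
    by (rule integrable_continuous_bounded_support[where R = R])
      (auto intro!: continuous_intros assms)
qed

lemma inner_grad:
  assumes "f differentiable (at x)"
  shows "grad f x \<bullet> v = frechet_derivative f (at x) v"
proof -
  have lin: "linear (frechet_derivative f (at x))"
    using assms by (rule linear_frechet_derivative)
  have "frechet_derivative f (at x) v = frechet_derivative f (at x) (\<Sum>b\<in>Basis. (v \<bullet> b) *\<^sub>R b)"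
    by (simp add: euclidean_representation)
  also have "\<dots> = (\<Sum>b\<in>Basis. (v \<bullet> b) * frechet_derivative f (at x) b)"
    by (simp add: linear_sum[OF lin] linear_cmul[OF lin])
  finally show ?thesis
    by (simp add: grad_def inner_sum_right inner_commute[of _ v] mult.commute)
qed

lemma grad_eqI:
  assumes "(f has_derivative D) (at x)" "\<And>v. D v = w \<bullet> v"
  shows "grad f x = w"
proof (rule euclidean_eqI)
  fix b :: 'a
  have "f differentiable (at x)"
    using assms(1) by (auto simp: differentiable_def)
  then show "grad f x \<bullet> b = w \<bullet> b"
    using inner_grad[of f x b] frechet_derivative_at[OF assms(1)] assms(2) by simp
qed

lemma test_function_derivative:
  assumes "\<phi> \<in> test_functions \<Omega>"
  shows "(\<phi> has_derivative (\<lambda>v. grad \<phi> x \<bullet> v)) (at x)"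
proof -
  have "Ck_on 1 UNIV \<phi>"
    using assms by (auto simp: test_functions_def smooth_on_def)
  then have "\<phi> differentiable (at x)" by simp
  then show ?thesis
    by (simp add: inner_grad frechet_derivative_works)
qed

lemma test_function_continuous:
  assumes "\<phi> \<in> test_functions \<Omega>"
  shows "continuous_on UNIV \<phi>" "continuous_on UNIV (grad \<phi>)"
proof -
  have "Ck_on 0 UNIV \<phi>" "Ck_on 1 UNIV \<phi>"
    using assms unfolding test_functions_def smooth_on_def by blast+
  then show "continuous_on UNIV \<phi>" "continuous_on UNIV (grad \<phi>)"
    unfolding grad_def[abs_def] by (auto intro!: continuous_intros)
qed

lemma zero_outside_supp: "x \<notin> supp f \<Longrightarrow> f x = 0"
  using closure_subset[of "{x. f x \<noteq> 0}"] by (auto simp: supp_def)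

lemma closed_supp: "closed (supp f)"
  by (simp add: supp_def)

lemma grad_zero_outside_supp:
  assumes "x \<notin> supp f"
  shows "grad f x = 0"
proof (rule grad_eqI)
  have "open (- supp f)"
    by (simp add: supp_def open_Compl)
  then show "(f has_derivative (\<lambda>v. 0)) (at x)"
    by (rule has_derivative_transform_within_open[OF has_derivative_const])
      (use assms in \<open>auto simp: zero_outside_supp\<close>)
qed simp

lemma test_function_zero:
  assumes "\<phi> \<in> test_functions \<Omega>" "x \<notin> \<Omega>"
  shows "\<phi> x = 0" "grad \<phi> x = 0"
proof -
  have "x \<notin> supp \<phi>"
    using assms by (auto simp: test_functions_def)
  then show "\<phi> x = 0" "grad \<phi> x = 0"
    by (simp_all add: zero_outside_supp grad_zero_outside_supp)
qed

lemma test_function_bounded_support: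
  assumes "\<phi> \<in> test_functions \<Omega>"
  obtains R where "R > 0" "\<And>x. x \<notin> cball 0 R \<Longrightarrow> \<phi> x = 0" "\<And>x. x \<notin> cball 0 R \<Longrightarrow> grad \<phi> x = 0"
proof -
  have "bounded (supp \<phi>)"
    using assms compact_imp_bounded by (auto simp: test_functions_def)
  then obtain R where "R > 0" "\<forall>x\<in>supp \<phi>. norm x \<le> R"
    unfolding bounded_pos by blast
  then show ?thesis
    using zero_outside_supp grad_zero_outside_supp by (intro that[of R]) fastforce+
qed

lemma test_function_sq_integrable:
  assumes "\<phi> \<in> test_functions \<Omega>"
  shows "sq_integrable lborel \<phi>" "sq_integrable lborel (grad \<phi>)"
    "integrable lborel \<phi>" "integrable lborel (grad \<phi>)"
proof -
  obtain R where R: "\<And>x. x \<notin> cball 0 R \<Longrightarrow> \<phi> x = 0" "\<And>x. x \<notin> cball 0 R \<Longrightarrow> grad \<phi> x = 0"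
    using test_function_bounded_support[OF assms] by metis
  show "sq_integrable lborel \<phi>" "sq_integrable lborel (grad \<phi>)"
    "integrable lborel \<phi>" "integrable lborel (grad \<phi>)"
    using test_function_continuous[OF assms] R
    by (blast intro: sq_integrable_continuous_bounded_support integrable_continuous_bounded_support)+
qed

lemma test_functions_0: "(\<lambda>x. 0) \<in> test_functions \<Omega>"
proof -
  have "Ck_on k UNIV (\<lambda>x::'a. 0::real)" for k
    by (induction k) (auto intro: Ck_on_SucI[where D = "\<lambda>_ _. 0"])
  then show ?thesis
    by (simp add: test_functions_def smooth_on_def supp_def)
qed

lemma test_functions_add:
  assumes "\<phi> \<in> test_functions \<Omega>" "\<psi> \<in> test_functions \<Omega>"
  shows "(\<lambda>x. \<phi> x + \<psi> x) \<in> test_functions \<Omega>"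
    and "grad (\<lambda>x. \<phi> x + \<psi> x) = (\<lambda>x. grad \<phi> x + grad \<psi> x)"
proof -
  have cl: "closed (supp \<phi> \<union> supp \<psi>)"
    by (simp add: supp_def closed_Un)
  have "supp (\<lambda>x. \<phi> x + \<psi> x) \<subseteq> supp \<phi> \<union> supp \<psi>"
    unfolding supp_def[of "\<lambda>x. \<phi> x + \<psi> x"]
    by (rule closure_minimal[OF _ cl]) (auto intro: ccontr simp: zero_outside_supp)
  moreover have "compact (supp \<phi> \<union> supp \<psi>)"
    using assms by (auto simp: test_functions_def)
  ultimately have "compact (supp (\<lambda>x. \<phi> x + \<psi> x))" "supp (\<lambda>x. \<phi> x + \<psi> x) \<subseteq> \<Omega>"
    using compact_Int_closed[of "supp \<phi> \<union> supp \<psi>" "supp (\<lambda>x. \<phi> x + \<psi> x)"] assms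
    by (auto simp: test_functions_def closed_supp inf.absorb2)
  then show "(\<lambda>x. \<phi> x + \<psi> x) \<in> test_functions \<Omega>"
    using assms Ck_on_add[OF open_UNIV, of _ \<phi> \<psi>]
    by (simp add: test_functions_def smooth_on_def)
  show "grad (\<lambda>x. \<phi> x + \<psi> x) = (\<lambda>x. grad \<phi> x + grad \<psi> x)"
    by (rule ext, rule grad_eqI[OF has_derivative_add[OF test_function_derivative[OF assms(1)]
      test_function_derivative[OF assms(2)]]]) (simp add: inner_add_left)
qed

lemma test_functions_scale:
  assumes "\<phi> \<in> test_functions \<Omega>"
  shows "(\<lambda>x. c * \<phi> x) \<in> test_functions \<Omega>"
    and "grad (\<lambda>x. c * \<phi> x) = (\<lambda>x. c *\<^sub>R grad \<phi> x)"
proof -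
  have cl: "closed (supp \<phi>)"
    by (simp add: supp_def)
  have "supp (\<lambda>x. c * \<phi> x) \<subseteq> supp \<phi>"
    unfolding supp_def[of "\<lambda>x. c * \<phi> x"]
    by (rule closure_minimal[OF _ cl]) (auto intro: ccontr simp: zero_outside_supp)
  then show "(\<lambda>x. c * \<phi> x) \<in> test_functions \<Omega>"
    using assms Ck_on_scaleR[OF open_UNIV, of _ \<phi> c]
      compact_Int_closed[of "supp \<phi>" "supp (\<lambda>x. c * \<phi> x)"]
    by (auto simp: test_functions_def smooth_on_def closed_supp inf.absorb2)
  show "grad (\<lambda>x. c * \<phi> x) = (\<lambda>x. c *\<^sub>R grad \<phi> x)"
    by (rule ext, rule grad_eqI[OF has_derivative_mult_right[OF test_function_derivative[OF assms]]])
      simp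
qed

lemma test_function_integration_by_parts:
  assumes "\<phi> \<in> test_functions \<Omega>" "\<psi> \<in> test_functions \<Omega>"
  shows "(LBINT x. \<phi> x * (grad \<psi> x \<bullet> b)) = - (LBINT x. \<psi> x * (grad \<phi> x \<bullet> b))"
proof -
  obtain R where R: "\<And>x. x \<notin> cball 0 R \<Longrightarrow> \<phi> x = 0" "\<And>x. x \<notin> cball 0 R \<Longrightarrow> grad \<phi> x = 0"
    using test_function_bounded_support[OF assms(1)] by metis
  note c = test_function_continuous[OF assms(1)] test_function_continuous[OF assms(2)]
  have i: "integrable lborel (\<lambda>x. \<phi> x * (grad \<psi> x \<bullet> b))" "integrable lborel (\<lambda>x. \<psi> x * (grad \<phi> x \<bullet> b))"
    by (rule integrable_continuous_bounded_support[where R = R]; auto intro!: continuous_intros c simp: R)+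
  have "(LBINT x. \<phi> x * (grad \<psi> x \<bullet> b) + (grad \<phi> x \<bullet> b) * \<psi> x) = 0"
  proof (rule integral_directional_derivative_eq_0[where R = R and b = b and
        D = "\<lambda>x v. \<phi> x * (grad \<psi> x \<bullet> v) + (grad \<phi> x \<bullet> v) * \<psi> x"])
    show "((\<lambda>x. \<phi> x * \<psi> x) has_derivative (\<lambda>v. \<phi> x * (grad \<psi> x \<bullet> v) + (grad \<phi> x \<bullet> v) * \<psi> x)) (at x)" for x
      by (intro has_derivative_mult test_function_derivative[OF assms(1)] test_function_derivative[OF assms(2)])
  qed (auto intro!: continuous_intros c simp: R)
  then show ?thesis
    using i by (simp add: mult.commute)
qed

text \<open>Differentiate \<phi>^2 (x . b) along one coordinate vector b: its integral being 0, the
  integral of \<phi>^2 is minus twice that of \<phi> (x . b) (grad \<phi> . b). As |x . b| \<le> R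
  on the support, Cauchy-Schwarz applies and one factor of the norm of \<phi> cancels.\<close>

lemma Poincare:
  fixes \<Omega> :: "'a::euclidean_space set"
  assumes \<phi>: "\<phi> \<in> test_functions \<Omega>" and \<Omega>: "\<Omega> \<subseteq> cball 0 R" and "R \<ge> 0"
  shows "L2_norm lborel \<phi> \<le> 2 * R * L2_norm lborel (grad \<phi>)"
proof -
  note c = test_function_continuous[OF \<phi>] and d = test_function_derivative[OF \<phi>]
  have z: "\<phi> x = 0" "grad \<phi> x = 0" if "x \<notin> cball 0 R" for x
    using that \<Omega> by (auto intro!: test_function_zero[OF \<phi>] simp del: mem_cball)
  obtain b :: 'a where b: "b \<in> Basis"
    using nonempty_Basis by blast
  have i: "integrable lborel (\<lambda>x. 2 * \<phi> x * (x \<bullet> b) * (grad \<phi> x \<bullet> b))" "integrable lborel (\<lambda>x. (\<phi> x)\<^sup>2)"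
    "integrable lborel (\<lambda>x. norm (\<phi> x) * norm (grad \<phi> x))"
    by (rule integrable_continuous_bounded_support[where R = R]; auto intro!: continuous_intros c simp: z)+
  have "(LBINT x. (\<phi> x * \<phi> x) * (b \<bullet> b) + (\<phi> x * (grad \<phi> x \<bullet> b) + (grad \<phi> x \<bullet> b) * \<phi> x) * (x \<bullet> b)) = 0"
  proof (rule integral_directional_derivative_eq_0[where R = R and b = b and
        D = "\<lambda>x v. (\<phi> x * \<phi> x) * (v \<bullet> b) + (\<phi> x * (grad \<phi> x \<bullet> v) + (grad \<phi> x \<bullet> v) * \<phi> x) * (x \<bullet> b)"])
    show "((\<lambda>x. (\<phi> x * \<phi> x) * (x \<bullet> b)) has_derivative
      (\<lambda>v. (\<phi> x * \<phi> x) * (v \<bullet> b) + (\<phi> x * (grad \<phi> x \<bullet> v) + (grad \<phi> x \<bullet> v) * \<phi> x) * (x \<bullet> b))) (at x)" for x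
      by (intro has_derivative_mult d bounded_linear_imp_has_derivative bounded_linear_inner_left)
  qed (auto intro!: continuous_intros c simp: z)
  also have "(\<lambda>x. (\<phi> x * \<phi> x) * (b \<bullet> b) + (\<phi> x * (grad \<phi> x \<bullet> b) + (grad \<phi> x \<bullet> b) * \<phi> x) * (x \<bullet> b))
      = (\<lambda>x. (\<phi> x)\<^sup>2 + 2 * \<phi> x * (x \<bullet> b) * (grad \<phi> x \<bullet> b))"
    using b by (simp add: fun_eq_iff power2_eq_square algebra_simps inner_Basis)
  finally have "(LBINT x. (\<phi> x)\<^sup>2) = - (LBINT x. 2 * \<phi> x * (x \<bullet> b) * (grad \<phi> x \<bullet> b))"
    using i by simp
  also have "\<dots> \<le> (LBINT x. 2 * R * (norm (\<phi> x) * norm (grad \<phi> x)))"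
    unfolding Bochner_Integration.integral_minus[symmetric]
  proof (rule integral_mono)
    fix x
    show "- (2 * \<phi> x * (x \<bullet> b) * (grad \<phi> x \<bullet> b)) \<le> 2 * R * (norm (\<phi> x) * norm (grad \<phi> x))"
    proof (cases "x \<in> cball 0 R")
      case True
      have "\<bar>\<phi> x * (x \<bullet> b) * (grad \<phi> x \<bullet> b)\<bar> \<le> (norm (\<phi> x) * R) * norm (grad \<phi> x)"
        unfolding abs_mult using True b Basis_le_norm[OF b, of x] Basis_le_norm[OF b, of "grad \<phi> x"]
        by (intro mult_mono) auto
      then have "- (\<phi> x * (x \<bullet> b) * (grad \<phi> x \<bullet> b)) \<le> R * (norm (\<phi> x) * norm (grad \<phi> x))"
        by (simp add: abs_le_iff mult.assoc mult.left_commute[of R])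
      then show ?thesis by (simp add: mult.assoc)
    qed (simp add: z)
  qed (use i in auto)
  also have "\<dots> = 2 * R * (LBINT x. norm (\<phi> x) \<bullet> norm (grad \<phi> x))"
    by simp
  also have "\<dots> \<le> 2 * R * (L2_norm lborel \<phi> * L2_norm lborel (grad \<phi>))"
    using integral_Cauchy_Schwarz[OF sq_integrable_norm sq_integrable_norm, OF test_function_sq_integrable(1,2)[OF \<phi>]]
      \<open>R \<ge> 0\<close> unfolding L2_norm_norm by (intro mult_left_mono) auto
  finally have "L2_norm lborel \<phi> * L2_norm lborel \<phi> \<le> 2 * R * L2_norm lborel (grad \<phi>) * L2_norm lborel \<phi>"
    using L2_norm_power2[of lborel \<phi>] by (simp add: power2_eq_square ac_simps)
  then show ?thesis
    using L2_norm_nonneg[of lborel \<phi>] \<open>R \<ge> 0\<close>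
    by (cases "L2_norm lborel \<phi> = 0") (auto simp: mult_le_cancel_right)
qed

subsection \<open>Existence of the torsion function\<close>

lemma scaleR_indicator_outside:
  fixes f :: "'a \<Rightarrow> 'b::real_vector"
  shows "(\<And>x. x \<notin> \<Omega> \<Longrightarrow> f x = 0) \<Longrightarrow> indicator \<Omega> x *\<^sub>R f x = f x"
  by (cases "x \<in> \<Omega>") auto

lemma L2_on_iff: "L2_on \<Omega> u \<longleftrightarrow> sq_integrable lborel (\<lambda>x. indicator \<Omega> x *\<^sub>R u x)"
proof -
  have "(norm (indicator \<Omega> x *\<^sub>R u x))\<^sup>2 = indicator \<Omega> x *\<^sub>R (norm (u x))\<^sup>2" for x
    by (simp add: indicator_def)
  then show ?thesis
    by (simp add: L2_on_def sq_integrable_def set_borel_measurable_def set_integrable_def)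
qed

text \<open>Extracts the Euler-Lagrange equation from minimality: \<open>L\<close> is the first
  variation in some direction and \<open>q\<close> the second.\<close>

lemma linear_term_eq_0:
  fixes L q :: real
  assumes nonneg: "\<And>c. 0 \<le> c * L + c\<^sup>2 * q / 2" and "q \<ge> 0"
  shows "L = 0"
proof -
  \<comment> \<open>The denominator q + 1 instead of q treats q = 0 along with the rest; the
    quadratic takes the value -L^2 (q/2 + 1)/(q + 1)^2 here.\<close>
  define c where "c = - L / (q + 1)"
  have c: "c * (q + 1) = - L"
    using \<open>q \<ge> 0\<close> by (simp add: c_def)
  have "0 \<le> (c * L + c\<^sup>2 * q / 2) * (q + 1)\<^sup>2"
    using nonneg by simp
  also have "\<dots> = (c * (q + 1)) * L * (q + 1) + (c * (q + 1))\<^sup>2 * q / 2"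
    by (simp add: power2_eq_square algebra_simps)
  also have "\<dots> = - (L\<^sup>2 * (q / 2 + 1))"
    unfolding c by (simp add: power2_eq_square algebra_simps)
  finally have "L\<^sup>2 * (q / 2 + 1) \<le> 0" by simp
  then show ?thesis
    using \<open>q \<ge> 0\<close> by (simp add: mult_le_0_iff)
qed

text \<open>Boundedness enters through the Poincare inequality, twice: it bounds the energy
  \<open>J\<close> from below, and it makes the functions of a minimising sequence Cauchy as soon as
  their gradients are.\<close>

lemma torsion_function_exists:
  fixes \<Omega> :: "'a::euclidean_space set"
  assumes "open \<Omega>" and bdd: "bounded \<Omega>"
  shows "\<exists>u g. torsion_function \<Omega> u g"
proof -
  define E where "E = test_functions \<Omega>"
  define J where "J \<phi> = (L2_norm lborel (grad \<phi>))\<^sup>2 / 2 - (LBINT x. \<phi> x)" for \<phi> :: "'a \<Rightarrow> real"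
  obtain R where R: "R > 0" "\<Omega> \<subseteq> cball 0 R"
    using bdd unfolding bounded_pos by (auto simp: subset_iff)
  have \<Omega>: "\<Omega> \<in> sets lborel" "emeasure lborel \<Omega> < \<infinity>"
    using assms(1) emeasure_bounded_finite[OF bdd] by auto
  have sq: "sq_integrable lborel \<phi>" "sq_integrable lborel (grad \<phi>)" "integrable lborel \<phi>"
    if "\<phi> \<in> E" for \<phi>
    using test_function_sq_integrable that by (auto simp: E_def)
  have zero: "\<phi> x = 0" "grad \<phi> x = 0" if "\<phi> \<in> E" "x \<notin> \<Omega>" for \<phi> x
    using test_function_zero that by (auto simp: E_def)
  have Poin: "L2_norm lborel \<phi> \<le> 2 * R * L2_norm lborel (grad \<phi>)" if "\<phi> \<in> E" for \<phi>
    using Poincare[OF _ R(2)] R(1) that by (simp add: E_def)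
  have comb: "(\<lambda>x. \<phi> x + c * \<psi> x) \<in> E" "grad (\<lambda>x. \<phi> x + c * \<psi> x) = (\<lambda>x. grad \<phi> x + c *\<^sub>R grad \<psi> x)"
    if "\<phi> \<in> E" "\<psi> \<in> E" for \<phi> \<psi> c
    using that test_functions_add[of \<phi> \<Omega> "\<lambda>x. c * \<psi> x"] test_functions_scale[of \<psi> \<Omega> c]
    by (simp_all add: E_def)
  have Jcomb: "J (\<lambda>x. \<phi> x + c * \<psi> x) = J \<phi>
      + c * ((LBINT x. grad \<phi> x \<bullet> grad \<psi> x) - (LBINT x. \<psi> x)) + c\<^sup>2 * (L2_norm lborel (grad \<psi>))\<^sup>2 / 2"
    if "\<phi> \<in> E" "\<psi> \<in> E" for \<phi> \<psi> c
    using sq that unfolding J_def comb(2)[OF that]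
    by (simp add: L2_norm_add_scaled algebra_simps add_divide_distrib)

  define K where "K = sqrt (measure lborel \<Omega>) * (2 * R)"
  \<comment> \<open>With G the norm of the gradient, the linear term is at most K G, and G^2/2 - K G
    \<ge> -K^2/2.\<close>
  have J_ge: "J \<phi> \<ge> - (K\<^sup>2 / 2)" if "\<phi> \<in> E" for \<phi>
  proof -
    have "(LBINT x. \<phi> x) \<le> (LBINT x. norm (\<phi> x))"
      using sq[OF that] by (intro integral_mono) auto
    also have "\<dots> \<le> sqrt (measure lborel \<Omega>) * L2_norm lborel \<phi>"
      by (rule integral_norm_le_L2_norm(2)[OF sq(1)[OF that] \<Omega> zero(1)[OF that]])
    also have "\<dots> \<le> K * L2_norm lborel (grad \<phi>)"
      using mult_left_mono[OF Poin[OF that], of "sqrt (measure lborel \<Omega>)"]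
      by (simp add: K_def mult.assoc)
    finally have "(LBINT x. \<phi> x) \<le> K * L2_norm lborel (grad \<phi>)" .
    moreover have "0 \<le> (L2_norm lborel (grad \<phi>) - K)\<^sup>2" by simp
    ultimately show ?thesis
      by (simp add: J_def power2_diff algebra_simps)
  qed
  define m where "m = (INF \<phi>\<in>E. J \<phi>)"
  have E0: "(\<lambda>x. 0) \<in> E"
    by (simp add: E_def test_functions_0)
  have bddJ: "bdd_below (J ` E)"
    using J_ge by (intro bdd_belowI2)
  have m_le: "m \<le> J \<phi>" if "\<phi> \<in> E" for \<phi>
    unfolding m_def using bddJ that by (rule cINF_lower)
  have "\<exists>\<phi>\<in>E. J \<phi> < m + 1 / real (Suc n)" for n
  proof -
    have "Inf (J ` E) < m + 1 / real (Suc n)"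
      unfolding m_def by simp
    then show ?thesis
      using cInf_less_iff[of "J ` E" "m + 1 / real (Suc n)"] E0 bddJ by blast
  qed
  then obtain \<phi> where \<phi>: "\<phi> n \<in> E" "J (\<phi> n) < m + 1 / real (Suc n)" for n
    by metis

  \<comment> \<open>Compare with the midpoint: its energy is the mean of the two energies minus
    \<open>?q / 8\<close>. The midpoint has energy at least \<open>m\<close> and the mean is at most
    m + 1/(N + 1), so \<open>?q\<close> is at most 8/(N + 1).\<close>
  have par: "(L2_norm lborel (\<lambda>x. grad (\<phi> i) x - grad (\<phi> j) x))\<^sup>2 \<le> 8 / real (Suc N)"
    if "i \<ge> N" "j \<ge> N" for i j N
  proof -
    have dE: "(\<lambda>x. \<phi> j x + (-1) * \<phi> i x) \<in> E"
      "grad (\<lambda>x. \<phi> j x + (-1) * \<phi> i x) = (\<lambda>x. grad (\<phi> j) x + (-1) *\<^sub>R grad (\<phi> i) x)"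
      using comb[OF \<phi>(1)[of j] \<phi>(1)[of i], of "-1"] by auto
    let ?\<delta> = "\<lambda>x. \<phi> j x + (-1) * \<phi> i x"
    let ?L = "(LBINT x. grad (\<phi> i) x \<bullet> grad ?\<delta> x) - (LBINT x. ?\<delta> x)"
    let ?q = "(L2_norm lborel (grad ?\<delta>))\<^sup>2"
    have "(\<lambda>x. \<phi> i x + 1 * ?\<delta> x) = \<phi> j" by auto
    then have 1: "J (\<phi> j) = J (\<phi> i) + ?L + ?q / 2"
      using Jcomb[OF \<phi>(1)[of i] dE(1), of 1] by simp
    have 2: "m \<le> J (\<phi> i) + 1/2 * ?L + (1/2)\<^sup>2 * ?q / 2"
      using Jcomb[OF \<phi>(1)[of i] dE(1), of "1/2"] m_le[OF comb(1)[OF \<phi>(1)[of i] dE(1), of "1/2"]] by simp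
    have "1 / real (Suc i) \<le> 1 / real (Suc N)" "1 / real (Suc j) \<le> 1 / real (Suc N)"
      using that by (auto intro!: divide_left_mono)
    then have 3: "J (\<phi> i) \<le> m + 1 / real (Suc N)" "J (\<phi> j) \<le> m + 1 / real (Suc N)"
      using \<phi>(2)[of i] \<phi>(2)[of j] by linarith+
    have "?q \<le> 8 * (1 / real (Suc N))"
    proof -
      have "(1/2)\<^sup>2 * q / 2 = q / 8" for q :: real
        by (simp add: power2_eq_square)
      from 2[unfolded this] 1 3 show ?thesis by argo
    qed
    moreover have "?q = (L2_norm lborel (\<lambda>x. grad (\<phi> i) x - grad (\<phi> j) x))\<^sup>2"
      unfolding dE(2) by (simp add: L2_norm_diff_commute[of _ "grad (\<phi> i)"])
    ultimately show ?thesis by simp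
  qed
  have cauchy_g: "\<exists>N. \<forall>i\<ge>N. \<forall>j\<ge>N. L2_norm lborel (\<lambda>x. grad (\<phi> i) x - grad (\<phi> j) x) < e"
    if "e > 0" for e
  proof -
    obtain N where N: "8 / e\<^sup>2 < real N"
      using reals_Archimedean2 by blast
    then have "8 < real (Suc N) * e\<^sup>2"
      using \<open>e > 0\<close> by (simp add: field_simps add_strict_increasing)
    then have "8 / real (Suc N) < e\<^sup>2"
      by (simp add: divide_less_eq mult.commute del: of_nat_Suc)
    then have "L2_norm lborel (\<lambda>x. grad (\<phi> i) x - grad (\<phi> j) x) < e" if "i \<ge> N" "j \<ge> N" for i j
      using par[OF that] \<open>e > 0\<close> by (intro power2_less_imp_less[of _ e]) auto
    then show ?thesis by blast
  qed
  obtain g where g: "sq_integrable lborel g" "\<And>x. x \<notin> \<Omega> \<Longrightarrow> g x = 0"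
    "(\<lambda>n. L2_norm lborel (\<lambda>x. grad (\<phi> n) x - g x)) \<longlonglongrightarrow> 0"
    using L2_complete[of lborel "\<lambda>n. grad (\<phi> n)" \<Omega>] sq(2)[OF \<phi>(1)] zero(2)[OF \<phi>(1)] \<Omega> cauchy_g
    by blast
  have cauchy_u: "\<exists>N. \<forall>i\<ge>N. \<forall>j\<ge>N. L2_norm lborel (\<lambda>x. \<phi> i x - \<phi> j x) < e"
    if "e > 0" for e
  proof -
    obtain N where N: "\<forall>i\<ge>N. \<forall>j\<ge>N. L2_norm lborel (\<lambda>x. grad (\<phi> i) x - grad (\<phi> j) x) < e / (2 * R)"
      using cauchy_g[of "e / (2 * R)"] \<open>e > 0\<close> R by auto
    have "L2_norm lborel (\<lambda>x. \<phi> i x - \<phi> j x) < e" if "i \<ge> N" "j \<ge> N" for i j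
    proof -
      have "L2_norm lborel (\<lambda>x. \<phi> i x - \<phi> j x)
          \<le> 2 * R * L2_norm lborel (\<lambda>x. grad (\<phi> i) x - grad (\<phi> j) x)"
        using Poin[OF comb(1)[OF \<phi>(1)[of i] \<phi>(1)[of j], of "-1"]]
        unfolding comb(2)[OF \<phi>(1)[of i] \<phi>(1)[of j]] by simp
      also have "\<dots> < 2 * R * (e / (2 * R))"
        using N that R by (intro mult_strict_left_mono) auto
      finally show ?thesis using R by simp
    qed
    then show ?thesis by blast
  qed
  obtain u where u: "sq_integrable lborel u" "\<And>x. x \<notin> \<Omega> \<Longrightarrow> u x = 0"
    "(\<lambda>n. L2_norm lborel (\<lambda>x. \<phi> n x - u x)) \<longlonglongrightarrow> 0"
    using L2_complete[of lborel \<phi> \<Omega>] sq(1)[OF \<phi>(1)] zero(1)[OF \<phi>(1)] \<Omega> cauchy_u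
    by blast

  have L2: "L2_on \<Omega> u" "L2_on \<Omega> g"
  proof -
    have "indicator \<Omega> x *\<^sub>R u x = u x" "indicator \<Omega> x *\<^sub>R g x = g x" for x
      by (rule scaleR_indicator_outside; simp add: u(2) g(2))+
    then show "L2_on \<Omega> u" "L2_on \<Omega> g"
      using u(1) g(1) by (simp_all only: L2_on_iff)
  qed
  \<comment> \<open>Each \<open>\<phi> n\<close> satisfies the identity by integration by parts, and
    L^2 convergence preserves it. One coordinate \<open>b\<close> at a time is tested, because
    \<open>L2_tendsto_inner\<close> concerns scalar integrals.\<close>
  have weak: "(LINT x:\<Omega>|lborel. u x *\<^sub>R grad \<psi> x) = - (LINT x:\<Omega>|lborel. \<psi> x *\<^sub>R g x)"
    if \<psi>: "\<psi> \<in> E" for \<psi>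
  proof (rule euclidean_eqI)
    fix b :: 'a
    obtain S where S: "\<And>x. x \<notin> cball 0 S \<Longrightarrow> \<psi> x = 0" "\<And>x. x \<notin> cball 0 S \<Longrightarrow> grad \<psi> x = 0"
      using test_function_bounded_support[of \<psi> \<Omega>] \<psi> unfolding E_def by metis
    have c: "continuous_on UNIV \<psi>" "continuous_on UNIV (grad \<psi>)"
      using test_function_continuous \<psi> by (auto simp: E_def)
    have sqb: "sq_integrable lborel (\<lambda>x. grad \<psi> x \<bullet> c)" "sq_integrable lborel (\<lambda>x. \<psi> x *\<^sub>R c)" for c
      by (rule sq_integrable_continuous_bounded_support[where R = S]; auto intro!: continuous_intros c simp: S)+
    have bI: "(LBINT x. f x) \<bullet> b = (LBINT x. f x \<bullet> b)"
      if "\<And>c. integrable lborel (\<lambda>x. f x \<bullet> c)" for f :: "'a \<Rightarrow> 'a"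
    proof -
      have "integrable lborel (\<lambda>x. \<Sum>c\<in>Basis. (f x \<bullet> c) *\<^sub>R c)"
        by (intro Bochner_Integration.integrable_sum integrable_scaleR_left that)
      then have "integrable lborel f"
        by (simp add: euclidean_representation)
      then show ?thesis by simp
    qed
    have i1: "integrable lborel (\<lambda>x. u x *\<^sub>R grad \<psi> x \<bullet> c)" for c
      using sq_integrable_inner[OF u(1) sqb(1)[of c]] by simp
    have i2: "integrable lborel (\<lambda>x. \<psi> x *\<^sub>R g x \<bullet> c)" for c
      using sq_integrable_inner[OF g(1) sqb(2)[of c]] by simp
    have l1: "(\<lambda>n. LBINT x. \<phi> n x \<bullet> (grad \<psi> x \<bullet> b)) \<longlonglongrightarrow> (LBINT x. u x \<bullet> (grad \<psi> x \<bullet> b))"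
      by (rule L2_tendsto_inner[OF sq(1)[OF \<phi>(1)] u(1) sqb(1) u(3)])
    have l2: "(\<lambda>n. LBINT x. grad (\<phi> n) x \<bullet> (\<psi> x *\<^sub>R b)) \<longlonglongrightarrow> (LBINT x. g x \<bullet> (\<psi> x *\<^sub>R b))"
      by (rule L2_tendsto_inner[OF sq(2)[OF \<phi>(1)] g(1) sqb(2) g(3)])
    have l3: "(LBINT x. \<phi> n x \<bullet> (grad \<psi> x \<bullet> b)) = - (LBINT x. grad (\<phi> n) x \<bullet> (\<psi> x *\<^sub>R b))" for n
      using test_function_integration_by_parts[of "\<phi> n" \<Omega> \<psi> b] \<phi>(1)[of n] \<psi> by (simp add: E_def)
    have eq: "(LBINT x. u x \<bullet> (grad \<psi> x \<bullet> b)) = - (LBINT x. g x \<bullet> (\<psi> x *\<^sub>R b))"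
      by (rule LIMSEQ_unique[OF l1[unfolded l3] tendsto_minus[OF l2]])
    show "(LINT x:\<Omega>|lborel. u x *\<^sub>R grad \<psi> x) \<bullet> b = (- (LINT x:\<Omega>|lborel. \<psi> x *\<^sub>R g x)) \<bullet> b"
    proof -
      have ind: "indicator \<Omega> x *\<^sub>R (u x *\<^sub>R grad \<psi> x) = u x *\<^sub>R grad \<psi> x"
        "indicator \<Omega> x *\<^sub>R (\<psi> x *\<^sub>R g x) = \<psi> x *\<^sub>R g x" for x
        by (rule scaleR_indicator_outside; simp add: u(2) g(2))+
      then show ?thesis
        using eq unfolding set_lebesgue_integral_def inner_minus_left ind bI[OF i1] bI[OF i2] by simp
    qed
  qed
  have conv: "(\<lambda>n. (LINT x:\<Omega>|lborel. (\<phi> n x - u x)\<^sup>2) + (LINT x:\<Omega>|lborel. (norm (grad (\<phi> n) x - g x))\<^sup>2)) \<longlonglongrightarrow> 0"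
  proof -
    have "(\<lambda>n. (L2_norm lborel (\<lambda>x. \<phi> n x - u x))\<^sup>2 + (L2_norm lborel (\<lambda>x. grad (\<phi> n) x - g x))\<^sup>2) \<longlonglongrightarrow> 0\<^sup>2 + 0\<^sup>2"
      by (intro tendsto_intros u g)
    moreover have "(LINT x:\<Omega>|lborel. (\<phi> n x - u x)\<^sup>2) = (L2_norm lborel (\<lambda>x. \<phi> n x - u x))\<^sup>2" for n
      unfolding L2_norm_power2 set_lebesgue_integral_def
      by (subst scaleR_indicator_outside) (use u zero[OF \<phi>(1)] in auto)
    moreover have "(LINT x:\<Omega>|lborel. (norm (grad (\<phi> n) x - g x))\<^sup>2) = (L2_norm lborel (\<lambda>x. grad (\<phi> n) x - g x))\<^sup>2" for n
      unfolding L2_norm_power2 set_lebesgue_integral_def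
      by (subst scaleR_indicator_outside) (use g zero[OF \<phi>(1)] in auto)
    ultimately show ?thesis by simp
  qed
  have EL: "(LINT x:\<Omega>|lborel. g x \<bullet> grad \<psi> x) = (LINT x:\<Omega>|lborel. \<psi> x)" if \<psi>: "\<psi> \<in> E" for \<psi>
  proof -
    let ?L = "(LBINT x. g x \<bullet> grad \<psi> x) - (LBINT x. \<psi> x)"
    let ?q = "(L2_norm lborel (grad \<psi>))\<^sup>2"
    \<comment> \<open>That \<open>u\<close> itself minimises \<open>J\<close> is never shown.
      Subtracting J(\<phi>_n) < m + 1/(n + 1) from the expansion of m \<le> J(\<phi>_n + c \<psi>)
      leaves the two variations and an error that vanishes in the limit.\<close>
    have pos: "0 \<le> c * ?L + c\<^sup>2 * ?q / 2" for c
    proof (rule LIMSEQ_le_const)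
      have "(\<lambda>n. 1 / real (Suc n)) \<longlonglongrightarrow> 0"
        using LIMSEQ_inverse_real_of_nat by (simp only: inverse_eq_divide)
      then have "(\<lambda>n. 1 / real (Suc n) + c * ((LBINT x. grad (\<phi> n) x \<bullet> grad \<psi> x) - (LBINT x. \<psi> x)) + c\<^sup>2 * ?q / 2)
          \<longlonglongrightarrow> 0 + c * ?L + c\<^sup>2 * ?q / 2"
        by (intro tendsto_add tendsto_mult tendsto_diff tendsto_const
            L2_tendsto_inner[OF sq(2)[OF \<phi>(1)] g(1) sq(2)[OF \<psi>] g(3)])
      then      show "(\<lambda>n. 1 / real (Suc n) + c * ((LBINT x. grad (\<phi> n) x \<bullet> grad \<psi> x) - (LBINT x. \<psi> x)) + c\<^sup>2 * ?q / 2)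
          \<longlonglongrightarrow> c * ?L + c\<^sup>2 * ?q / 2"
        by simp
      have A: "m \<le> J (\<phi> n) + c * ((LBINT x. grad (\<phi> n) x \<bullet> grad \<psi> x) - (LBINT x. \<psi> x)) + c\<^sup>2 * ?q / 2" for n
        using m_le[OF comb(1)[OF \<phi>(1) \<psi>]] Jcomb[OF \<phi>(1) \<psi>] by simp
      have "0 \<le> 1 / real (Suc n) + c * ((LBINT x. grad (\<phi> n) x \<bullet> grad \<psi> x) - (LBINT x. \<psi> x)) + c\<^sup>2 * ?q / 2" for n
        using A[of n] \<phi>(2)[of n] by linarith
      then show "\<exists>N. \<forall>n\<ge>N. 0 \<le> 1 / real (Suc n)
          + c * ((LBINT x. grad (\<phi> n) x \<bullet> grad \<psi> x) - (LBINT x. \<psi> x)) + c\<^sup>2 * ?q / 2"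
        by blast
    qed
    have "?L = 0"
      using pos by (rule linear_term_eq_0) simp
    then show ?thesis
    proof -
      have ind: "indicator \<Omega> x *\<^sub>R (g x \<bullet> grad \<psi> x) = g x \<bullet> grad \<psi> x"
        "indicator \<Omega> x *\<^sub>R \<psi> x = \<psi> x" for x
        by (rule scaleR_indicator_outside; simp add: g(2) zero[OF \<psi>])+
      with \<open>?L = 0\<close> show ?thesis
        unfolding set_lebesgue_integral_def ind by simp
    qed
  qed
  have "torsion_function \<Omega> u g"
    unfolding torsion_function_def H10_def H1_def
    using L2 weak conv EL \<phi>(1) unfolding E_def by blast
  then show ?thesis by blast
qed

subsection \<open>Torsional rigidity\<close>

text \<open>Extension by zero turns convergence in H^1(\<Omega>) into L^2 convergence over the whole
  space; a sum of two squares tends to 0 only if both terms do.\<close>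

lemma H10_approx:
  assumes "H10 \<Omega> u g"
  obtains \<phi> where "\<And>n::nat. \<phi> n \<in> test_functions \<Omega>"
    "(\<lambda>n. L2_norm lborel (\<lambda>x. \<phi> n x - indicator \<Omega> x *\<^sub>R u x)) \<longlonglongrightarrow> 0"
    "(\<lambda>n. L2_norm lborel (\<lambda>x. grad (\<phi> n) x - indicator \<Omega> x *\<^sub>R g x)) \<longlonglongrightarrow> 0"
proof -
  let ?u = "\<lambda>x. indicator \<Omega> x *\<^sub>R u x" and ?g = "\<lambda>x. indicator \<Omega> x *\<^sub>R g x"
  obtain \<phi> where \<phi>: "\<And>n::nat. \<phi> n \<in> test_functions \<Omega>"
    and lim: "(\<lambda>n. (LINT x:\<Omega>|lborel. (\<phi> n x - u x)\<^sup>2)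
                + (LINT x:\<Omega>|lborel. (norm (grad (\<phi> n) x - g x))\<^sup>2)) \<longlonglongrightarrow> 0"
    using assms unfolding H10_def by blast
  have "indicator \<Omega> x *\<^sub>R (\<phi> n x - u x)\<^sup>2 = (norm (\<phi> n x - ?u x))\<^sup>2"
    "indicator \<Omega> x *\<^sub>R (norm (grad (\<phi> n) x - g x))\<^sup>2 = (norm (grad (\<phi> n) x - ?g x))\<^sup>2" for n x
    by (cases "x \<in> \<Omega>"; simp add: test_function_zero[OF \<phi>])+
  then have lim: "(\<lambda>n. (L2_norm lborel (\<lambda>x. \<phi> n x - ?u x))\<^sup>2
      + (L2_norm lborel (\<lambda>x. grad (\<phi> n) x - ?g x))\<^sup>2) \<longlonglongrightarrow> 0"
    using lim unfolding L2_norm_power2 set_lebesgue_integral_def by simp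
  have sqz: "a \<longlonglongrightarrow> 0" if "(\<lambda>n. (a n)\<^sup>2 + (b n)\<^sup>2) \<longlonglongrightarrow> 0" for a b :: "nat \<Rightarrow> real"
  proof -
    have "(\<lambda>n. (a n)\<^sup>2) \<longlonglongrightarrow> 0"
      by (rule Lim_null_comparison[OF _ that]) auto
    then show ?thesis by (simp add: power_tendsto_0_iff)
  qed
  have "(\<lambda>n. (L2_norm lborel (\<lambda>x. grad (\<phi> n) x - ?g x))\<^sup>2
      + (L2_norm lborel (\<lambda>x. \<phi> n x - ?u x))\<^sup>2) \<longlonglongrightarrow> 0"
    using lim by (subst add.commute)
  then show ?thesis
    by (rule that[OF \<phi> sqz[OF lim] sqz])
qed

text \<open>Test the equation of \<open>v\<close> with functions approximating \<open>u\<close>: the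
  integral of \<open>u\<close> becomes that of g . h. This is symmetric in the two solutions, so all
  solutions have the same integral, and their equality almost everywhere need not be proved.\<close>

lemma torsion_function_cross:
  fixes \<Omega> :: "'a::euclidean_space set"
  assumes \<Omega>: "\<Omega> \<in> sets lborel" "emeasure lborel \<Omega> < \<infinity>"
    and "torsion_function \<Omega> u g" "torsion_function \<Omega> v h"
    and \<phi>: "\<And>n::nat. \<phi> n \<in> test_functions \<Omega>"
    "(\<lambda>n. L2_norm lborel (\<lambda>x. \<phi> n x - indicator \<Omega> x *\<^sub>R u x)) \<longlonglongrightarrow> 0"
    "(\<lambda>n. L2_norm lborel (\<lambda>x. grad (\<phi> n) x - indicator \<Omega> x *\<^sub>R g x)) \<longlonglongrightarrow> 0"
  shows "(LINT x:\<Omega>|lborel. u x) = (LBINT x. (indicator \<Omega> x *\<^sub>R g x) \<bullet> (indicator \<Omega> x *\<^sub>R h x))"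
    "(\<lambda>n. LBINT x. \<phi> n x) \<longlonglongrightarrow> (LINT x:\<Omega>|lborel. u x)"
proof -
  let ?u = "\<lambda>x. indicator \<Omega> x *\<^sub>R u x" and ?g = "\<lambda>x. indicator \<Omega> x *\<^sub>R g x"
    and ?h = "\<lambda>x. indicator \<Omega> x *\<^sub>R h x"
  have sq: "sq_integrable lborel ?u" "sq_integrable lborel ?g" "sq_integrable lborel ?h"
    using assms(3,4) by (simp_all only: torsion_function_def H10_def H1_def L2_on_iff)
  have eq: "(LBINT x. grad \<psi> x \<bullet> ?h x) = (LBINT x. \<psi> x)" if \<psi>: "\<psi> \<in> test_functions \<Omega>" for \<psi>
  proof -
    have "(LINT x:\<Omega>|lborel. h x \<bullet> grad \<psi> x) = (LINT x:\<Omega>|lborel. \<psi> x)"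
      using assms(4) \<psi> by (simp add: torsion_function_def)
    moreover have ind: "indicator \<Omega> x *\<^sub>R \<psi> x = \<psi> x" "indicator \<Omega> x *\<^sub>R (h x \<bullet> grad \<psi> x) = grad \<psi> x \<bullet> ?h x" for x
      by (cases "x \<in> \<Omega>"; simp add: test_function_zero[OF \<psi>] inner_commute)+
    ultimately show ?thesis
      unfolding set_lebesgue_integral_def ind by simp
  qed
  have l1: "(\<lambda>n. LBINT x. grad (\<phi> n) x \<bullet> ?h x) \<longlonglongrightarrow> (LBINT x. ?g x \<bullet> ?h x)"
    by (rule L2_tendsto_inner[OF test_function_sq_integrable(2)[OF \<phi>(1)] sq(2,3) \<phi>(3)])
  have "(\<lambda>n. LBINT x. \<phi> n x \<bullet> indicator \<Omega> x) \<longlonglongrightarrow> (LBINT x. ?u x \<bullet> indicator \<Omega> x)"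
    by (rule L2_tendsto_inner[OF test_function_sq_integrable(1)[OF \<phi>(1)] sq(1)
          sq_integrable_indicator(1)[OF \<Omega>] \<phi>(2)])
  moreover have ind: "\<phi> n x \<bullet> indicator \<Omega> x = \<phi> n x" "?u x \<bullet> indicator \<Omega> x = ?u x" for n x
    by (cases "x \<in> \<Omega>"; simp add: test_function_zero[OF \<phi>(1)])+
  ultimately show l2: "(\<lambda>n. LBINT x. \<phi> n x) \<longlonglongrightarrow> (LINT x:\<Omega>|lborel. u x)"
    unfolding set_lebesgue_integral_def ind by simp
  show "(LINT x:\<Omega>|lborel. u x) = (LBINT x. ?g x \<bullet> ?h x)"
    by (rule LIMSEQ_unique[OF l2 l1[unfolded eq[OF \<phi>(1)]]])
qed

text \<open>Resolves the definite description in \<open>torsion\<close> once and keeps what the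
  estimates need: \<open>g\<close> is the gradient of a solution, extended by zero, and the test
  functions \<open>\<phi> n\<close> carry integrals and gradient norms to the limit.\<close>

lemma torsion_characterization:
  fixes \<Omega> :: "'a::euclidean_space set"
  assumes "open \<Omega>" "bounded \<Omega>"
  obtains g \<phi> where "sq_integrable lborel g" "torsion \<Omega> = (L2_norm lborel g)\<^sup>2"
    "\<And>\<psi>. \<psi> \<in> test_functions \<Omega> \<Longrightarrow> (LBINT x. grad \<psi> x \<bullet> g x) = (LBINT x. \<psi> x)"
    "\<And>n::nat. \<phi> n \<in> test_functions \<Omega>" "(\<lambda>n. L2_norm lborel (grad (\<phi> n))) \<longlonglongrightarrow> L2_norm lborel g"
    "(\<lambda>n. LBINT x. \<phi> n x) \<longlonglongrightarrow> torsion \<Omega>"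
proof -
  have \<Omega>: "\<Omega> \<in> sets lborel" "emeasure lborel \<Omega> < \<infinity>"
    using assms emeasure_bounded_finite by auto
  obtain u g where ug: "torsion_function \<Omega> u g"
    using torsion_function_exists[OF assms] by blast
  let ?g = "\<lambda>x. indicator \<Omega> x *\<^sub>R g x"
  have cross: "(LINT x:\<Omega>|lborel. u x) = (LBINT x. (indicator \<Omega> x *\<^sub>R g x) \<bullet> (indicator \<Omega> x *\<^sub>R h x))"
    if "torsion_function \<Omega> u g" "torsion_function \<Omega> v h" for u g v h
  proof -
    have "H10 \<Omega> u g"
      using that(1) by (simp add: torsion_function_def)
    then show ?thesis
      by (rule H10_approx) (rule torsion_function_cross(1)[OF \<Omega> that])
  qed
  have T: "torsion \<Omega> = (LINT x:\<Omega>|lborel. u x)"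
    unfolding torsion_def
  proof (rule the_equality)
    fix T assume "\<exists>u g. torsion_function \<Omega> u g \<and> T = (LINT x:\<Omega>|lborel. u x)"
    then obtain v h where "torsion_function \<Omega> v h" "T = (LINT x:\<Omega>|lborel. v x)" by blast
    then have "T = (LBINT x. (indicator \<Omega> x *\<^sub>R h x) \<bullet> ?g x)"
      using cross[of v h u g] ug by simp
    also have "\<dots> = (LINT x:\<Omega>|lborel. u x)"
      unfolding cross[OF ug \<open>torsion_function \<Omega> v h\<close>] by (simp only: inner_commute)
    finally show "T = (LINT x:\<Omega>|lborel. u x)" .
  qed (use ug in blast)
  have sqg: "sq_integrable lborel ?g"
    using ug by (simp only: torsion_function_def H10_def H1_def L2_on_iff)
  obtain \<phi> where \<phi>: "\<And>n::nat. \<phi> n \<in> test_functions \<Omega>"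
    "(\<lambda>n. L2_norm lborel (\<lambda>x. \<phi> n x - indicator \<Omega> x *\<^sub>R u x)) \<longlonglongrightarrow> 0"
    "(\<lambda>n. L2_norm lborel (\<lambda>x. grad (\<phi> n) x - ?g x)) \<longlonglongrightarrow> 0"
  proof -
    have "H10 \<Omega> u g"
      using ug by (simp add: torsion_function_def)
    then show ?thesis
      by (rule H10_approx) (rule that)
  qed
  show ?thesis
  proof (rule that[OF sqg _ _ \<phi>(1)])
    show "torsion \<Omega> = (L2_norm lborel ?g)\<^sup>2"
      unfolding T cross[OF ug ug] L2_norm_power2 power2_norm_eq_inner ..
    show "(LBINT x. grad \<psi> x \<bullet> ?g x) = (LBINT x. \<psi> x)" if \<psi>: "\<psi> \<in> test_functions \<Omega>" for \<psi>
    proof -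
      have "(LINT x:\<Omega>|lborel. g x \<bullet> grad \<psi> x) = (LINT x:\<Omega>|lborel. \<psi> x)"
        using ug \<psi> by (simp add: torsion_function_def)
      moreover have ind: "indicator \<Omega> x *\<^sub>R \<psi> x = \<psi> x" "indicator \<Omega> x *\<^sub>R (g x \<bullet> grad \<psi> x) = grad \<psi> x \<bullet> ?g x" for x
        by (cases "x \<in> \<Omega>"; simp add: test_function_zero[OF \<psi>] inner_commute)+
      ultimately show ?thesis
        unfolding set_lebesgue_integral_def ind by simp
    qed
    show "(\<lambda>n. L2_norm lborel (grad (\<phi> n))) \<longlonglongrightarrow> L2_norm lborel ?g"
      by (rule L2_tendsto_norm[OF test_function_sq_integrable(2)[OF \<phi>(1)] sqg \<phi>(3)])
    show "(\<lambda>n. LBINT x. \<phi> n x) \<longlonglongrightarrow> torsion \<Omega>"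
      unfolding T by (rule torsion_function_cross(2)[OF \<Omega> ug ug \<phi>])
  qed
qed

lemma torsion_nonneg:
  fixes \<Omega> :: "'a::euclidean_space set"
  assumes "open \<Omega>" "bounded \<Omega>"
  shows "torsion \<Omega> \<ge> 0"
proof -
  obtain g :: "'a \<Rightarrow> 'a" where "torsion \<Omega> = (L2_norm lborel g)\<^sup>2"
    by (rule torsion_characterization[OF assms])
  then show ?thesis by simp
qed

text \<open>One half of the variational formula: Cauchy-Schwarz in the weak equation. The product
  form avoids dividing by a gradient norm that might be zero.\<close>

lemma torsion_ge:
  fixes \<Omega> :: "'a::euclidean_space set"
  assumes "open \<Omega>" "bounded \<Omega>" and \<phi>: "\<phi> \<in> test_functions \<Omega>"
  shows "(LBINT x. \<phi> x)\<^sup>2 \<le> torsion \<Omega> * (L2_norm lborel (grad \<phi>))\<^sup>2"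
proof (rule torsion_characterization[OF assms(1,2)])
  fix g :: "'a \<Rightarrow> 'a"
  assume g: "sq_integrable lborel g" "torsion \<Omega> = (L2_norm lborel g)\<^sup>2"
    "\<And>\<psi>. \<psi> \<in> test_functions \<Omega> \<Longrightarrow> (LBINT x. grad \<psi> x \<bullet> g x) = (LBINT x. \<psi> x)"
  have "\<bar>\<integral>x. \<phi> x \<partial>lborel\<bar> \<le> L2_norm lborel (grad \<phi>) * L2_norm lborel g"
    using integral_Cauchy_Schwarz[OF test_function_sq_integrable(2)[OF \<phi>] g(1)]
    unfolding g(3)[OF \<phi>] .
  then have "\<bar>\<integral>x. \<phi> x \<partial>lborel\<bar>\<^sup>2 \<le> (L2_norm lborel (grad \<phi>) * L2_norm lborel g)\<^sup>2"
    by (intro power_mono) auto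
  then show ?thesis
    by (simp add: g(2) power_mult_distrib mult.commute)
qed

text \<open>The other half of the variational formula. Along the approximating test functions the
  hypothesis becomes T \<le> A |g|, with |g| the L^2 norm, and T = |g|^2.\<close>

lemma torsion_le:
  fixes \<Omega> :: "'a::euclidean_space set"
  assumes "open \<Omega>" "bounded \<Omega>"
    and A: "\<And>\<phi>. \<phi> \<in> test_functions \<Omega> \<Longrightarrow> (LBINT x. \<phi> x) \<le> A * L2_norm lborel (grad \<phi>)"
  shows "torsion \<Omega> \<le> A\<^sup>2"
proof (rule torsion_characterization[OF assms(1,2)])
  fix g :: "'a \<Rightarrow> 'a" and \<phi>
  assume g: "torsion \<Omega> = (L2_norm lborel g)\<^sup>2" "\<And>n::nat. \<phi> n \<in> test_functions \<Omega>"
    "(\<lambda>n. L2_norm lborel (grad (\<phi> n))) \<longlonglongrightarrow> L2_norm lborel g"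
    "(\<lambda>n. LBINT x. \<phi> n x) \<longlonglongrightarrow> torsion \<Omega>"
  have "torsion \<Omega> \<le> A * L2_norm lborel g"
    by (rule LIMSEQ_le[OF g(4) tendsto_mult_left[OF g(3)]]) (use A g(2) in blast)
  then have "L2_norm lborel g * L2_norm lborel g \<le> A * L2_norm lborel g"
    by (simp add: g(1) power2_eq_square)
  \<comment> \<open>If \<open>g\<close> has norm 0, then T = 0. Otherwise cancelling gives |g| \<le>
    A, which also supplies the sign of \<open>A\<close>.\<close>
  then have "L2_norm lborel g = 0 \<or> L2_norm lborel g \<le> A"
    using L2_norm_nonneg[of lborel g] by (auto simp: mult_le_cancel_right order_less_le)
  then show ?thesis
    unfolding g(1) using L2_norm_nonneg[of lborel g] by (auto intro: power_mono)
qed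

subsection \<open>Perimeter\<close>

text \<open>Each term of the divergence is a directional derivative, hence a limit of difference
  quotients. A change of variables moves the difference from the field to the indicator of
  \<open>\<Omega>\<close>, and as the field is bounded by 1, the volume of a symmetric difference
  divided by t remains. Summing over \<open>Basis\<close> costs the factor d. The cover
  \<open>W\<close> allows measuring a convenient superset of the symmetric difference.\<close>

lemma perimeter_le_translation:
  fixes \<Omega> :: "'a::euclidean_space set"
  assumes [measurable]: "\<Omega> \<in> sets lborel" and "\<delta> > 0" "K \<ge> 0"
    and W: "\<And>v. 0 < norm v \<Longrightarrow> norm v < \<delta> \<Longrightarrow>
      \<exists>W\<in>sets lborel. {x. (x - v \<in> \<Omega>) \<noteq> (x \<in> \<Omega>)} \<subseteq> W \<and> emeasure lborel W \<le> ennreal (K * norm v)"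
  shows "perimeter \<Omega> \<le> ereal (real DIM('a) * K)"
  unfolding perimeter_def
proof (rule SUP_least)
  fix \<phi> :: "'a \<Rightarrow> 'a"
  assume "\<phi> \<in> {\<phi>. Ck_on 1 UNIV \<phi> \<and> compact (supp \<phi>) \<and> (\<forall>x. norm (\<phi> x) \<le> 1)}"
  then have \<phi>: "\<And>x. (\<phi> has_derivative frechet_derivative \<phi> (at x)) (at x)"
    "\<And>v. continuous_on UNIV (\<lambda>x. frechet_derivative \<phi> (at x) v)"
    "compact (supp \<phi>)" "\<And>x. norm (\<phi> x) \<le> 1"
    by (auto simp: frechet_derivative_works)
  obtain R where "\<forall>x\<in>supp \<phi>. norm x \<le> R"
    using compact_imp_bounded[OF \<phi>(3)] unfolding bounded_pos by blast
  then have R: "\<phi> x = 0" if "x \<notin> cball 0 R" for x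
    using that zero_outside_supp[of x \<phi>] by auto
  have R': "frechet_derivative \<phi> (at x) v = 0" if "x \<notin> cball 0 R" for x v
  proof -
    have "(\<phi> has_derivative (\<lambda>v. 0)) (at x)"
    proof (rule has_derivative_transform_within_open[OF has_derivative_const])
      show "open (- cball 0 R :: 'a set)" by (simp add: open_Compl)
    qed (use that R in auto)
    then show ?thesis
      using frechet_derivative_at by metis
  qed
  have "continuous_on UNIV \<phi>"
    by (intro continuous_at_imp_continuous_on ballI has_derivative_continuous[OF \<phi>(1)])
  have part: "(LINT x:\<Omega>|lborel. frechet_derivative \<phi> (at x) b \<bullet> b) \<le> K" if b: "b \<in> Basis" for b
  proof -
    define \<psi> where "\<psi> x = \<phi> x \<bullet> b" for x
    have c\<psi>: "continuous_on UNIV \<psi>"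
      unfolding \<psi>_def using \<open>continuous_on UNIV \<phi>\<close> by (intro continuous_intros)
    then have [measurable]: "\<psi> \<in> borel_measurable borel"
      by (rule borel_measurable_continuous_onI)
    have i\<psi>: "integrable lborel \<psi>"
      by (rule integrable_continuous_bounded_support[OF c\<psi>, of R]) (simp add: \<psi>_def R)
    have lim: "(\<lambda>n. LBINT x. indicator \<Omega> x * ((\<psi> (x + (1 / real (Suc n)) *\<^sub>R b) - \<psi> x) * real (Suc n)))
     \<longlonglongrightarrow> (LBINT x. indicator \<Omega> x * (frechet_derivative \<phi> (at x) b \<bullet> b))"
    proof (rule integral_difference_quotient[where D = "\<lambda>x v. frechet_derivative \<phi> (at x) v \<bullet> b" and R = R])
      show "(\<psi> has_derivative (\<lambda>v. frechet_derivative \<phi> (at x) v \<bullet> b)) (at x)" for x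
        unfolding \<psi>_def by (rule has_derivative_inner_left[OF \<phi>(1)])
      show "continuous_on UNIV (\<lambda>x. frechet_derivative \<phi> (at x) b \<bullet> b)"
        by (intro continuous_intros \<phi>)
    qed (use assms(1) in \<open>auto simp: \<psi>_def R\<close>)
    have "\<forall>\<^sub>F n in sequentially. 1 / real (Suc n) < \<delta>"
      using order_tendstoD(2)[OF LIMSEQ_inverse_real_of_nat \<open>\<delta> > 0\<close>] by (simp only: inverse_eq_divide)
    then have "\<forall>\<^sub>F n in sequentially.
      (LBINT x. indicator \<Omega> x * ((\<psi> (x + (1 / real (Suc n)) *\<^sub>R b) - \<psi> x) * real (Suc n))) \<le> K"
    proof eventually_elim
      case (elim n)
      define t where "t = 1 / real (Suc n)"
      have t: "t > 0" "t < \<delta>" using elim by (auto simp: t_def)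
      obtain W where [measurable]: "W \<in> sets lborel"
        and Wsub: "{x. (x - t *\<^sub>R b \<in> \<Omega>) \<noteq> (x \<in> \<Omega>)} \<subseteq> W"
        and Wm: "emeasure lborel W \<le> ennreal (K * t)"
        using W[of "t *\<^sub>R b"] t b by auto
      have Wfin: "emeasure lborel W < \<infinity>"
        using Wm by (auto intro: le_less_trans)
      have Wm': "measure lborel W \<le> K * t"
        using Wm t \<open>K \<ge> 0\<close> by (auto simp: measure_def intro!: enn2real_leI)
      have i1: "integrable lborel (\<lambda>x. indicator \<Omega> x * f x)" if "integrable lborel f" for f :: "'a \<Rightarrow> real"
        using integrable_mult_indicator[OF assms(1) that] by simp
      have i2: "integrable lborel (\<lambda>x. indicator \<Omega> (x - t *\<^sub>R b) * \<psi> x)"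
        by (rule Bochner_Integration.integrable_bound[OF i\<psi>]) (auto simp: indicator_def)
      have "(LBINT x. indicator \<Omega> x * (\<psi> (x + t *\<^sub>R b) - \<psi> x))
          = (LBINT x. indicator \<Omega> x * \<psi> (x + t *\<^sub>R b)) - (LBINT x. indicator \<Omega> x * \<psi> x)"
        using i1[OF i\<psi>] i1[OF integrable_translate_lborel[OF i\<psi>]] by (simp add: right_diff_distrib)
      also have "(LBINT x. indicator \<Omega> x * \<psi> (x + t *\<^sub>R b)) = (LBINT x. indicator \<Omega> (x - t *\<^sub>R b) * \<psi> x)"
        using integral_translate_lborel[of "\<lambda>x. indicator \<Omega> (x - t *\<^sub>R b) * \<psi> x" "t *\<^sub>R b"] by simp
      also have "\<dots> - (LBINT x. indicator \<Omega> x * \<psi> x)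
          = (LBINT x. indicator \<Omega> (x - t *\<^sub>R b) * \<psi> x - indicator \<Omega> x * \<psi> x)"
        using i2 i1[OF i\<psi>] by simp
      also have "\<dots> \<le> (LBINT x. indicator W x)"
      proof (rule integral_mono)
        fix x
        have "\<bar>\<psi> x\<bar> \<le> 1"
          unfolding \<psi>_def using Basis_le_norm[OF b, of "\<phi> x"] \<phi>(4)[of x] by linarith
        then show "indicator \<Omega> (x - t *\<^sub>R b) * \<psi> x - indicator \<Omega> x * \<psi> x \<le> indicator W x"
          using Wsub by (auto simp: indicator_def)
      qed (use i2 i1[OF i\<psi>] Wfin \<open>W \<in> sets lborel\<close> in auto)
      also have "\<dots> \<le> K * t"
        using Wm' by simp
      finally have "(LBINT x. indicator \<Omega> x * (\<psi> (x + t *\<^sub>R b) - \<psi> x)) * real (Suc n) \<le> K"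
        by (simp add: t_def field_simps)
      then show ?case
        by (simp add: t_def mult.assoc[symmetric] del: of_nat_Suc)
    qed
    then have "(LBINT x. indicator \<Omega> x * (frechet_derivative \<phi> (at x) b \<bullet> b)) \<le> K"
      by (rule tendsto_upperbound[OF lim]) simp
    then show ?thesis
      by (simp add: set_lebesgue_integral_def)
  qed
  have int: "set_integrable lborel \<Omega> (\<lambda>x. frechet_derivative \<phi> (at x) b \<bullet> b)" for b
    unfolding set_integrable_def
    by (intro integrable_mult_indicator[OF assms(1)] integrable_continuous_bounded_support[where R = R])
      (auto intro!: continuous_intros \<phi> simp: R')
  have "(LINT x:\<Omega>|lborel. divergence \<phi> x) = (\<Sum>b\<in>Basis. LINT x:\<Omega>|lborel. frechet_derivative \<phi> (at x) b \<bullet> b)"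
    using int unfolding divergence_def set_lebesgue_integral_def set_integrable_def scaleR_sum_right
    by (intro Bochner_Integration.integral_sum)
  also have "\<dots> \<le> real DIM('a) * K"
    by (rule sum_bounded_above[OF part])
  finally show "ereal (LINT x:\<Omega>|lborel. divergence \<phi> x) \<le> ereal (real DIM('a) * K)"
    by simp
qed

lemma emeasure_annulus_le:
  fixes c :: "'a::euclidean_space"
  assumes "0 \<le> t" "t \<le> \<rho>"
  shows "emeasure lborel (cball c (\<rho> + t) - ball c (\<rho> - t))
    \<le> ennreal (2 * real DIM('a) * unit_ball_vol DIM('a) * (2 * \<rho>) ^ (DIM('a) - 1) * t)"
proof -
  let ?d = "DIM('a)"
  have "emeasure lborel (cball c (\<rho> + t) - ball c (\<rho> - t))
      = ennreal (unit_ball_vol ?d * (\<rho> + t) ^ ?d) - ennreal (unit_ball_vol ?d * (\<rho> - t) ^ ?d)"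
    using assms by (subst emeasure_Diff) (auto simp: emeasure_cball emeasure_ball)
  also have "\<dots> = ennreal (unit_ball_vol ?d * ((\<rho> + t) ^ ?d - (\<rho> - t) ^ ?d))"
    using assms by (simp add: ennreal_minus right_diff_distrib)
  also have "\<dots> \<le> ennreal (unit_ball_vol ?d * (2 * t * (real ?d * (2 * \<rho>) ^ (?d - 1))))"
  proof (intro ennreal_leI mult_left_mono)
    have "(\<rho> + t) ^ ?d - (\<rho> - t) ^ ?d = (2 * t) * (\<Sum>i<?d. (\<rho> - t) ^ (?d - Suc i) * (\<rho> + t) ^ i)"
      by (subst power_diff_sumr2) simp
    also have "\<dots> \<le> (2 * t) * (\<Sum>i<?d. (2 * \<rho>) ^ (?d - 1))"
    proof (intro mult_left_mono sum_mono)
      fix i assume "i \<in> {..<?d}"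
      then have "(\<rho> - t) ^ (?d - Suc i) * (\<rho> + t) ^ i \<le> (2 * \<rho>) ^ (?d - Suc i) * (2 * \<rho>) ^ i"
        using assms by (intro mult_mono power_mono) auto
      also have "\<dots> = (2 * \<rho>) ^ (?d - 1)"
        using \<open>i \<in> _\<close> unfolding power_add[symmetric] by (intro arg_cong[where f = "power _"]) auto
      finally show "(\<rho> - t) ^ (?d - Suc i) * (\<rho> + t) ^ i \<le> (2 * \<rho>) ^ (?d - 1)" .
    qed (use assms in simp)
    finally show "(\<rho> + t) ^ ?d - (\<rho> - t) ^ ?d \<le> 2 * t * (real ?d * (2 * \<rho>) ^ (?d - 1))" by simp
  qed simp
  finally show ?thesis by (simp add: ac_simps)
qed

text \<open>If x and x - v disagree about membership, the segment between them meets the frontier,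
  so x lies within |v| of some sphere, that is, in an annulus of volume O(|v|). Asking only for an
  inclusion of the frontier covers unions of balls and perforated balls alike.\<close>

lemma perimeter_le_spheres:
  fixes \<Omega> :: "'a::euclidean_space set"
  assumes "open \<Omega>" and I: "finite I" "I \<noteq> {}" and \<rho>: "\<And>i. i \<in> I \<Longrightarrow> \<rho> i > 0"
    and fr: "frontier \<Omega> \<subseteq> (\<Union>i\<in>I. sphere (c i) (\<rho> i))"
  shows "perimeter \<Omega> \<le> ereal (2 * (real DIM('a))\<^sup>2 * unit_ball_vol DIM('a) * 2 ^ (DIM('a) - 1)
           * (\<Sum>i\<in>I. \<rho> i ^ (DIM('a) - 1)))"
proof -
  let ?d = "DIM('a)"
  define k where "k = 2 * real ?d * unit_ball_vol ?d"
  have k: "k \<ge> 0" by (simp add: k_def)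
  define K where "K = (\<Sum>i\<in>I. k * (2 * \<rho> i) ^ (?d - 1))"
  \<comment> \<open>Translations shorter than every radius keep the inner radii of the annuli
    nonnegative, as \<open>emeasure_annulus_le\<close> requires.\<close>
  define \<delta> where "\<delta> = Min (\<rho> ` I)"
  have "perimeter \<Omega> \<le> ereal (real ?d * K)"
  proof (rule perimeter_le_translation)
    show "\<Omega> \<in> sets lborel" using \<open>open \<Omega>\<close> by simp
    show "\<delta> > 0" using I \<rho> by (auto simp: \<delta>_def)
    show "K \<ge> 0" unfolding K_def using k \<rho> by (intro sum_nonneg) (simp add: less_imp_le)
    fix v :: 'a assume v: "0 < norm v" "norm v < \<delta>"
    define A where "A i = cball (c i) (\<rho> i + norm v) - ball (c i) (\<rho> i - norm v)" for i
    have "{x. (x - v \<in> \<Omega>) \<noteq> (x \<in> \<Omega>)} \<subseteq> (\<Union>i\<in>I. A i)"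
    proof
      fix x assume x: "x \<in> {x. (x - v \<in> \<Omega>) \<noteq> (x \<in> \<Omega>)}"
      have "closed_segment x (x - v) \<inter> frontier \<Omega> \<noteq> {}"
        by (rule connected_Int_frontier) (use x in auto)
      then obtain z where z: "z \<in> closed_segment x (x - v)" "z \<in> frontier \<Omega>" by blast
      then obtain i where i: "i \<in> I" "dist (c i) z = \<rho> i"
        using fr by auto
      have "dist z x \<le> norm v"
        using segment_bound1[OF z(1)] by (simp add: dist_norm)
      then have "x \<in> A i"
        using i(2) dist_triangle[of "c i" x z] dist_triangle[of "c i" z x]
        by (auto simp: A_def dist_commute)
      then show "x \<in> (\<Union>i\<in>I. A i)" using i(1) by blast
    qed
    moreover have "emeasure lborel (\<Union>i\<in>I. A i) \<le> ennreal (K * norm v)"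
    proof -
      have "emeasure lborel (\<Union>i\<in>I. A i) \<le> (\<Sum>i\<in>I. emeasure lborel (A i))"
        by (rule emeasure_subadditive_finite[OF I(1)]) (auto simp: A_def)
      also have "\<dots> \<le> (\<Sum>i\<in>I. ennreal (k * (2 * \<rho> i) ^ (?d - 1) * norm v))"
      proof (rule sum_mono)
        fix i assume "i \<in> I"
        then have "\<delta> \<le> \<rho> i"
          using I by (simp add: \<delta>_def)
        then show "emeasure lborel (A i) \<le> ennreal (k * (2 * \<rho> i) ^ (?d - 1) * norm v)"
          using emeasure_annulus_le[of "norm v" "\<rho> i" "c i"] v by (simp add: A_def k_def)
      qed
      also have "\<dots> = ennreal (K * norm v)"
        using k \<rho> by (simp add: K_def sum_distrib_right less_imp_le)
      finally show ?thesis .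
    qed
    ultimately show "\<exists>W\<in>sets lborel. {x. (x - v \<in> \<Omega>) \<noteq> (x \<in> \<Omega>)} \<subseteq> W \<and> emeasure lborel W \<le> ennreal (K * norm v)"
      using I(1) by (intro bexI[of _ "\<Union>i\<in>I. A i"] conjI sets.finite_UN) (auto simp: A_def)
  qed
  also have "real ?d * K = 2 * (real ?d)\<^sup>2 * unit_ball_vol ?d * 2 ^ (?d - 1) * (\<Sum>i\<in>I. \<rho> i ^ (?d - 1))"
    by (simp add: K_def k_def sum_distrib_left power_mult_distrib power2_eq_square ac_simps)
  finally show ?thesis .
qed

section \<open>Spheres as smooth boundaries\<close>

text \<open>The family a + b t^e is stable under differentiation on t > 0: the derivative has
  constant 0, factor b e and exponent e - 1. The root is written with \<open>powr\<close> since its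
  derivatives have the exponents 1/2 - k.\<close>

lemma smooth_on_affine_sqrt:
  fixes q :: "'a::euclidean_space \<Rightarrow> real"
  assumes "open S" "real_polynomial_function q" "\<And>x. x \<in> S \<Longrightarrow> q x > 0"
  shows "smooth_on S (\<lambda>x. a + b * q x powr (1/2))"
proof (rule smooth_on_compose_polynomial[where \<H> = "{\<lambda>t. a + b * t powr e | a b e. True}" and T = "{0<..}"
      and h = "\<lambda>t. a + b * t powr (1/2)" and q = q])
  fix h :: "real \<Rightarrow> real" assume "h \<in> {\<lambda>t. a + b * t powr e | a b e. True}"
  then obtain a b e where h: "h = (\<lambda>t. a + b * t powr e)" by blast
  show "\<exists>h'\<in>{\<lambda>t. a + b * t powr e | a b e. True}. \<forall>t\<in>{0<..}. (h has_real_derivative h' t) (at t)"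
  proof (rule bexI[of _ "\<lambda>t. 0 + (b * e) * t powr (e - 1)"])
    show "\<forall>t\<in>{0<..}. (h has_real_derivative 0 + b * e * t powr (e - 1)) (at t)"
      unfolding h by (auto intro!: derivative_eq_intros)
  qed blast
qed (use assms in auto)

text \<open>Near \<open>x\<close> with \<open>x - c = \<rho> n\<close>, the sphere is the graph of
  \<open>sqrt (\<rho>\<^sup>2 - |P (y - c)|\<^sup>2)\<close> over the hyperplane orthogonal to \<open>n\<close>, where \<open>P\<close> is the orthogonal projection.\<close>

lemma smooth_boundary_spheres:
  fixes \<Omega> :: "'a::euclidean_space set"
  assumes local: "\<And>x. x \<in> frontier \<Omega> \<Longrightarrow> \<exists>r>0. \<exists>c \<rho>. \<rho> > 0 \<and> norm (x - c) = \<rho> \<and>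
     ((\<forall>y\<in>ball x r. y \<in> \<Omega> \<longleftrightarrow> norm (y - c) < \<rho>) \<or> (\<forall>y\<in>ball x r. y \<in> \<Omega> \<longleftrightarrow> norm (y - c) > \<rho>))"
  shows "smooth_boundary \<Omega>"
  unfolding smooth_boundary_def
proof
  fix x assume "x \<in> frontier \<Omega>"
  then obtain r c \<rho> where r: "r > 0" and \<rho>: "\<rho> > 0" "norm (x - c) = \<rho>"
    and alt: "(\<forall>y\<in>ball x r. y \<in> \<Omega> \<longleftrightarrow> norm (y - c) < \<rho>) \<or> (\<forall>y\<in>ball x r. y \<in> \<Omega> \<longleftrightarrow> norm (y - c) > \<rho>)"
    using local by blast
  define n where "n = (x - c) /\<^sub>R \<rho>"
  have n: "norm n = 1" "n \<bullet> n = 1" "x - c = \<rho> *\<^sub>R n"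
    using \<rho> by (auto simp: n_def power2_norm_eq_inner[symmetric])
  \<comment> \<open>The sign merges the two cases: s = -1 if \<Omega> is locally inside the sphere,
    s = 1 if it is outside. The epigraph is then taken in the direction
    \<open>s *\<^sub>R n\<close>.\<close>
  obtain s :: real where s: "s = 1 \<or> s = -1"
    and sdef: "\<forall>y\<in>ball x r. y \<in> \<Omega> \<longleftrightarrow> s * \<rho> < s * norm (y - c)"
    using alt by (rule disjE) (rule that[of "-1"] that[of 1]; simp)+
  define q where "q y = \<rho>\<^sup>2 + - (norm (y - c))\<^sup>2 + ((y - c) \<bullet> n)\<^sup>2" for y
  define \<gamma> where "\<gamma> y = c \<bullet> (s *\<^sub>R n) + s * q y powr (1/2)" for y
  \<comment> \<open>Within \<rho>/2 of x a point stays in the half space (y - c) . n > 0, and the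
    radicand \<open>q y\<close> stays positive, so the root is smooth and no second sheet of the
    sphere interferes.\<close>
  define r' where "r' = min r (\<rho> / 2)"
  have r': "r' > 0" "r' \<le> r" "r' \<le> \<rho> / 2"
    using r \<rho> by (auto simp: r'_def)
  have pos: "(y - c) \<bullet> n > 0" "q y > 0" if "y \<in> ball x r'" for y
  proof -
    have d: "norm (y - x) < \<rho> / 2"
      using that r' by (simp add: dist_norm norm_minus_commute)
    have yc: "y - c = (y - x) + \<rho> *\<^sub>R n"
      using n(3) by (simp add: algebra_simps)
    have "\<bar>(y - x) \<bullet> n\<bar> \<le> norm (y - x)"
      using Cauchy_Schwarz_ineq2[of "y - x" n] n(1) by simp
    with d show "(y - c) \<bullet> n > 0"
      unfolding yc inner_add_left by (simp add: n)
    have "q y = \<rho>\<^sup>2 - (norm (y - x))\<^sup>2 + ((y - x) \<bullet> n)\<^sup>2"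
      unfolding q_def yc power2_norm_eq_inner
      by (simp add: inner_add_left inner_add_right n inner_commute power2_eq_square algebra_simps)
    moreover have "(norm (y - x))\<^sup>2 < \<rho>\<^sup>2"
    proof (rule power_strict_mono)
      show "norm (y - x) < \<rho>"
        using d \<rho>(1) by linarith
    qed auto
    ultimately show "q y > 0" by (simp add: add_pos_nonneg)
  qed
  have inv: "\<gamma> (y + t *\<^sub>R (s *\<^sub>R n)) = \<gamma> y" for y t
  proof -
    have "q (y + u *\<^sub>R n) = q y" for u
    proof -
      have e: "y + u *\<^sub>R n - c = (y - c) + u *\<^sub>R n" by simp
      show ?thesis
        unfolding q_def e power2_norm_eq_inner
        by (simp add: inner_add_left inner_add_right n inner_commute power2_eq_square algebra_simps)
    qed
    from this[of "t * s"] show ?thesis by (simp add: \<gamma>_def)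
  qed
  have poly: "real_polynomial_function q"
  proof -
    have "real_polynomial_function (\<lambda>y. y \<bullet> n + - (c \<bullet> n))"
      by (intro real_polynomial_function.intros bounded_linear_inner_left)
    from real_polynomial_function.intros(4)[OF this this]
    have "real_polynomial_function (\<lambda>y. \<rho>\<^sup>2 + - (norm (y - c))\<^sup>2 + (y \<bullet> n + - (c \<bullet> n)) * (y \<bullet> n + - (c \<bullet> n)))"
      by (intro real_polynomial_function.intros(2,3) real_polynomial_function_minus
          real_polynomial_function_norm_sq)
    then show ?thesis
      by (simp add: q_def[abs_def] power2_eq_square inner_diff_left)
  qed
  have "smooth_on (ball x r') \<gamma>"
    unfolding \<gamma>_def[abs_def] by (rule smooth_on_affine_sqrt[OF open_ball poly pos(2)])
  moreover have "\<Omega> \<inter> ball x r' = {y \<in> ball x r'. \<gamma> y < y \<bullet> (s *\<^sub>R n)}"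
  proof -
    have "y \<in> \<Omega> \<longleftrightarrow> \<gamma> y < y \<bullet> (s *\<^sub>R n)" if y: "y \<in> ball x r'" for y
    proof -
      have "y \<in> ball x r" using y r' by simp
      have sq: "q y powr (1/2) = sqrt (q y)"
        using pos(2)[OF y] by (simp add: powr_half_sqrt)
      have sqless: "a < b \<longleftrightarrow> a\<^sup>2 < b\<^sup>2" if "0 \<le> a" "0 \<le> b" for a b :: real
        using that by (meson power2_less_imp_less power_strict_mono zero_less_numeral)
      have lt: "norm (y - c) < \<rho> \<longleftrightarrow> (y - c) \<bullet> n < sqrt (q y)"
      proof -
        have "norm (y - c) < \<rho> \<longleftrightarrow> (norm (y - c))\<^sup>2 < \<rho>\<^sup>2"
          using \<rho>(1) by (intro sqless) auto
        also have "\<dots> \<longleftrightarrow> ((y - c) \<bullet> n)\<^sup>2 < (sqrt (q y))\<^sup>2"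
          using pos(2)[OF y] by (simp add: q_def)
        also have "\<dots> \<longleftrightarrow> (y - c) \<bullet> n < sqrt (q y)"
          using pos[OF y] by (intro sqless[symmetric]) auto
        finally show ?thesis .
      qed
      have gt: "norm (y - c) > \<rho> \<longleftrightarrow> (y - c) \<bullet> n > sqrt (q y)"
      proof -
        have "norm (y - c) > \<rho> \<longleftrightarrow> (norm (y - c))\<^sup>2 > \<rho>\<^sup>2"
          using \<rho>(1) by (intro sqless) auto
        also have "\<dots> \<longleftrightarrow> ((y - c) \<bullet> n)\<^sup>2 > (sqrt (q y))\<^sup>2"
          using pos(2)[OF y] by (simp add: q_def)
        also have "\<dots> \<longleftrightarrow> (y - c) \<bullet> n > sqrt (q y)"
          using pos[OF y] by (intro sqless[symmetric]) auto
        finally show ?thesis .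
      qed
      show ?thesis
        using s sdef \<open>y \<in> ball x r\<close> lt gt
        by (auto simp: \<gamma>_def sq inner_diff_left algebra_simps)
    qed
    then show ?thesis by blast
  qed
  ultimately show "\<exists>r>0. \<exists>\<nu> \<gamma>. norm \<nu> = 1 \<and> (\<forall>y t. \<gamma> (y + t *\<^sub>R \<nu>) = \<gamma> y) \<and> smooth_on (ball x r) \<gamma> \<and>
        \<Omega> \<inter> ball x r = {y \<in> ball x r. \<gamma> y < y \<bullet> \<nu>}"
    using r'(1) inv n(1) s by (intro exI[of _ r'] exI[of _ "s *\<^sub>R n"] exI[of _ \<gamma>] conjI) auto
qed

subsection \<open>Unions of balls\<close>

lemma ball_avoiding_closed:
  fixes x :: "'a::metric_space"
  assumes "closed S" "x \<notin> S"
  obtains r where "r > 0" "ball x r \<inter> S = {}"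
proof -
  have "open (- S)" "x \<in> - S" using assms by auto
  then obtain r where "r > 0" "ball x r \<subseteq> - S" by (meson openE)
  then show ?thesis using that[of r] by blast
qed

text \<open>The strict gaps keep the other closed balls, finitely many, away from a point of one of
  the spheres, so near that point the union coincides with a single ball.\<close>

lemma union_balls_boundary:
  fixes c :: "'i \<Rightarrow> 'a::euclidean_space"
  assumes I: "finite I" and \<rho>: "\<And>i. i \<in> I \<Longrightarrow> \<rho> i > 0"
    and sep: "\<And>i j. i \<in> I \<Longrightarrow> j \<in> I \<Longrightarrow> i \<noteq> j \<Longrightarrow> \<rho> i + \<rho> j < dist (c i) (c j)"
    and \<Omega>: "\<Omega> = (\<Union>i\<in>I. ball (c i) (\<rho> i))"
  shows "frontier \<Omega> \<subseteq> (\<Union>i\<in>I. sphere (c i) (\<rho> i))" and "smooth_boundary \<Omega>"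
proof -
  have op: "open \<Omega>" unfolding \<Omega> by auto
  have "closure \<Omega> \<subseteq> (\<Union>i\<in>I. cball (c i) (\<rho> i))"
    unfolding \<Omega> using I ball_subset_cball by (intro closure_minimal closed_UN) (auto intro: less_imp_le)
  then show fr: "frontier \<Omega> \<subseteq> (\<Union>i\<in>I. sphere (c i) (\<rho> i))"
    using op by (fastforce simp: frontier_def interior_open \<Omega>)
  show "smooth_boundary \<Omega>"
  proof (rule smooth_boundary_spheres)
    fix x assume "x \<in> frontier \<Omega>"
    then obtain i where i: "i \<in> I" "dist (c i) x = \<rho> i" using fr by auto
    let ?S = "\<Union>j\<in>I - {i}. cball (c j) (\<rho> j)"
    have "x \<notin> ?S"
    proof
      assume "x \<in> ?S"
      then obtain j where "j \<in> I" "j \<noteq> i" "dist (c j) x \<le> \<rho> j" by auto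
      then show False
        using sep[of i j] i dist_triangle2[of "c i" "c j" x] by auto
    qed
    moreover have "closed ?S" using I by (intro closed_UN) auto
    ultimately obtain r where r: "r > 0" "ball x r \<inter> ?S = {}"
      using ball_avoiding_closed[of ?S x] by blast
    have "y \<in> \<Omega> \<longleftrightarrow> norm (y - c i) < \<rho> i" if "y \<in> ball x r" for y
    proof
      assume "y \<in> \<Omega>"
      then obtain j where j: "j \<in> I" "y \<in> ball (c j) (\<rho> j)" by (auto simp: \<Omega>)
      have "j = i"
      proof (rule ccontr)
        assume "j \<noteq> i"
        then have "y \<in> ?S" using j by (auto intro!: bexI[of _ j])
        then show False using r(2) that by blast
      qed
      with j show "norm (y - c i) < \<rho> i" by (simp add: dist_norm norm_minus_commute)
    qed (use i in \<open>auto simp: \<Omega> dist_norm norm_minus_commute intro!: bexI[of _ i]\<close>)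
    then show "\<exists>r>0. \<exists>c \<rho>. \<rho> > 0 \<and> norm (x - c) = \<rho> \<and>
     ((\<forall>y\<in>ball x r. y \<in> \<Omega> \<longleftrightarrow> norm (y - c) < \<rho>) \<or> (\<forall>y\<in>ball x r. y \<in> \<Omega> \<longleftrightarrow> norm (y - c) > \<rho>))"
      using r(1) i \<rho>[of i] by (intro exI[of _ r] conjI exI[of _ "c i"] exI[of _ "\<rho> i"])
        (auto simp: dist_norm norm_minus_commute)
  qed
qed

section \<open>Lower bound for the perimeter of separated balls\<close>

text \<open>The perimeter is tested with C^1 fields, so a nest of squared positive parts, each of
  them C^1, is regular enough. The value is 1 for s \<le> 1 and 0 for s \<ge> 2.\<close>

definition cutoff :: "real \<Rightarrow> real" where
  "cutoff s = (max 0 (1 - (max 0 (s - 1))\<^sup>2))\<^sup>2"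

definition cutoff' :: "real \<Rightarrow> real" where
  "cutoff' s = - 4 * max 0 (1 - (max 0 (s - 1))\<^sup>2) * max 0 (s - 1)"

lemma pos_part_square_deriv: "((\<lambda>t. (max 0 t)\<^sup>2) has_real_derivative 2 * max 0 t) (at (t::real))"
proof (cases t "0::real" rule: linorder_cases)
  case less
  have "((\<lambda>_. 0) has_real_derivative 0) (at t)" by simp
  then have "((\<lambda>t. (max 0 t)\<^sup>2) has_real_derivative 0) (at t)"
    by (rule has_field_derivative_transform_within_open[of _ _ _ "{..<0}"]) (use less in auto)
  then show ?thesis using less by simp
next
  case greater
  have "((\<lambda>t. t\<^sup>2) has_real_derivative 2 * t) (at t)" by (auto intro!: derivative_eq_intros)
  then have "((\<lambda>t. (max 0 t)\<^sup>2) has_real_derivative 2 * t) (at t)"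
    by (rule has_field_derivative_transform_within_open[of _ _ _ "{0<..}"]) (use greater in auto)
  then show ?thesis using greater by simp
next
  case equal
  have "((\<lambda>h. (max 0 h)\<^sup>2 / h) \<longlongrightarrow> 0) (at (0::real))"
  proof (rule Lim_null_comparison)
    show "((\<lambda>h. \<bar>h\<bar>) \<longlongrightarrow> 0) (at (0::real))"
      using tendsto_rabs_zero[OF tendsto_ident_at] .
    show "\<forall>\<^sub>F h in at (0::real). norm ((max 0 h)\<^sup>2 / h) \<le> \<bar>h\<bar>"
      by (rule always_eventually) (auto simp: max_def power2_eq_square)
  qed
  then show ?thesis using equal by (simp add: DERIV_def)
qed

lemma cutoff_deriv: "(cutoff has_real_derivative cutoff' s) (at s)"
proof -
  have "((\<lambda>s. (max 0 (s - 1))\<^sup>2) has_real_derivative 2 * max 0 (s - 1) * 1) (at s)"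
    by (rule DERIV_chain2[OF pos_part_square_deriv]) (auto intro!: derivative_eq_intros)
  then have "((\<lambda>s. 1 - (max 0 (s - 1))\<^sup>2) has_real_derivative 0 - 2 * max 0 (s - 1) * 1) (at s)"
    by (intro DERIV_diff) simp
  from DERIV_chain2[OF pos_part_square_deriv this]
  show ?thesis by (simp add: cutoff_def[abs_def] cutoff'_def mult.assoc)
qed

lemma cutoff_simps:
  "s \<le> 1 \<Longrightarrow> cutoff s = 1" "s \<ge> 2 \<Longrightarrow> cutoff s = 0" "0 \<le> cutoff s" "cutoff s \<le> 1"
proof -
  show "s \<ge> 2 \<Longrightarrow> cutoff s = 0"
    using one_le_power[of "s - 1" 2] by (simp add: cutoff_def)
  have "max 0 (1 - (max 0 (s - 1))\<^sup>2) \<le> 1" by simp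
  then show "cutoff s \<le> 1"
    unfolding cutoff_def by (intro power_le_one) auto
qed (auto simp: cutoff_def)

text \<open>An extension of the radial field (x - c)/(2 \<rho>), whose divergence in the ball is
  d/(2 \<rho>). The factor 1/2 leaves room for the cutoff: up to distance 2 \<rho>, beyond which the
  field vanishes, the norm is at most 1.\<close>

definition ball_field :: "'a::euclidean_space \<Rightarrow> real \<Rightarrow> 'a \<Rightarrow> 'a" where
  "ball_field c \<rho> x = (cutoff ((norm (x - c))\<^sup>2 / \<rho>\<^sup>2) / (2 * \<rho>)) *\<^sub>R (x - c)"

lemma ball_field_C1:
  assumes "\<rho> > 0"
  shows "Ck_on 1 UNIV (ball_field c \<rho> :: 'a::euclidean_space \<Rightarrow> 'a)"
proof (rule Ck_on_1I[OF open_UNIV])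
  let ?q = "\<lambda>x::'a. (norm (x - c))\<^sup>2 / \<rho>\<^sup>2"
  let ?D = "\<lambda>(x::'a) v. (cutoff (?q x) / (2 * \<rho>)) *\<^sub>R v
    + (cutoff' (?q x) * (2 * ((x - c) \<bullet> v) / \<rho>\<^sup>2) / (2 * \<rho>)) *\<^sub>R (x - c)"
  fix x :: 'a
  have "((\<lambda>x. (x - c) \<bullet> (x - c)) has_derivative (\<lambda>v. (x - c) \<bullet> v + v \<bullet> (x - c))) (at x)"
    by (rule has_derivative_inner) (auto intro!: derivative_eq_intros)
  then have "(?q has_derivative (\<lambda>v. 2 * ((x - c) \<bullet> v) / \<rho>\<^sup>2)) (at x)"
    using has_derivative_scaleR_right[of _ _ _ "1 / \<rho>\<^sup>2"] unfolding power2_norm_eq_inner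
    by (fastforce simp: inner_commute)
  from has_derivative_compose[OF this, of cutoff "\<lambda>u. cutoff' (?q x) * u"]
  have "((\<lambda>x. cutoff (?q x)) has_derivative (\<lambda>v. cutoff' (?q x) * (2 * ((x - c) \<bullet> v) / \<rho>\<^sup>2))) (at x)"
    using cutoff_deriv by (simp add: has_field_derivative_def)
  then have "((\<lambda>x. cutoff (?q x) / (2 * \<rho>)) has_derivative
      (\<lambda>v. cutoff' (?q x) * (2 * ((x - c) \<bullet> v) / \<rho>\<^sup>2) / (2 * \<rho>))) (at x)"
    by (rule bounded_linear.has_derivative[OF bounded_linear_divide])
  moreover have "((\<lambda>x. x - c) has_derivative (\<lambda>v. v)) (at x)"
    by (auto intro!: derivative_eq_intros)
  ultimately show "(ball_field c \<rho> has_derivative ?D x) (at x)"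
    unfolding ball_field_def[abs_def] by (rule has_derivative_scaleR)
next
  fix v :: 'a
  have "continuous_on UNIV cutoff"
    by (intro continuous_at_imp_continuous_on ballI DERIV_isCont[OF cutoff_deriv])
  moreover have "continuous_on UNIV cutoff'"
    unfolding cutoff'_def[abs_def] by (intro continuous_intros)
  ultimately have c: "continuous_on UNIV (\<lambda>x. cutoff (f x))" "continuous_on UNIV (\<lambda>x. cutoff' (f x))"
    if "continuous_on UNIV f" for f :: "'a \<Rightarrow> real"
    using that continuous_on_compose2 by blast+
  show "continuous_on UNIV (\<lambda>x::'a. (cutoff ((norm (x - c))\<^sup>2 / \<rho>\<^sup>2) / (2 * \<rho>)) *\<^sub>R v
    + (cutoff' ((norm (x - c))\<^sup>2 / \<rho>\<^sup>2) * (2 * ((x - c) \<bullet> v) / \<rho>\<^sup>2) / (2 * \<rho>)) *\<^sub>R (x - c))"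
    by (intro continuous_intros c) (use assms in auto)
qed

lemma ball_field_inside:
  "\<rho> > 0 \<Longrightarrow> x \<in> ball c \<rho> \<Longrightarrow> ball_field c \<rho> x = (1 / (2 * \<rho>)) *\<^sub>R (x - c)"
  by (subst ball_field_def, subst cutoff_simps(1))
    (auto simp: dist_norm norm_minus_commute divide_le_eq power_mono)

lemma ball_field_outside:
  assumes "\<rho> > 0" "dist c x \<ge> 2 * \<rho>"
  shows "ball_field c \<rho> x = 0"
proof -
  have "(2 * \<rho>)\<^sup>2 \<le> (norm (x - c))\<^sup>2"
    using assms by (intro power_mono) (auto simp: dist_norm norm_minus_commute)
  moreover have "2 * \<rho>\<^sup>2 \<le> (2 * \<rho>)\<^sup>2"
    by (simp add: power_mult_distrib)
  ultimately have "2 * \<rho>\<^sup>2 \<le> (norm (x - c))\<^sup>2"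
    by linarith
  then have "2 \<le> (norm (x - c))\<^sup>2 / \<rho>\<^sup>2"
    using assms(1) by (simp add: le_divide_eq)
  then show ?thesis by (simp add: ball_field_def cutoff_simps)
qed

lemma norm_ball_field_le:
  assumes "\<rho> > 0"
  shows "norm (ball_field c \<rho> x) \<le> 1"
proof (cases "dist c x \<ge> 2 * \<rho>")
  case False
  have "norm (ball_field c \<rho> x) = cutoff ((norm (x - c))\<^sup>2 / \<rho>\<^sup>2) * (norm (x - c) / (2 * \<rho>))"
    using assms by (simp add: ball_field_def cutoff_simps)
  also have "\<dots> \<le> 1 * 1"
    using False assms by (intro mult_mono) (auto simp: cutoff_simps dist_norm norm_minus_commute)
  finally show ?thesis by simp
qed (simp add: ball_field_outside assms)

lemma Ck_on_sum:
  fixes f :: "'i \<Rightarrow> 'a::euclidean_space \<Rightarrow> 'b::real_normed_vector"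
  assumes "open S" "finite I" "\<And>i. i \<in> I \<Longrightarrow> Ck_on k S (f i)" "Ck_on k S (\<lambda>x. 0::'b)"
  shows "Ck_on k S (\<lambda>x. \<Sum>i\<in>I. f i x)"
  using assms(2,3)
proof (induction rule: finite_induct)
  case (insert i I)
  then show ?case using Ck_on_add[OF assms(1), of k "f i"] by simp
qed (simp add: assms(4))

text \<open>The gaps make the balls of radius 2 \<rho> disjoint, so the sum of the fields equals at
  most one of them at each point and is still bounded by 1. Each ball contributes d/(2 \<rho>) times
  its volume, which is half its true perimeter; the loss is harmless.\<close>

lemma perimeter_union_balls_ge:
  fixes c :: "'i \<Rightarrow> 'a::euclidean_space"
  assumes I: "finite I" and \<rho>: "\<And>i. i \<in> I \<Longrightarrow> \<rho> i > 0"
    and sep: "\<And>i j. i \<in> I \<Longrightarrow> j \<in> I \<Longrightarrow> i \<noteq> j \<Longrightarrow> 2 * (\<rho> i + \<rho> j) \<le> dist (c i) (c j)"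
  shows "ereal (real DIM('a) * unit_ball_vol DIM('a) / 2 * (\<Sum>i\<in>I. \<rho> i ^ (DIM('a) - 1)))
    \<le> perimeter (\<Union>i\<in>I. ball (c i) (\<rho> i))"
proof -
  let ?d = "DIM('a)" and ?\<Omega> = "\<Union>i\<in>I. ball (c i) (\<rho> i)"
  define \<phi> where "\<phi> x = (\<Sum>i\<in>I. ball_field (c i) (\<rho> i) x)" for x
  have single: "\<phi> x = ball_field (c i) (\<rho> i) x" if "i \<in> I" "dist (c i) x < 2 * \<rho> i" for i x
  proof -
    have "ball_field (c j) (\<rho> j) x = 0" if "j \<in> I - {i}" for j
      using that \<open>i \<in> I\<close> \<open>dist (c i) x < 2 * \<rho> i\<close> sep[of i j] \<rho>[of j] dist_triangle2[of "c i" "c j" x]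
      by (intro ball_field_outside) auto
    then show ?thesis
      unfolding \<phi>_def by (subst sum.remove[OF I \<open>i \<in> I\<close>]) simp
  qed
  have out: "\<phi> x = 0" if "\<And>i. i \<in> I \<Longrightarrow> 2 * \<rho> i \<le> dist (c i) x" for x
    unfolding \<phi>_def using that \<rho> ball_field_outside by (intro sum.neutral) blast
  have "Ck_on 1 UNIV (\<lambda>x::'a. 0::'a)"
    by (rule Ck_on_1I[where D = "\<lambda>_ _. 0"]) auto
  then have C1: "Ck_on 1 UNIV \<phi>"
    unfolding \<phi>_def[abs_def] using I \<rho> by (intro Ck_on_sum ball_field_C1) auto
  have norm: "norm (\<phi> x) \<le> 1" for x
  proof (cases "\<exists>i\<in>I. dist (c i) x < 2 * \<rho> i")
    case True
    then show ?thesis using single norm_ball_field_le \<rho> by metis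
  next
    case False
    then show ?thesis using out[of x] by (auto simp: not_less)
  qed
  have cpt: "compact (supp \<phi>)"
  proof -
    have K: "compact (\<Union>i\<in>I. cball (c i) (2 * \<rho> i))" using I by (intro compact_UN) auto
    have "{x. \<phi> x \<noteq> 0} \<subseteq> (\<Union>i\<in>I. cball (c i) (2 * \<rho> i))"
      using out by (auto simp: not_le) (meson le_cases)
    then have "supp \<phi> \<subseteq> (\<Union>i\<in>I. cball (c i) (2 * \<rho> i))"
      unfolding supp_def using compact_imp_closed[OF K] by (intro closure_minimal)
    then show ?thesis
      using compact_Int_closed[OF K closed_supp[of \<phi>]] by (simp add: inf.absorb2)
  qed
  have div: "divergence \<phi> x = real ?d / (2 * \<rho> i)" if "i \<in> I" "x \<in> ball (c i) (\<rho> i)" for i x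
  proof -
    have "((\<lambda>x. (1 / (2 * \<rho> i)) *\<^sub>R (x - c i)) has_derivative (\<lambda>v. (1 / (2 * \<rho> i)) *\<^sub>R v)) (at x)"
      by (auto intro!: derivative_eq_intros)
    then have "(\<phi> has_derivative (\<lambda>v. (1 / (2 * \<rho> i)) *\<^sub>R v)) (at x)"
    proof (rule has_derivative_transform_within_open[OF _ open_ball that(2)])
      fix y assume "y \<in> ball (c i) (\<rho> i)"
      then show "(1 / (2 * \<rho> i)) *\<^sub>R (y - c i) = \<phi> y"
        using single[OF that(1), of y] \<rho>[OF that(1)] ball_field_inside[of "\<rho> i" y "c i"] by auto
    qed
    then have "frechet_derivative \<phi> (at x) = (\<lambda>v. (1 / (2 * \<rho> i)) *\<^sub>R v)"
      using frechet_derivative_at by metis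
    then show ?thesis by (simp add: divergence_def)
  qed
  have disj: "j = i" if "i \<in> I" "j \<in> I" "x \<in> ball (c i) (\<rho> i)" "x \<in> ball (c j) (\<rho> j)" for i j x
    using that sep[of i j] \<rho>[of i] \<rho>[of j] dist_triangle2[of "c i" "c j" x] by auto
  have ind: "indicator ?\<Omega> x * divergence \<phi> x = (\<Sum>i\<in>I. real ?d / (2 * \<rho> i) * indicator (ball (c i) (\<rho> i)) x)" for x
  proof (cases "x \<in> ?\<Omega>")
    case True
    then obtain i where i: "i \<in> I" "x \<in> ball (c i) (\<rho> i)" by blast
    have "indicator (ball (c j) (\<rho> j)) x = (0::real)" if "j \<in> I - {i}" for j
      using disj[OF i(1), of j x] i(2) that by (auto simp: indicator_def)
    then have "(\<Sum>i\<in>I. real ?d / (2 * \<rho> i) * indicator (ball (c i) (\<rho> i)) x) = real ?d / (2 * \<rho> i)"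
      using i by (subst sum.remove[OF I i(1)]) simp
    then show ?thesis using True div[OF i] by simp
  next
    case False
    then show ?thesis by (auto intro!: sum.neutral)
  qed
  have "(LINT x:?\<Omega>|lborel. divergence \<phi> x) = (LBINT x. (\<Sum>i\<in>I. real ?d / (2 * \<rho> i) * indicator (ball (c i) (\<rho> i)) x))"
    unfolding set_lebesgue_integral_def by (simp only: real_scaleR_def ind)
  also have "\<dots> = (\<Sum>i\<in>I. real ?d / (2 * \<rho> i) * (unit_ball_vol ?d * \<rho> i ^ ?d))"
    using \<rho> by (subst Bochner_Integration.integral_sum)
      (auto intro!: sum.cong integrable_mult_right integrable_real_indicator emeasure_lborel_ball_finite
        simp: content_ball less_imp_le simp del: times_divide_eq_left)
  also have "\<dots> = (\<Sum>i\<in>I. real ?d * unit_ball_vol ?d / 2 * \<rho> i ^ (?d - 1))"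
  proof (rule sum.cong)
    fix i assume "i \<in> I"
    have "\<rho> i ^ ?d = \<rho> i * \<rho> i ^ (?d - 1)"
      using power_Suc[of "\<rho> i" "?d - 1"] by simp
    then show "real ?d / (2 * \<rho> i) * (unit_ball_vol ?d * \<rho> i ^ ?d) = real ?d * unit_ball_vol ?d / 2 * \<rho> i ^ (?d - 1)"
      using \<rho>[OF \<open>i \<in> I\<close>] by simp
  qed simp
  finally have eq: "(LINT x:?\<Omega>|lborel. divergence \<phi> x) = real ?d * unit_ball_vol ?d / 2 * (\<Sum>i\<in>I. \<rho> i ^ (?d - 1))"
    by (simp add: sum_distrib_left)
  have "ereal (LINT x:?\<Omega>|lborel. divergence \<phi> x) \<le> perimeter ?\<Omega>"
    unfolding perimeter_def using C1 cpt norm by (intro SUP_upper) auto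
  then show ?thesis unfolding eq .
qed

section \<open>Torsion from below and the sign of the functional\<close>

text \<open>Stands in for monotonicity of the torsion: one fixed bump in the unit ball is admissible
  for every larger domain.\<close>

lemma torsion_lower_bound:
  obtains T where "T > 0"
    "\<And>\<Omega> :: 'a::euclidean_space set. open \<Omega> \<Longrightarrow> bounded \<Omega> \<Longrightarrow> ball 0 1 \<subseteq> \<Omega> \<Longrightarrow> torsion \<Omega> \<ge> T"
proof -
  obtain \<phi> :: "'a \<Rightarrow> real" where \<phi>: "\<phi> \<in> test_functions (ball 0 1)" "\<And>x. \<phi> x \<ge> 0" "\<phi> 0 > 0"
    using ex_bump by blast
  have "isCont \<phi> 0"
    using test_function_continuous(1)[OF \<phi>(1)] by (simp add: continuous_on_eq_continuous_at)
  then have "\<forall>\<^sub>F x in nhds 0. \<phi> x > \<phi> 0 / 2"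
    using \<phi>(3) order_tendstoD(1)[of \<phi> "\<phi> 0" "nhds 0" "\<phi> 0 / 2"]
    by (simp add: continuous_within tendsto_at_iff_tendsto_nhds)
  then obtain \<delta> where \<delta>: "\<delta> > 0" "\<And>x. x \<in> ball 0 \<delta> \<Longrightarrow> \<phi> x > \<phi> 0 / 2"
    unfolding eventually_nhds_metric by (auto simp: dist_commute)
  have "0 < \<phi> 0 / 2 * measure lborel (ball (0::'a) \<delta>)"
    using \<phi>(3) \<delta>(1) by simp
  also have "\<dots> = (LBINT x. \<phi> 0 / 2 * indicator (ball (0::'a) \<delta>) x)"
    by simp
  also have "\<dots> \<le> (LBINT x. \<phi> x)"
  proof (rule integral_mono)
    show "integrable lborel (\<lambda>x. \<phi> 0 / 2 * indicator (ball (0::'a) \<delta>) x)"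
      using emeasure_lborel_ball_finite[of "0::'a" \<delta>] by simp
    show "\<phi> 0 / 2 * indicator (ball 0 \<delta>) x \<le> \<phi> x" for x
      using \<delta>(2)[of x] \<phi>(2)[of x] by (cases "x \<in> ball 0 \<delta>") auto
  qed (rule test_function_sq_integrable(3)[OF \<phi>(1)])
  finally have pos: "(LBINT x. \<phi> x) > 0" .
  let ?G = "(L2_norm lborel (grad \<phi>))\<^sup>2"
  have ge: "(LBINT x. \<phi> x)\<^sup>2 \<le> torsion \<Omega> * ?G" if "open \<Omega>" "bounded \<Omega>" "ball 0 1 \<subseteq> \<Omega>" for \<Omega> :: "'a set"
    using that \<phi>(1) by (intro torsion_ge) (auto simp: test_functions_def)
  \<comment> \<open>The inequality itself excludes a vanishing gradient norm, since the bump has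
    positive integral.\<close>
  have "?G > 0"
  proof (rule ccontr)
    assume "\<not> ?G > 0"
    then have "?G = 0" using zero_le_power2[of "L2_norm lborel (grad \<phi>)"] by linarith
    then show False using ge[of "ball 0 1"] pos by simp
  qed
  then show ?thesis
    using pos ge by (intro that[of "(LBINT x. \<phi> x)\<^sup>2 / ?G"]) (auto simp: divide_le_eq)
qed

text \<open>A positive exponent lets bounds on the volume pass to the denominator of F_q.\<close>

lemma alpha_pos:
  assumes "DIM('a::euclidean_space) \<ge> 2" "q > 0"
  shows "alpha TYPE('a) q > 0"
proof -
  have "(2 * q - 1) / real DIM('a) \<ge> - 1 / real DIM('a)"
    using assms(2) by (intro divide_right_mono) auto
  moreover have "1 / real DIM('a) < 1"
    using assms(1) by simp
  ultimately show ?thesis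
    using assms(2) unfolding alpha_def by linarith
qed

lemma perimeter_nonneg: "perimeter (\<Omega> :: 'a::euclidean_space set) \<ge> 0"
proof -
  have "Ck_on 1 UNIV (\<lambda>x::'a. 0::'a)"
    by (rule Ck_on_1I[where D = "\<lambda>_ _. 0"]) auto
  moreover have "divergence (\<lambda>x::'a. 0) = (\<lambda>x. 0)"
    by (simp add: divergence_def[abs_def])
  ultimately have "ereal 0 \<le> perimeter \<Omega>"
    unfolding perimeter_def
    by (intro SUP_upper2[of "\<lambda>x. 0"]) (auto simp: supp_def)
  then show ?thesis by (simp add: zero_ereal_def)
qed

lemma F_nonneg:
  assumes "\<Omega> \<in> A_all"
  shows "F q \<Omega> \<ge> 0"
proof -
  have "measure lborel \<Omega> > 0"
  proof -
    have "emeasure lborel \<Omega> \<noteq> 0"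
      using assms open_not_negligible[of \<Omega>] by (auto simp: A_all_def negligible_iff_emeasure0)
    then show ?thesis
      using assms by (simp add: A_all_def measure_def enn2real_positive_iff zero_less_iff_neq_zero)
  qed
  then show ?thesis
    unfolding F_def divide_ereal_def
    by (intro ereal_0_le_mult perimeter_nonneg) auto
qed

lemma F_eq:
  fixes \<Omega> :: "'a::euclidean_space set"
  assumes "perimeter \<Omega> = ereal p" "measure lborel \<Omega> > 0"
  shows "F q \<Omega> = ereal (p * torsion \<Omega> powr q / measure lborel \<Omega> powr alpha TYPE('a) q)"
  using assms by (simp add: F_def ereal_divide)

section \<open>Domains of large perimeter\<close>

lemma ex_domain_large_perimeter:
  fixes n :: nat
  shows "\<exists>\<Omega>::'a::euclidean_space set. open \<Omega> \<and> bounded \<Omega> \<and> ball 0 1 \<subseteq> \<Omega> \<and> smooth_boundary \<Omega> \<and>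
    perimeter \<Omega> < \<infinity> \<and> ereal (real DIM('a) * unit_ball_vol DIM('a) / 2 * real n) \<le> perimeter \<Omega> \<and>
    measure lborel \<Omega> \<le> 2 * unit_ball_vol DIM('a)"
proof -
  let ?d = "DIM('a)"
  \<comment> \<open>m \<ge> n makes the perimeter large; m \<ge> 8 makes the small radii at most
    1/8, which suffices for the gaps.\<close>
  define m where "m = n + 8"
  define I where "I = {..m ^ ?d}"
  obtain b :: 'a where b: "b \<in> Basis" using nonempty_Basis by blast
  \<comment> \<open>Index 0 is the unit ball; the small balls sit on one axis at distances 3, 4, ...
    from the origin. Over these m^d + 1 balls the sum of \<rho>^(d-1) is 1 + m and the sum of
    \<rho>^d is 2.\<close>
  define c :: "nat \<Rightarrow> 'a" where "c i = (if i = 0 then 0 else (2 + real i) *\<^sub>R b)" for i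
  define \<rho> :: "nat \<Rightarrow> real" where "\<rho> i = (if i = 0 then 1 else 1 / real m)" for i
  define \<Omega> where "\<Omega> = (\<Union>i\<in>I. ball (c i) (\<rho> i))"
  have m: "real m \<ge> 8" by (simp add: m_def)
  have \<rho>: "\<rho> i > 0" "i \<noteq> 0 \<Longrightarrow> \<rho> i \<le> 1/8" for i
    using m by (auto simp: \<rho>_def field_simps)
  have sep: "2 * (\<rho> i + \<rho> j) \<le> dist (c i) (c j)" if "i \<noteq> j" for i j
  proof -
    have "\<bar>real i - real j\<bar> \<ge> 1" using that by linarith
    moreover have "dist (c i) (c j) = (if i = 0 then 2 + real j else if j = 0 then 2 + real i else \<bar>real i - real j\<bar>)"
      using b that by (auto simp: c_def dist_norm scaleR_diff_left[symmetric])
    ultimately show ?thesis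
      using that \<rho>(2)[of i] \<rho>(2)[of j] by (auto simp: \<rho>_def)
  qed
  have fin: "finite I" by (simp add: I_def)
  have bd: "frontier \<Omega> \<subseteq> (\<Union>i\<in>I. sphere (c i) (\<rho> i))" "smooth_boundary \<Omega>"
  proof -
    have "\<rho> i + \<rho> j < dist (c i) (c j)" if "i \<noteq> j" for i j
    proof (rule less_le_trans[OF _ sep[OF that]])
      show "\<rho> i + \<rho> j < 2 * (\<rho> i + \<rho> j)"
        using \<rho>(1)[of i] \<rho>(1)[of j] by simp
    qed
    then show "frontier \<Omega> \<subseteq> (\<Union>i\<in>I. sphere (c i) (\<rho> i))" "smooth_boundary \<Omega>"
      using union_balls_boundary[OF fin \<rho>(1) _ \<Omega>_def] by blast+
  qed
  have op: "open \<Omega>" "bounded \<Omega>" using fin by (auto simp: \<Omega>_def)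
  have split: "(\<Sum>i\<in>I. f i) = f 0 + (\<Sum>i\<in>{1..m ^ ?d}. f i)" for f :: "nat \<Rightarrow> real"
    unfolding I_def atMost_atLeast0 by (simp add: sum.atLeast_Suc_atMost)
  have dpos: "?d = Suc (?d - 1)" by simp
  have "perimeter \<Omega> < \<infinity>"
    using perimeter_le_spheres[OF op(1) fin _ \<rho>(1) bd(1)]
    by (auto simp: I_def intro: le_less_trans)
  moreover have "ereal (real ?d * unit_ball_vol ?d / 2 * real n) \<le> perimeter \<Omega>"
  proof -
    have "(\<Sum>i\<in>I. \<rho> i ^ (?d - 1)) = 1 + real m ^ ?d / real m ^ (?d - 1)"
      unfolding split by (simp add: \<rho>_def power_divide)
    also have "real m ^ ?d / real m ^ (?d - 1) = real m"
      using m by (subst dpos) (simp only: power_Suc, simp)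
    finally have "real n \<le> (\<Sum>i\<in>I. \<rho> i ^ (?d - 1))" by (simp add: m_def)
    then have "real ?d * unit_ball_vol ?d / 2 * real n \<le> real ?d * unit_ball_vol ?d / 2 * (\<Sum>i\<in>I. \<rho> i ^ (?d - 1))"
      by (intro mult_left_mono) auto
    then show ?thesis
      using perimeter_union_balls_ge[OF fin \<rho>(1) sep] unfolding \<Omega>_def
      by (meson ereal_less_eq(3) order_trans)
  qed
  moreover have "measure lborel \<Omega> \<le> 2 * unit_ball_vol ?d"
  proof -
    have "measure lborel \<Omega> \<le> (\<Sum>i\<in>I. measure lborel (ball (c i) (\<rho> i)))"
      unfolding \<Omega>_def by (rule measure_UNION_le[OF fin]) auto
    also have "\<dots> = (\<Sum>i\<in>I. unit_ball_vol ?d * \<rho> i ^ ?d)"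
      using \<rho>(1) by (simp add: content_ball less_imp_le)
    also have "\<dots> = unit_ball_vol ?d * (\<Sum>i\<in>I. \<rho> i ^ ?d)"
      by (simp add: sum_distrib_left)
    also have "(\<Sum>i\<in>I. \<rho> i ^ ?d) = 2"
      unfolding split using m by (simp add: \<rho>_def power_divide)
    finally show ?thesis by simp
  qed
  moreover have "ball 0 1 \<subseteq> \<Omega>"
  proof -
    have "ball (c 0) (\<rho> 0) \<subseteq> \<Omega>" unfolding \<Omega>_def I_def by blast
    then show ?thesis by (simp add: c_def \<rho>_def)
  qed
  ultimately show ?thesis
    using op bd(2) by (intro exI[of _ \<Omega>] conjI)
qed

subsection \<open>The hole estimate on a cube\<close>

lemma integral_affine_lborel:
  fixes f :: "'a::euclidean_space \<Rightarrow> real"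
  assumes [measurable]: "f \<in> borel_measurable borel" and "c \<noteq> 0"
  shows "(LBINT x. f x) = \<bar>c\<bar> ^ DIM('a) * (LBINT x. f (t + c *\<^sub>R x))"
proof -
  have "(LBINT x. f x) = (\<integral>x. f x \<partial>(density (distr lborel borel (\<lambda>x. t + c *\<^sub>R x)) (\<lambda>_. ennreal (\<bar>c\<bar> ^ DIM('a)))))"
    using lborel_affine[OF \<open>c \<noteq> 0\<close>, of t] by simp
  also have "\<dots> = (\<integral>x. \<bar>c\<bar> ^ DIM('a) * f x \<partial>(distr lborel borel (\<lambda>x. t + c *\<^sub>R x)))"
    by (subst integral_density) auto
  also have "\<dots> = (LBINT x. \<bar>c\<bar> ^ DIM('a) * f (t + c *\<^sub>R x))"
    by (subst integral_distr) auto
  finally show ?thesis by simp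
qed

definition cube :: "'a::euclidean_space \<Rightarrow> real \<Rightarrow> 'a set" where
  "cube c h = cbox (c - (h / 2) *\<^sub>R One) (c + (h / 2) *\<^sub>R One)"

lemma mem_cube:
  fixes c :: "'a::euclidean_space"
  shows "x \<in> cube c h \<longleftrightarrow> (\<forall>b\<in>Basis. \<bar>(x - c) \<bullet> b\<bar> \<le> h / 2)"
proof -
  have e: "(c - (h / 2) *\<^sub>R One) \<bullet> b = c \<bullet> b - h / 2" "(c + (h / 2) *\<^sub>R One) \<bullet> b = c \<bullet> b + h / 2"
    if "b \<in> Basis" for b
    using that by (simp_all add: inner_simps)
  show ?thesis
    unfolding cube_def mem_box
  proof (intro ball_cong refl)
    fix b :: 'a assume "b \<in> Basis"
    then show "(c - (h / 2) *\<^sub>R One) \<bullet> b \<le> x \<bullet> b \<and> x \<bullet> b \<le> (c + (h / 2) *\<^sub>R One) \<bullet> b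
        \<longleftrightarrow> \<bar>(x - c) \<bullet> b\<bar> \<le> h / 2"
      unfolding e[OF \<open>b \<in> Basis\<close>] unfolding inner_diff_left by linarith
  qed
qed

lemma norm_cube_le:
  fixes x :: "'a::euclidean_space"
  assumes "x \<in> cube c h"
  shows "norm (x - c) \<le> real DIM('a) * h / 2"
proof -
  have "norm (x - c) \<le> (\<Sum>b\<in>Basis. \<bar>(x - c) \<bullet> b\<bar>)"
    by (rule norm_le_l1)
  also have "\<dots> \<le> (\<Sum>b\<in>(Basis :: 'a set). h / 2)"
    using assms by (intro sum_mono) (auto simp: mem_cube)
  finally show ?thesis by simp
qed

lemma measure_cube:
  assumes "h \<ge> 0"
  shows "measure lborel (cube c h :: 'a::euclidean_space set) = h ^ DIM('a)"
proof -
  have "(c + (h / 2) *\<^sub>R One - (c - (h / 2) *\<^sub>R One)) \<bullet> b = h" if "b \<in> Basis" for b :: 'a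
    using that by (simp add: inner_simps)
  moreover have "\<forall>b\<in>Basis. (c - (h / 2) *\<^sub>R One) \<bullet> b \<le> (c + (h / 2) *\<^sub>R One) \<bullet> (b::'a)"
    using assms by (simp add: inner_simps)
  ultimately show ?thesis
    by (simp add: cube_def content_cbox)
qed

text \<open>With \<open>G \<tau> = \<integral>\<^sub>Q \<phi> (c + \<tau> (x - c))\<close>, Cauchy--Schwarz and scaling give
  \<open>G' \<tau> \<le> M / sqrt \<tau>\<close>, while \<open>G\<close> vanishes at \<open>\<eta>\<close> because \<open>\<phi>\<close> vanishes on the hole.\<close>

lemma integral_cube_le:
  fixes \<phi> :: "'a::euclidean_space \<Rightarrow> real"
  assumes \<phi>: "\<phi> \<in> test_functions \<Omega>" and hole: "\<And>x. x \<in> ball c r \<Longrightarrow> \<phi> x = 0"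
    and h: "h > 0" and \<eta>: "0 < \<eta>" "\<eta> \<le> 1" "\<eta> * (real DIM('a) * h) \<le> r"
  shows "(LINT x:cube c h|lborel. \<phi> x)
    \<le> real DIM('a) * h * sqrt (h ^ DIM('a) / \<eta> ^ (DIM('a) - 1)) * sqrt (LINT x:cube c h|lborel. (norm (grad \<phi> x))\<^sup>2)"
proof -
  let ?d = "DIM('a)" and ?Q = "cube c h"
  define D where "D = real ?d * h / 2"
  have D: "D > 0" using h by (simp add: D_def)
  note cont = test_function_continuous[OF \<phi>]
  have [measurable]: "\<phi> \<in> borel_measurable borel" "grad \<phi> \<in> borel_measurable borel"
    using cont by (auto intro: borel_measurable_continuous_onI)
  have Q [measurable]: "?Q \<in> sets borel" by (simp add: cube_def)
  have cQ: "compact ?Q" by (simp add: cube_def)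
  have Qfin: "emeasure lborel ?Q < \<infinity>" using cQ by (rule emeasure_compact_finite)
  define N where "N = sqrt (LINT x:?Q|lborel. (norm (grad \<phi> x))\<^sup>2)"
  have N: "N \<ge> 0" "N\<^sup>2 = (LINT x:?Q|lborel. (norm (grad \<phi> x))\<^sup>2)"
    unfolding N_def by (auto simp: set_lebesgue_integral_def)
  define M where "M = D * sqrt (h ^ ?d / \<eta> ^ (?d - 1)) * N"
  define G where "G \<tau> = integral ?Q (\<lambda>x. \<phi> (c + \<tau> *\<^sub>R (x - c)))" for \<tau>
  define G' where "G' \<tau> = integral ?Q (\<lambda>x. grad \<phi> (c + \<tau> *\<^sub>R (x - c)) \<bullet> (x - c))" for \<tau>
  have set_int: "set_integrable lborel ?Q f" "(LINT x:?Q|lborel. f x) = integral ?Q f"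
    if "continuous_on UNIV f" for f :: "'a \<Rightarrow> real"
  proof -
    show "set_integrable lborel ?Q f"
      unfolding set_integrable_def using cQ continuous_on_subset[OF that] by (intro borel_integrable_compact) auto
    then show "(LINT x:?Q|lborel. f x) = integral ?Q f"
      by (rule set_borel_integral_eq_integral(2))
  qed
  have cont_line: "continuous_on UNIV (\<lambda>x. \<phi> (c + \<tau> *\<^sub>R (x - c)))" "continuous_on UNIV (\<lambda>x. grad \<phi> (c + \<tau> *\<^sub>R (x - c)))" for \<tau>
    by (rule continuous_on_compose2[OF cont(1)] continuous_on_compose2[OF cont(2)]; auto intro!: continuous_intros)+
  have G_deriv: "(G has_real_derivative G' \<tau>) (at \<tau>)" for \<tau>
    unfolding G_def[abs_def] G'_def cube_def
  proof (rule leibniz_rule_field_derivative[where U = UNIV])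
    fix \<tau> :: real and x :: 'a
    have "((\<lambda>\<tau>. c + \<tau> *\<^sub>R (x - c)) has_derivative (\<lambda>u. u *\<^sub>R (x - c))) (at \<tau>)"
      by (auto intro!: derivative_eq_intros)
    from has_derivative_compose[OF this test_function_derivative[OF \<phi>]]
    show "((\<lambda>\<tau>. \<phi> (c + \<tau> *\<^sub>R (x - c))) has_real_derivative grad \<phi> (c + \<tau> *\<^sub>R (x - c)) \<bullet> (x - c)) (at \<tau>)"
      by (simp add: has_field_derivative_def mult_commute_abs)
  next
    fix \<tau> :: real
    show "(\<lambda>x. \<phi> (c + \<tau> *\<^sub>R (x - c))) integrable_on cbox (c - (h / 2) *\<^sub>R One) (c + (h / 2) *\<^sub>R One)"
      by (intro integrable_continuous continuous_on_subset[OF cont_line(1)]) auto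
  next
    have "continuous_on UNIV (\<lambda>p::real \<times> 'a. grad \<phi> (c + fst p *\<^sub>R (snd p - c)) \<bullet> (snd p - c))"
      by (intro continuous_intros continuous_on_compose2[OF cont(2)]) auto
    then show "continuous_on (UNIV \<times> cbox (c - (h / 2) *\<^sub>R One) (c + (h / 2) *\<^sub>R One))
        (\<lambda>(\<tau>, x). grad \<phi> (c + \<tau> *\<^sub>R (x - c)) \<bullet> (x - c))"
      unfolding case_prod_beta by (rule continuous_on_subset) auto
  qed auto
  have G'_le: "G' \<tau> \<le> M / sqrt \<tau>" if \<tau>: "\<eta> \<le> \<tau>" "\<tau> \<le> 1" for \<tau>
  proof -
    have tpos: "\<tau> > 0" using \<eta> \<tau> by linarith
    define f where "f x = indicator ?Q x *\<^sub>R grad \<phi> (c + \<tau> *\<^sub>R (x - c))" for x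
    have sqf: "sq_integrable lborel f"
      unfolding sq_integrable_def
    proof
      show "f \<in> borel_measurable lborel"
        unfolding f_def[abs_def] using borel_measurable_continuous_onI[OF cont_line(2)] by simp
      have "(norm (f x))\<^sup>2 = indicator ?Q x *\<^sub>R (norm (grad \<phi> (c + \<tau> *\<^sub>R (x - c))))\<^sup>2" for x
        by (simp add: f_def indicator_def)
      then show "integrable lborel (\<lambda>x. (norm (f x))\<^sup>2)"
        using set_int(1)[of "\<lambda>x. (norm (grad \<phi> (c + \<tau> *\<^sub>R (x - c))))\<^sup>2"] cont_line(2)[of \<tau>]
        by (simp add: set_integrable_def continuous_intros)
    qed
    \<comment> \<open>Dilation by \<tau> \<le> 1 about the centre maps the cube into itself, so the
      substitution costs only the Jacobian \<tau>^(-d).\<close>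
    have L2f: "L2_norm lborel f \<le> N / sqrt (\<tau> ^ ?d)"
    proof -
      define g where "g x = indicator ?Q x * (norm (grad \<phi> x))\<^sup>2" for x
      have [measurable]: "g \<in> borel_measurable borel" unfolding g_def[abs_def] by measurable
      have gi: "integrable lborel g"
        unfolding g_def[abs_def] using set_int(1)[of "\<lambda>x. (norm (grad \<phi> x))\<^sup>2"] cont(2)
        by (simp add: set_integrable_def continuous_intros)
      have "(LBINT x. (norm (f x))\<^sup>2) \<le> (LBINT x. g ((c - \<tau> *\<^sub>R c) + \<tau> *\<^sub>R x))"
      proof (rule integral_mono)
        show "integrable lborel (\<lambda>x. (norm (f x))\<^sup>2)" using sqf by (simp add: sq_integrable_def)
        have "integrable (density (distr lborel borel (\<lambda>x. (c - \<tau> *\<^sub>R c) + \<tau> *\<^sub>R x)) (\<lambda>_. ennreal (\<bar>\<tau>\<bar> ^ ?d))) g"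
          using gi lborel_affine[of \<tau> "c - \<tau> *\<^sub>R c"] tpos by simp
        then show "integrable lborel (\<lambda>x. g ((c - \<tau> *\<^sub>R c) + \<tau> *\<^sub>R x))"
          using tpos by (subst (asm) integrable_density) (auto simp: integrable_distr_eq)
        fix x
        show "(norm (f x))\<^sup>2 \<le> g ((c - \<tau> *\<^sub>R c) + \<tau> *\<^sub>R x)"
        proof (cases "x \<in> ?Q")
          case True
          have e: "(c - \<tau> *\<^sub>R c) + \<tau> *\<^sub>R x = c + \<tau> *\<^sub>R (x - c)" by (simp add: algebra_simps)
          have "\<bar>\<tau> * ((x - c) \<bullet> b)\<bar> \<le> h / 2" if "b \<in> Basis" for b
          proof -
            have "\<tau> * \<bar>(x - c) \<bullet> b\<bar> \<le> 1 * (h / 2)"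
              using True that \<tau> tpos by (intro mult_mono) (auto simp: mem_cube)
            then show ?thesis using tpos by (simp add: abs_mult)
          qed
          then have "c + \<tau> *\<^sub>R (x - c) \<in> ?Q"
            by (simp add: mem_cube)
          then show ?thesis unfolding e using True by (simp add: f_def g_def)
        next
          case False
          then show ?thesis by (simp add: f_def g_def)
        qed
      qed
      also have "\<dots> = N\<^sup>2 / \<tau> ^ ?d"
        using integral_affine_lborel[of g \<tau> "c - \<tau> *\<^sub>R c"] tpos N(2)
        by (simp add: field_simps set_lebesgue_integral_def g_def[abs_def])
      finally have "(L2_norm lborel f)\<^sup>2 \<le> (N / sqrt (\<tau> ^ ?d))\<^sup>2"
        unfolding L2_norm_power2 using tpos by (simp add: power_divide)
      then show ?thesis
        by (rule power2_le_imp_le) (use N(1) tpos in simp)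
    qed
    have "G' \<tau> = (LINT x:?Q|lborel. grad \<phi> (c + \<tau> *\<^sub>R (x - c)) \<bullet> (x - c))"
      unfolding G'_def using cont_line(2)[of \<tau>] by (intro set_int(2)[symmetric] continuous_intros)
    also have "\<dots> = (LBINT x. f x \<bullet> (x - c))"
      by (simp add: set_lebesgue_integral_def f_def)
    also have "\<dots> \<le> (LBINT x. D * norm (f x))"
    proof (rule integral_mono)
      have fx: "f x \<bullet> (x - c) = indicator ?Q x *\<^sub>R (grad \<phi> (c + \<tau> *\<^sub>R (x - c)) \<bullet> (x - c))" for x
        by (simp add: f_def)
      show "integrable lborel (\<lambda>x. f x \<bullet> (x - c))"
        unfolding fx set_integrable_def[symmetric]
        using cont_line(2)[of \<tau>] by (intro set_int(1) continuous_intros)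
      show "integrable lborel (\<lambda>x. D * norm (f x))"
        by (intro integrable_mult_right integrable_norm integral_norm_le_L2_norm(1)[OF sqf _ Qfin])
          (simp_all add: f_def Q)
      fix x
      show "f x \<bullet> (x - c) \<le> D * norm (f x)"
      proof (cases "x \<in> ?Q")
        case True
        have "f x \<bullet> (x - c) \<le> norm (f x) * norm (x - c)" by (rule norm_cauchy_schwarz)
        also have "\<dots> \<le> norm (f x) * D"
          using norm_cube_le[OF True] by (intro mult_left_mono) (auto simp: D_def)
        finally show ?thesis by (simp add: mult.commute)
      qed (simp add: f_def)
    qed
    also have "\<dots> = D * (LBINT x. norm (f x))" by simp
    also have "\<dots> \<le> D * (sqrt (measure lborel ?Q) * L2_norm lborel f)"
      using D by (intro mult_left_mono integral_norm_le_L2_norm(2)[OF sqf _ Qfin]) (auto simp: f_def)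
    also have "\<dots> \<le> D * (sqrt (h ^ ?d) * (N / sqrt (\<tau> ^ ?d)))"
      using D L2f h unfolding measure_cube[OF less_imp_le[OF h]] by (intro mult_left_mono) auto
    \<comment> \<open>Of \<tau>^d one factor \<tau> is kept and the others are bounded below by
      \<eta>. This leaves the integrable \<tau>^(-1/2), with primitive 2 sqrt \<tau>; the power
      \<eta>^(d-1) is the price of the hole.\<close>
    also have "\<dots> \<le> D * (sqrt (h ^ ?d) * (N / sqrt (\<eta> ^ (?d - 1) * \<tau>)))"
    proof -
      have "\<eta> ^ (?d - 1) * \<tau> \<le> \<tau> ^ (?d - 1) * \<tau>"
        using \<eta> \<tau> tpos by (intro mult_right_mono power_mono) auto
      also have "\<dots> = \<tau> ^ ?d"
        using power_Suc2[of \<tau> "?d - 1"] by simp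
      finally have "sqrt (\<eta> ^ (?d - 1) * \<tau>) \<le> sqrt (\<tau> ^ ?d)" by simp
      then show ?thesis
        using D h N \<eta> tpos by (intro mult_left_mono divide_left_mono mult_pos_pos) auto
    qed
    also have "\<dots> = M / sqrt \<tau>"
      by (simp add: M_def real_sqrt_mult real_sqrt_divide)
    finally show ?thesis .
  qed
  \<comment> \<open>Monotonicity of 2 M sqrt \<tau> - G on [\<eta>, 1] replaces integrating the
    bound on G'.\<close>
  have "2 * M * sqrt \<eta> - G \<eta> \<le> 2 * M * sqrt 1 - G 1"
  proof (rule DERIV_nonneg_imp_nondecreasing[OF \<eta>(2)])
    fix \<tau> assume \<tau>: "\<eta> \<le> \<tau>" "\<tau> \<le> 1"
    then have "\<tau> > 0" using \<eta> by linarith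
    have "((\<lambda>\<tau>. 2 * M * sqrt \<tau> - G \<tau>) has_real_derivative 2 * M * (inverse (sqrt \<tau>) / 2) - G' \<tau>) (at \<tau>)"
      by (intro DERIV_diff DERIV_cmult DERIV_real_sqrt G_deriv) fact
    moreover have "0 \<le> 2 * M * (inverse (sqrt \<tau>) / 2) - G' \<tau>"
    proof -
      have "2 * M * (inverse (sqrt \<tau>) / 2) = M / sqrt \<tau>"
        unfolding divide_inverse[of M] by simp
      with G'_le[OF \<tau>] show ?thesis by linarith
    qed
    ultimately show "\<exists>y. ((\<lambda>\<tau>. 2 * M * sqrt \<tau> - G \<tau>) has_real_derivative y) (at \<tau>) \<and> 0 \<le> y"
      by blast
  qed
  moreover have "G \<eta> = 0"
  proof -
    have "\<phi> (c + \<eta> *\<^sub>R (x - c)) = 0" if "x \<in> ?Q" for x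
    proof (rule hole)
      have "\<eta> * norm (x - c) \<le> \<eta> * (real ?d * h / 2)"
        using norm_cube_le[OF that] \<eta> by (intro mult_left_mono) auto
      also have "\<dots> < \<eta> * (real ?d * h)"
        using \<eta> h by (intro mult_strict_left_mono) auto
      also have "\<dots> \<le> r"
        by (rule \<eta>(3))
      finally show "c + \<eta> *\<^sub>R (x - c) \<in> ball c r"
        using \<eta>(1) by (simp add: dist_norm)
    qed
    then have "G \<eta> = integral ?Q (\<lambda>x. 0)"
      unfolding G_def by (intro integral_cong) auto
    then show ?thesis by simp
  qed
  moreover have "G 1 = (LINT x:?Q|lborel. \<phi> x)"
    using set_int(2)[OF cont(1)] by (simp add: G_def)
  moreover have "0 \<le> 2 * M * sqrt \<eta>"
    using D N \<eta> h by (simp add: M_def)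
  ultimately have "(LINT x:?Q|lborel. \<phi> x) \<le> 2 * M" by simp
  then show ?thesis by (simp add: M_def D_def N_def)
qed

subsection \<open>Perforated balls\<close>

text \<open>The centre of the half-open lattice cube containing x. Its fibres, the cells, partition
  space exactly, so sums over cells never count a point twice; the closed cubes, on which the
  calculus is done, overlap in faces.\<close>

definition cell_center :: "real \<Rightarrow> 'a::euclidean_space \<Rightarrow> 'a" where
  "cell_center h x = (\<Sum>b\<in>Basis. (h * (of_int \<lfloor>x \<bullet> b / h\<rfloor> + 1 / 2)) *\<^sub>R b)"

definition cell :: "real \<Rightarrow> 'a::euclidean_space \<Rightarrow> 'a set" where
  "cell h z = {x. cell_center h x = z}"

lemma cell_center_inner:
  "b \<in> Basis \<Longrightarrow> cell_center h x \<bullet> b = h * (of_int \<lfloor>x \<bullet> b / h\<rfloor> + 1 / 2)"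
  by (simp add: cell_center_def)

lemma cell_sets [measurable]: "cell h z \<in> sets borel"
proof -
  have "cell_center h \<in> borel_measurable borel"
    unfolding cell_center_def[abs_def] by measurable
  from measurable_sets[OF this, of "{z}"] show ?thesis
    by (simp add: cell_def vimage_def)
qed

lemma mem_cube_cell_center:
  fixes x :: "'a::euclidean_space"
  assumes "h > 0"
  shows "x \<in> cube (cell_center h x) h"
  unfolding mem_cube
proof
  fix b :: 'a assume b: "b \<in> Basis"
  let ?i = "of_int \<lfloor>x \<bullet> b / h\<rfloor> :: real"
  have "h * ?i \<le> h * (x \<bullet> b / h)" "h * (x \<bullet> b / h) \<le> h * (?i + 1)"
    using assms by (intro mult_left_mono; linarith)+
  moreover have "h * (x \<bullet> b / h) = x \<bullet> b"
    using assms by simp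
  ultimately have "h * ?i \<le> x \<bullet> b" "x \<bullet> b \<le> h * ?i + h"
    by (simp_all only: distrib_left mult_1_right)
  then show "\<bar>(x - cell_center h x) \<bullet> b\<bar> \<le> h / 2"
    unfolding inner_diff_left cell_center_inner[OF b] distrib_left by linarith
qed

lemma cell_subset_cube: "h > 0 \<Longrightarrow> cell h z \<subseteq> cube z h"
  using mem_cube_cell_center by (auto simp: cell_def)

text \<open>The offset 1/2 puts the centre strictly inside its cell, so it determines its own
  integer index.\<close>

lemma floor_cell_center:
  assumes "h > 0" "z \<in> range (cell_center h)" "b \<in> Basis"
  shows "z \<bullet> b = h * (of_int \<lfloor>z \<bullet> b / h\<rfloor> + 1 / 2)"
proof -
  obtain y where y: "z = cell_center h y" using assms(2) by blast
  have "z \<bullet> b / h = of_int \<lfloor>y \<bullet> b / h\<rfloor> + 1 / 2"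
    using assms by (simp add: y cell_center_inner)
  then have "\<lfloor>z \<bullet> b / h\<rfloor> = \<lfloor>y \<bullet> b / h\<rfloor>" by linarith
  then show ?thesis using assms(3) by (simp add: y cell_center_inner)
qed

text \<open>The cell lies between the open box and the closed cube, which differ by the negligible
  faces.\<close>

lemma cell_cube_null:
  fixes z :: "'a::euclidean_space"
  assumes "h > 0" "z \<in> range (cell_center h)"
  shows "(cell h z - cube z h) \<union> (cube z h - cell h z) \<in> null_sets lborel"
proof -
  let ?a = "z - (h / 2) *\<^sub>R One" and ?b = "z + (h / 2) *\<^sub>R One"
  have "box ?a ?b \<subseteq> cell h z"
  proof
    fix x assume x: "x \<in> box ?a ?b"
    have "cell_center h x \<bullet> b = z \<bullet> b" if b: "b \<in> Basis" for b
    proof -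
      have "z \<bullet> b - h / 2 < x \<bullet> b" "x \<bullet> b < z \<bullet> b + h / 2"
        using x b by (auto simp: mem_box inner_diff_left inner_add_left)
      moreover have zb: "z \<bullet> b = h * (of_int \<lfloor>z \<bullet> b / h\<rfloor> + 1 / 2)"
        by (rule floor_cell_center[OF assms b])
      ultimately have "h * of_int \<lfloor>z \<bullet> b / h\<rfloor> < x \<bullet> b" "x \<bullet> b < h * (of_int \<lfloor>z \<bullet> b / h\<rfloor> + 1)"
        unfolding distrib_left by linarith+
      then have "of_int \<lfloor>z \<bullet> b / h\<rfloor> < x \<bullet> b / h" "x \<bullet> b / h < of_int \<lfloor>z \<bullet> b / h\<rfloor> + 1"
        using assms(1) by (simp_all add: less_divide_eq divide_less_eq mult.commute)
      then have "\<lfloor>x \<bullet> b / h\<rfloor> = \<lfloor>z \<bullet> b / h\<rfloor>" by linarith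
      then show ?thesis using zb b by (simp add: cell_center_inner)
    qed
    then show "x \<in> cell h z" by (auto simp: cell_def intro: euclidean_eqI)
  qed
  then have sub: "(cell h z - cube z h) \<union> (cube z h - cell h z) \<subseteq> cbox ?a ?b - box ?a ?b"
    using cell_subset_cube[OF assms(1), of z] by (auto simp: cube_def)
  have "cbox ?a ?b - box ?a ?b \<in> null_sets lborel"
    using negligible_frontier_interval[of ?a ?b]
    by (auto simp: negligible_iff_null_sets null_sets_completion_iff)
  then show ?thesis
    by (rule null_sets_subset[OF _ _ sub]) (auto simp: cube_def)
qed

lemma cell_integral_eq:
  fixes f :: "'a::euclidean_space \<Rightarrow> real"
  assumes "h > 0" "z \<in> range (cell_center h)" "integrable lborel f"
  shows "(LINT x:cube z h|lborel. f x) = (LINT x:cell h z|lborel. f x)"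
proof (rule set_integral_null_delta[OF assms(3)])
  show "(cube z h - cell h z) \<union> (cell h z - cube z h) \<in> null_sets lborel"
    using cell_cube_null[OF assms(1,2)] by (simp add: Un_commute)
qed (auto simp: cube_def)

lemma measure_cell:
  fixes z :: "'a::euclidean_space"
  assumes "h > 0" "z \<in> range (cell_center h)"
  shows "measure lborel (cell h z) = h ^ DIM('a)"
proof -
  have "emeasure lborel (cell h z) = emeasure lborel (cube z h)"
    using cell_cube_null[OF assms] by (intro emeasure_eq_AE AE_I'[of "(cell h z - cube z h) \<union> (cube z h - cell h z)"]) (auto simp: cube_def)
  then show ?thesis
    using measure_cube[of h z] assms(1) by (simp add: measure_def)
qed

lemma cell_center_dist:
  fixes z :: "'a::euclidean_space"
  assumes "h > 0" "z \<in> range (cell_center h)" "w \<in> range (cell_center h)" "z \<noteq> w"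
  shows "h \<le> dist z w"
proof -
  obtain b where b: "b \<in> Basis" "z \<bullet> b \<noteq> w \<bullet> b"
    using assms(4) euclidean_eqI by blast
  let ?i = "\<lfloor>z \<bullet> b / h\<rfloor>" and ?j = "\<lfloor>w \<bullet> b / h\<rfloor>"
  have e: "(z - w) \<bullet> b = h * (of_int ?i - of_int ?j)"
    using floor_cell_center[OF assms(1,2) b(1)] floor_cell_center[OF assms(1,3) b(1)]
    unfolding inner_diff_left by (simp add: algebra_simps)
  then have "?i \<noteq> ?j" using b(2) by (auto simp: inner_diff_left)
  then have "\<bar>real_of_int ?i - real_of_int ?j\<bar> \<ge> 1" by linarith
  then have "h * 1 \<le> h * \<bar>real_of_int ?i - real_of_int ?j\<bar>"
    using assms(1) by (intro mult_left_mono) auto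
  also have "\<dots> = \<bar>(z - w) \<bullet> b\<bar>"
    using assms(1) by (simp add: e abs_mult)
  also have "\<dots> \<le> dist z w"
    using Basis_le_norm[OF b(1)] by (simp add: dist_norm)
  finally show ?thesis by simp
qed

text \<open>Centres are encoded by their integer index vectors, which range over a finite
  box.\<close>

lemma finite_cell_centers:
  assumes "h > 0" "bounded Z" "Z \<subseteq> range (cell_center h)"
  shows "finite (Z :: 'a::euclidean_space set)"
proof -
  obtain B where B: "\<And>z. z \<in> Z \<Longrightarrow> norm z \<le> B"
    using assms(2) unfolding bounded_iff by blast
  define f where "f z = (\<lambda>b\<in>Basis. \<lfloor>z \<bullet> b / h\<rfloor>)" for z :: 'a
  have "inj_on f Z"
  proof (rule inj_onI, rule euclidean_eqI)
    fix z w and b :: 'a assume zw: "z \<in> Z" "w \<in> Z" "f z = f w" and b: "b \<in> Basis"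
    have "f z b = f w b" using zw(3) by simp
    then have "\<lfloor>z \<bullet> b / h\<rfloor> = \<lfloor>w \<bullet> b / h\<rfloor>"
      using b by (simp add: f_def)
    moreover have "z \<in> range (cell_center h)" "w \<in> range (cell_center h)"
      using zw assms(3) by blast+
    ultimately show "z \<bullet> b = w \<bullet> b"
      using floor_cell_center[OF assms(1) _ b, of z] floor_cell_center[OF assms(1) _ b, of w] by simp
  qed
  moreover have "f ` Z \<subseteq> (\<Pi>\<^sub>E b\<in>Basis. {\<lfloor>- B / h\<rfloor>..\<lfloor>B / h\<rfloor>})"
  proof
    fix g assume "g \<in> f ` Z"
    then obtain z where z: "z \<in> Z" "g = f z" by blast
    have "\<lfloor>- B / h\<rfloor> \<le> \<lfloor>z \<bullet> b / h\<rfloor> \<and> \<lfloor>z \<bullet> b / h\<rfloor> \<le> \<lfloor>B / h\<rfloor>" if "b \<in> Basis" for b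
    proof -
      have "\<bar>z \<bullet> b\<bar> \<le> B" using Basis_le_norm[OF that, of z] B[OF z(1)] by linarith
      then show ?thesis using assms(1) by (intro conjI floor_mono divide_right_mono) auto
    qed
    then show "g \<in> (\<Pi>\<^sub>E b\<in>Basis. {\<lfloor>- B / h\<rfloor>..\<lfloor>B / h\<rfloor>})"
      by (auto simp: z(2) f_def)
  qed
  moreover have "finite (\<Pi>\<^sub>E b\<in>(Basis::'a set). {\<lfloor>- B / h\<rfloor>..\<lfloor>B / h\<rfloor>})"
    by (intro finite_PiE) auto
  ultimately show ?thesis by (rule inj_on_finite)
qed

lemma sum_indicator_cell:
  assumes "finite Z"
  shows "(\<Sum>z\<in>Z. indicator (cell h z) x) = (indicator Z (cell_center h x) :: real)"
proof -
  have "(\<Sum>z\<in>Z. indicator (cell h z) x) = (\<Sum>z\<in>Z. if z = cell_center h x then 1 else (0::real))"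
    by (intro sum.cong) (auto simp: cell_def indicator_def)
  then show ?thesis
    using assms by (simp add: indicator_def)
qed

text \<open>A count by volume: the cells are disjoint, have volume h^d each and lie in the unit
  ball.\<close>

lemma card_cell_centers_le:
  fixes Z :: "'a::euclidean_space set"
  assumes h: "h > 0" and Z: "finite Z" "Z \<subseteq> range (cell_center h)" "\<And>z. z \<in> Z \<Longrightarrow> cube z h \<subseteq> ball 0 1"
  shows "real (card Z) * h ^ DIM('a) \<le> unit_ball_vol DIM('a)"
proof -
  have fin: "emeasure lborel (cell h z) < \<infinity>" for z :: 'a
  proof -
    have "emeasure lborel (cell h z) \<le> emeasure lborel (cube z h)"
      using cell_subset_cube[OF h] by (intro emeasure_mono) (auto simp: cube_def)
    also have "\<dots> < \<infinity>"
      using emeasure_lborel_cbox_finite by (auto simp: cube_def)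
    finally show ?thesis .
  qed
  have "real (card Z) * h ^ DIM('a) = (\<Sum>z\<in>Z. measure lborel (cell h z))"
  proof -
    have "measure lborel (cell h z) = h ^ DIM('a)" if "z \<in> Z" for z
      using measure_cell[OF h] Z(2) that by blast
    then show ?thesis by simp
  qed
  also have "\<dots> = (LBINT x. (\<Sum>z\<in>Z. indicator (cell h z) x))"
    using fin by (subst Bochner_Integration.integral_sum) auto
  also have "\<dots> \<le> (LBINT x. indicator (ball (0::'a) 1) x)"
  proof (rule integral_mono)
    show "integrable lborel (\<lambda>x. \<Sum>z\<in>Z. indicat_real (cell h z) x)"
      using fin by (intro Bochner_Integration.integrable_sum integrable_real_indicator) auto
    show "integrable lborel (indicat_real (ball (0::'a) 1))"
      using emeasure_lborel_ball_finite[of "0::'a" 1] by (intro integrable_real_indicator) auto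
    show "(\<Sum>z\<in>Z. indicator (cell h z) x) \<le> indicat_real (ball 0 1) x" for x :: 'a
      unfolding sum_indicator_cell[OF Z(1)]
      using Z(3) mem_cube_cell_center[OF h, of x] by (fastforce simp: indicator_def)
  qed
  also have "\<dots> = unit_ball_vol DIM('a)"
    by (simp add: content_ball)
  finally show ?thesis .
qed

text \<open>At a point of a hole's sphere, the other holes and the complement of the unit ball form
  a closed set missing the point, so the domain is locally the exterior of one ball.\<close>

lemma perforated_ball_boundary:
  fixes Z :: "'a::euclidean_space set"
  assumes Z: "finite Z" and r: "r > 0" "\<And>z. z \<in> Z \<Longrightarrow> cball z r \<subseteq> ball 0 1"
    and sep: "\<And>z w. z \<in> Z \<Longrightarrow> w \<in> Z \<Longrightarrow> z \<noteq> w \<Longrightarrow> 2 * r < dist z w"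
    and \<Omega>: "\<Omega> = ball 0 1 - (\<Union>z\<in>Z. cball z r)"
  shows "open \<Omega>" "frontier \<Omega> \<subseteq> sphere 0 1 \<union> (\<Union>z\<in>Z. sphere z r)" "smooth_boundary \<Omega>"
proof -
  have clH: "closed (\<Union>z\<in>Z. cball z r)" using Z by (intro closed_UN) auto
  show op: "open \<Omega>" unfolding \<Omega> using clH by (intro open_Diff) auto
  have "closure \<Omega> \<subseteq> cball 0 1 - (\<Union>z\<in>Z. ball z r)"
    by (intro closure_minimal closed_Diff open_UN) (auto simp: \<Omega> dest: less_imp_le)
  then show fr: "frontier \<Omega> \<subseteq> sphere 0 1 \<union> (\<Union>z\<in>Z. sphere z r)"
    using op by (fastforce simp: frontier_def interior_open \<Omega>)
  show "smooth_boundary \<Omega>"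
  proof (rule smooth_boundary_spheres)
    fix x assume "x \<in> frontier \<Omega>"
    then consider "norm x = 1" | z where "z \<in> Z" "dist z x = r" using fr by auto
    then show "\<exists>r>0. \<exists>c \<rho>. \<rho> > 0 \<and> norm (x - c) = \<rho> \<and>
     ((\<forall>y\<in>ball x r. y \<in> \<Omega> \<longleftrightarrow> norm (y - c) < \<rho>) \<or> (\<forall>y\<in>ball x r. y \<in> \<Omega> \<longleftrightarrow> norm (y - c) > \<rho>))"
    proof cases
      case 1
      have "x \<notin> (\<Union>z\<in>Z. cball z r)" using 1 r(2) by fastforce
      then obtain s where s: "s > 0" "ball x s \<inter> (\<Union>z\<in>Z. cball z r) = {}"
        using ball_avoiding_closed[OF clH] by blast
      have "y \<in> \<Omega> \<longleftrightarrow> norm (y - 0) < 1" if "y \<in> ball x s" for y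
      proof -
        have "y \<notin> (\<Union>z\<in>Z. cball z r)" using that s(2) by blast
        then show ?thesis unfolding \<Omega> by (simp add: dist_norm)
      qed
      then show ?thesis
        using s(1) 1 by (intro exI[of _ s] conjI exI[of _ 0] exI[of _ 1]) auto
    next
      case 2
      let ?S = "(\<Union>w\<in>Z - {z}. cball w r) \<union> - ball 0 1"
      have "x \<notin> ?S"
      proof
        assume "x \<in> ?S"
        moreover have "x \<in> ball 0 1" using r(2)[OF 2(1)] 2(2) by (auto simp: subset_iff)
        ultimately obtain w where "w \<in> Z" "w \<noteq> z" "dist w x \<le> r" by auto
        then show False
          using sep[of z w] 2 dist_triangle2[of z w x] by auto
      qed
      moreover have "closed ?S" using Z by (intro closed_Un closed_UN) auto
      ultimately obtain s where s: "s > 0" "ball x s \<inter> ?S = {}"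
        using ball_avoiding_closed[of ?S x] by blast
      have "y \<in> \<Omega> \<longleftrightarrow> norm (y - z) > r" if "y \<in> ball x s" for y
      proof -
        have "y \<notin> ?S" using s(2) that by blast
        then show ?thesis
          using 2(1) unfolding \<Omega> by (auto simp: dist_norm norm_minus_commute not_le)
      qed
      then show ?thesis
        using s(1) 2 r(1) by (intro exI[of _ s] conjI exI[of _ z] exI[of _ r]) (auto simp: dist_norm norm_minus_commute)
    qed
  qed
qed

section \<open>Torsion of the perforated ball\<close>

text \<open>The first summand collects the cells contained in the ball, each with a hole of radius
  \<open>\<eta> * (d * h)\<close>, the size that \<open>integral_cube_le\<close> asks for. The
  second is the layer of cut cells, whose smallness comes from its volume alone.\<close>

lemma perforated_integral_le:
  fixes \<phi> :: "'a::euclidean_space \<Rightarrow> real"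
  defines "Z h \<equiv> {z \<in> range (cell_center h). cube z h \<subseteq> ball (0::'a) 1}"
  assumes h: "h > 0" "real DIM('a) * h \<le> 1" and \<eta>: "0 < \<eta>" "\<eta> \<le> 1"
    and \<phi>: "\<phi> \<in> test_functions \<Omega>" and \<Omega>: "\<Omega> \<subseteq> ball 0 1"
    and hole: "\<And>z. z \<in> Z h \<Longrightarrow> \<Omega> \<inter> ball z (\<eta> * (real DIM('a) * h)) = {}"
  shows "(LBINT x. \<phi> x) \<le> (real DIM('a) * h * sqrt (unit_ball_vol DIM('a) / \<eta> ^ (DIM('a) - 1))
     + 2 * sqrt (2 * real DIM('a) * unit_ball_vol DIM('a) * 2 ^ (DIM('a) - 1) * (real DIM('a) * h)))
     * L2_norm lborel (grad \<phi>)"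
proof -
  let ?d = "DIM('a)" and ?Z = "Z h"
  note sq = test_function_sq_integrable[OF \<phi>]
  have Zr: "?Z \<subseteq> range (cell_center h)" "\<And>z. z \<in> ?Z \<Longrightarrow> cube z h \<subseteq> ball 0 1"
    by (auto simp: Z_def)
  have zin: "z \<in> cube z h" for z :: 'a
    using h(1) by (simp add: mem_cube)
  have "?Z \<subseteq> ball 0 1" using Zr(2) zin by blast
  then have fin: "finite ?Z"
    using finite_cell_centers[OF h(1) _ Zr(1)] bounded_subset[OF bounded_ball] by blast
  \<comment> \<open>The part of the ball covered by cells whose cubes are not contained in it; no
    holes are assumed there.\<close>
  define Y where "Y = {x \<in> ball 0 1. cell_center h x \<notin> ?Z}"
  have Yeq: "Y = ball 0 1 - (\<Union>z\<in>?Z. cell h z)"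
    by (auto simp: Y_def cell_def)
  have Y [measurable]: "Y \<in> sets borel"
    unfolding Yeq using fin by (intro sets.Diff sets.finite_UN cell_sets) auto
  define N where "N z = sqrt (LINT x:cube z h|lborel. (norm (grad \<phi> x))\<^sup>2)" for z
  have igrad: "integrable lborel (\<lambda>x. (norm (grad \<phi> x))\<^sup>2)"
    using sq(2) by (simp add: sq_integrable_def)
  have ici: "integrable lborel (\<lambda>x. indicator A x * f x)" if "integrable lborel f" "A \<in> sets borel"
    for f :: "'a \<Rightarrow> real" and A
    using integrable_mult_indicator[of A lborel f] that by simp

  have "\<phi> x = (\<Sum>z\<in>?Z. indicator (cell h z) x * \<phi> x) + indicator Y x * \<phi> x" for x
  proof -
    have "\<phi> x = 0" if "x \<notin> ball 0 1"
      using test_function_zero(1)[OF \<phi>] \<Omega> that by blast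
    then show ?thesis
      unfolding sum_distrib_right[symmetric] sum_indicator_cell[OF fin]
      by (auto simp: indicator_def Y_def)
  qed
  then have "(LBINT x. \<phi> x) = (LBINT x. (\<Sum>z\<in>?Z. indicator (cell h z) x * \<phi> x) + indicator Y x * \<phi> x)"
    by (rule Bochner_Integration.integral_cong[OF refl])
  also have "\<dots> = (\<Sum>z\<in>?Z. LBINT x. indicator (cell h z) x * \<phi> x) + (LBINT x. indicator Y x * \<phi> x)"
    using ici[OF sq(3)] by (subst Bochner_Integration.integral_add) auto
  finally have decomp: "(LBINT x. \<phi> x)
      = (\<Sum>z\<in>?Z. LBINT x. indicator (cell h z) x * \<phi> x) + (LBINT x. indicator Y x * \<phi> x)" .

  define B where "B = real ?d * h * sqrt (h ^ ?d / \<eta> ^ (?d - 1))"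
  have B: "B \<ge> 0" using h \<eta> by (simp add: B_def)
  have cells: "(LBINT x. indicator (cell h z) x * \<phi> x) \<le> B * N z" if z: "z \<in> ?Z" for z
  proof -
    have "(LBINT x. indicator (cell h z) x * \<phi> x) = (LINT x:cube z h|lborel. \<phi> x)"
      using cell_integral_eq[OF h(1) _ sq(3), of z] Zr(1) z
      by (auto simp: set_lebesgue_integral_def)
    also have "\<dots> \<le> B * N z"
      unfolding B_def N_def
    proof (rule integral_cube_le[OF \<phi> _ h(1) \<eta> order_refl])
      show "\<phi> x = 0" if "x \<in> ball z (\<eta> * (real ?d * h))" for x
        using test_function_zero(1)[OF \<phi>] hole[OF z] that by blast
    qed
    finally show ?thesis .
  qed
  have sumN2: "(\<Sum>z\<in>?Z. (N z)\<^sup>2) \<le> (L2_norm lborel (grad \<phi>))\<^sup>2"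
  proof -
    have "(\<Sum>z\<in>?Z. (N z)\<^sup>2) = (\<Sum>z\<in>?Z. LBINT x. indicator (cell h z) x * (norm (grad \<phi> x))\<^sup>2)"
    proof (rule sum.cong)
      fix z assume "z \<in> ?Z"
      have "0 \<le> (LINT x:cube z h|lborel. (norm (grad \<phi> x))\<^sup>2)"
        unfolding set_lebesgue_integral_def by (intro integral_nonneg_AE) auto
      then show "(N z)\<^sup>2 = (LBINT x. indicator (cell h z) x * (norm (grad \<phi> x))\<^sup>2)"
        using cell_integral_eq[OF h(1) _ igrad, of z] Zr(1) \<open>z \<in> ?Z\<close>
        by (auto simp: N_def set_lebesgue_integral_def)
    qed simp
    also have "\<dots> = (LBINT x. (\<Sum>z\<in>?Z. indicator (cell h z) x) * (norm (grad \<phi> x))\<^sup>2)"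
      unfolding sum_distrib_right using ici[OF igrad] by (subst Bochner_Integration.integral_sum) auto
    also have "\<dots> \<le> (LBINT x. (norm (grad \<phi> x))\<^sup>2)"
    proof (rule integral_mono)
      show "integrable lborel (\<lambda>x. (\<Sum>z\<in>?Z. indicator (cell h z) x) * (norm (grad \<phi> x))\<^sup>2)"
        unfolding sum_distrib_right using ici[OF igrad] by (intro Bochner_Integration.integrable_sum) auto
      show "(\<Sum>z\<in>?Z. indicator (cell h z) x) * (norm (grad \<phi> x))\<^sup>2 \<le> (norm (grad \<phi> x))\<^sup>2" for x
        unfolding sum_indicator_cell[OF fin] by (simp add: indicator_def)
    qed (rule igrad)
    finally show ?thesis by (simp add: L2_norm_power2)
  qed
  have card: "real (card ?Z) * h ^ ?d \<le> unit_ball_vol ?d"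
    by (rule card_cell_centers_le[OF h(1) fin Zr])
  \<comment> \<open>Cauchy-Schwarz over the cells. Their number is at most the volume of the ball
    over h^d, and this cancels the h^d under the root in \<open>B\<close>.\<close>
  have "(\<Sum>z\<in>?Z. N z)\<^sup>2 \<le> (\<Sum>z\<in>?Z. (N z)\<^sup>2) * (\<Sum>z\<in>?Z. 1\<^sup>2)"
    using Cauchy_Schwarz_ineq_sum[of N "\<lambda>_. 1" ?Z] by simp
  also have "\<dots> \<le> (L2_norm lborel (grad \<phi>))\<^sup>2 * (unit_ball_vol ?d / h ^ ?d)"
    using sumN2 card h by (intro mult_mono) (auto simp: field_simps)
  finally have "(\<Sum>z\<in>?Z. N z)\<^sup>2 \<le> (L2_norm lborel (grad \<phi>) * sqrt (unit_ball_vol ?d / h ^ ?d))\<^sup>2"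
    using h by (simp add: power_mult_distrib)
  then have sumN: "(\<Sum>z\<in>?Z. N z) \<le> L2_norm lborel (grad \<phi>) * sqrt (unit_ball_vol ?d / h ^ ?d)"
    by (rule power2_le_imp_le) (use h in simp)
  have "(\<Sum>z\<in>?Z. LBINT x. indicator (cell h z) x * \<phi> x) \<le> B * (\<Sum>z\<in>?Z. N z)"
    unfolding sum_distrib_left by (rule sum_mono[OF cells])
  also have "\<dots> \<le> B * (L2_norm lborel (grad \<phi>) * sqrt (unit_ball_vol ?d / h ^ ?d))"
    using sumN B by (rule mult_left_mono)
  also have "\<dots> = real ?d * h * (sqrt (h ^ ?d / \<eta> ^ (?d - 1)) * sqrt (unit_ball_vol ?d / h ^ ?d)) * L2_norm lborel (grad \<phi>)"
    by (simp add: B_def)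
  also have "sqrt (h ^ ?d / \<eta> ^ (?d - 1)) * sqrt (unit_ball_vol ?d / h ^ ?d) = sqrt (unit_ball_vol ?d / \<eta> ^ (?d - 1))"
    unfolding real_sqrt_mult[symmetric] using h by (simp add: field_simps)
  finally have part1: "(\<Sum>z\<in>?Z. LBINT x. indicator (cell h z) x * \<phi> x)
      \<le> real ?d * h * sqrt (unit_ball_vol ?d / \<eta> ^ (?d - 1)) * L2_norm lborel (grad \<phi>)" .

  let ?k = "2 * real ?d * unit_ball_vol ?d * 2 ^ (?d - 1) * (real ?d * h)"
  \<comment> \<open>The cube of a point of \<open>Y\<close> also contains a point outside the ball.
    Its diameter is at most d h, so \<open>Y\<close> lies in an annulus of that width and has volume
    of order h.\<close>
  have "Y \<subseteq> cball 0 (1 + real ?d * h) - ball 0 (1 - real ?d * h)"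
  proof
    fix x assume x: "x \<in> Y"
    then have "\<not> cube (cell_center h x) h \<subseteq> ball 0 1"
      unfolding Y_def Z_def by blast
    then obtain y where y: "y \<in> cube (cell_center h x) h" "y \<notin> ball 0 1"
      by blast
    have "norm (x - cell_center h x) \<le> real ?d * h / 2" "norm (y - cell_center h x) \<le> real ?d * h / 2"
      using norm_cube_le[OF y(1)] norm_cube_le[OF mem_cube_cell_center[OF h(1)]] by auto
    then have "norm (y - x) \<le> real ?d * h"
      using norm_triangle_ineq4[of "y - cell_center h x" "x - cell_center h x"] by simp
    moreover have "norm y \<le> norm x + norm (y - x)"
      using norm_triangle_ineq[of x "y - x"] by simp
    ultimately show "x \<in> cball 0 (1 + real ?d * h) - ball 0 (1 - real ?d * h)"
      using y(2) x h by (auto simp: Y_def)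
  qed
  then have "emeasure lborel Y \<le> emeasure lborel (cball (0::'a) (1 + real ?d * h) - ball 0 (1 - real ?d * h))"
    by (intro emeasure_mono) auto
  also have "\<dots> \<le> ennreal ?k"
    using emeasure_annulus_le[of "real ?d * h" 1 "0::'a"] h by simp
  finally have mY: "emeasure lborel Y \<le> ennreal ?k" .
  then have Yfin: "emeasure lborel Y < \<infinity>" by (rule le_less_trans) simp
  have mY': "measure lborel Y \<le> ?k"
    using mY h by (auto simp: measure_def intro!: enn2real_leI)
  have "(LBINT x. indicator Y x * \<phi> x) \<le> L2_norm lborel (indicator Y :: 'a \<Rightarrow> real) * L2_norm lborel \<phi>"
    using integral_Cauchy_Schwarz[OF sq_integrable_indicator(1)[OF _ Yfin] sq(1)] by simp
  also have "\<dots> = sqrt (measure lborel Y) * L2_norm lborel \<phi>"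
    using sq_integrable_indicator(2)[OF _ Yfin] by simp
  also have "\<dots> \<le> sqrt ?k * (2 * 1 * L2_norm lborel (grad \<phi>))"
  proof (rule mult_mono)
    show "L2_norm lborel \<phi> \<le> 2 * 1 * L2_norm lborel (grad \<phi>)"
      using \<Omega> ball_subset_cball by (intro Poincare[OF \<phi>]) auto
  qed (use mY' h in auto)
  finally have part2: "(LBINT x. indicator Y x * \<phi> x) \<le> 2 * sqrt ?k * L2_norm lborel (grad \<phi>)"
    by simp
  show ?thesis
    using add_mono[OF part1 part2] unfolding decomp distrib_right .
qed

text \<open>The lower bounds on m have separate tasks: m \<ge> 8 gives r \<le> h/8, so holes stay
  inside their cells and apart; m \<ge> d gives d h \<le> 1, as the boundary layer requires; m \<ge>
  2 \<omega>, with \<omega> the volume of the unit ball, keeps the holes below half of that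
  volume.\<close>

lemma ex_perforated_ball:
  assumes d: "DIM('a::euclidean_space) \<ge> 2"
  obtains P C :: real where "C \<ge> 0"
    "\<And>m::nat. m \<ge> 8 \<Longrightarrow> real m \<ge> real DIM('a) \<Longrightarrow> real m \<ge> 2 * unit_ball_vol DIM('a) \<Longrightarrow>
      \<exists>\<Omega>::'a set. open \<Omega> \<and> bounded \<Omega> \<and> smooth_boundary \<Omega> \<and> perimeter \<Omega> \<le> ereal P \<and>
        measure lborel \<Omega> \<ge> unit_ball_vol DIM('a) / 2 \<and> torsion \<Omega> \<le> C / real m"
proof -
  let ?d = "DIM('a)"
  define \<omega> where "\<omega> = unit_ball_vol ?d"
  have \<omega>: "\<omega> > 0" by (simp add: \<omega>_def)
  \<comment> \<open>The factor 1 + \<omega> bounds the sum of the radii to the power d - 1: 1 for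
    the outer sphere, and \<open>card Z\<close> times h^d for the holes.\<close>
  define P where "P = 2 * (real ?d)\<^sup>2 * \<omega> * 2 ^ (?d - 1) * (1 + \<omega>)"
  \<comment> \<open>The constant of \<open>perforated_integral_le\<close> after sqrt h has been
    taken out of both summands.\<close>
  define A0 where "A0 = real ?d * sqrt (\<omega> * real ?d ^ (?d - 1)) + 2 * sqrt (2 * real ?d * \<omega> * 2 ^ (?d - 1) * real ?d)"
  have "\<exists>\<Omega>::'a set. open \<Omega> \<and> bounded \<Omega> \<and> smooth_boundary \<Omega> \<and> perimeter \<Omega> \<le> ereal P \<and>
        measure lborel \<Omega> \<ge> \<omega> / 2 \<and> torsion \<Omega> \<le> A0\<^sup>2 / real m"
    if m: "m \<ge> 8" "real m \<ge> real ?d" "real m \<ge> 2 * \<omega>" for m :: nat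
  proof -
    define h where "h = 1 / real m ^ (?d - 1)"
    define r where "r = 1 / real m ^ ?d"
    have m1: "real m \<ge> 8" using m(1) by simp
    \<comment> \<open>Here d \<ge> 2 enters: for d = 1 the mesh would be 1 for every m.\<close>
    have hm: "h \<le> 1 / real m"
    proof -
      have "real m ^ 1 \<le> real m ^ (?d - 1)"
        using d m1 by (intro power_increasing) auto
      then show ?thesis using m1 by (simp add: h_def field_simps)
    qed
    have h: "h > 0" using m1 by (simp add: h_def)
    have dh: "real ?d * h \<le> 1"
    proof -
      have "real ?d * h \<le> real m * (1 / real m)"
        using hm h m by (intro mult_mono) auto
      then show ?thesis using m1 by simp
    qed
    have rh: "r = h / real m"
    proof -
      have "real m ^ ?d = real m * real m ^ (?d - 1)"
        using power_Suc[of "real m" "?d - 1"] by simp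
      then show ?thesis by (simp add: r_def h_def)
    qed
    have r: "r > 0" "r \<le> h / 8"
      unfolding rh using h m1 by (simp, intro divide_left_mono) auto
    \<comment> \<open>The balance of the construction: both sides are m^(-d(d-1)).\<close>
    have rd: "r ^ (?d - 1) = h ^ ?d"
      by (simp add: r_def h_def power_one_over mult.commute flip: power_mult)
    define Z where "Z = {z \<in> range (cell_center h). cube z h \<subseteq> ball (0::'a) 1}"
    have Zr: "Z \<subseteq> range (cell_center h)" "\<And>z. z \<in> Z \<Longrightarrow> cube z h \<subseteq> ball 0 1"
      by (auto simp: Z_def)
    have "Z \<subseteq> ball 0 1"
      using Zr(2) h by (force simp: mem_cube)
    then have fin: "finite Z"
      using finite_cell_centers[OF h _ Zr(1)] bounded_subset[OF bounded_ball] by blast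
    have card: "real (card Z) * h ^ ?d \<le> \<omega>"
      unfolding \<omega>_def by (rule card_cell_centers_le[OF h fin Zr])
    have inside: "cball z r \<subseteq> ball 0 1" if "z \<in> Z" for z
    proof -
      have "cball z r \<subseteq> cube z h"
      proof
        fix x assume "x \<in> cball z r"
        then have "norm (x - z) \<le> h / 2" using r h by (simp add: dist_norm norm_minus_commute)
        then show "x \<in> cube z h"
          unfolding mem_cube using Basis_le_norm[of _ "x - z"] order_trans by blast
      qed
      then show ?thesis using Zr(2)[OF that] by blast
    qed
    have sep: "2 * r < dist z w" if "z \<in> Z" "w \<in> Z" "z \<noteq> w" for z w
    proof -
      have "h \<le> dist z w"
        by (rule cell_center_dist[OF h]) (use Zr(1) that in auto)
      then show ?thesis using r h by linarith
    qed
    define \<Omega> where "\<Omega> = ball 0 1 - (\<Union>z\<in>Z. cball z r)"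
    note bd = perforated_ball_boundary[OF fin r(1) inside sep \<Omega>_def]
    have sub: "\<Omega> \<subseteq> ball 0 1" by (auto simp: \<Omega>_def)
    then have bounded: "bounded \<Omega>" using bounded_subset[OF bounded_ball] by blast
    have per: "perimeter \<Omega> \<le> ereal P"
    proof -
      \<comment> \<open>Spheres are indexed by pairs of centre and radius, so that
        \<open>fst\<close> and \<open>snd\<close> serve as the two families in
        \<open>perimeter_le_spheres\<close>.\<close>
      let ?I = "insert (0, 1) ((\<lambda>z. (z, r)) ` Z)"
      have "perimeter \<Omega> \<le> ereal (2 * (real ?d)\<^sup>2 * unit_ball_vol ?d * 2 ^ (?d - 1) * (\<Sum>i\<in>?I. snd i ^ (?d - 1)))"
        by (rule perimeter_le_spheres[where c = fst]) (use bd fin r in auto)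
      moreover have "(\<Sum>i\<in>?I. snd i ^ (?d - 1)) \<le> 1 + \<omega>"
      proof -
        have "(\<Sum>i\<in>?I. snd i ^ (?d - 1)) \<le> 1 + (\<Sum>i\<in>(\<lambda>z. (z, r)) ` Z. snd i ^ (?d - 1))"
          using fin r by (simp add: sum.insert_if)
        also have "(\<Sum>i\<in>(\<lambda>z. (z, r)) ` Z. snd i ^ (?d - 1)) = real (card Z) * h ^ ?d"
          by (subst sum.reindex) (auto simp: inj_on_def rd[symmetric])
        finally show ?thesis using card by linarith
      qed
      then have "2 * (real ?d)\<^sup>2 * unit_ball_vol ?d * 2 ^ (?d - 1) * (\<Sum>i\<in>?I. snd i ^ (?d - 1)) \<le> P"
        unfolding P_def \<omega>_def[symmetric] using \<omega> by (intro mult_left_mono) auto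
      ultimately show ?thesis
        by (meson ereal_less_eq(3) order_trans)
    qed
    have vol: "measure lborel \<Omega> \<ge> \<omega> / 2"
    proof -
      \<comment> \<open>Since r = h/m, the holes have total volume at most \<omega>^2/m, and m \<ge>
        2 \<omega>.\<close>
      have "real (card Z) * (\<omega> * r ^ ?d) \<le> \<omega> / 2"
      proof -
        have "r ^ ?d = h ^ ?d * (1 / real m ^ ?d)"
          unfolding rh by (simp add: power_divide)
        also have "\<dots> \<le> h ^ ?d * (1 / real m)"
        proof (intro mult_left_mono divide_left_mono)
          show "real m \<le> real m ^ ?d"
            using power_increasing[of 1 ?d "real m"] m1 by simp
        qed (use h m1 in auto)
        finally have "real (card Z) * (\<omega> * r ^ ?d) \<le> real (card Z) * (\<omega> * (h ^ ?d * (1 / real m)))"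
          using \<omega> by (intro mult_left_mono) auto
        also have "\<dots> = (real (card Z) * h ^ ?d) * (\<omega> / real m)" by simp
        also have "\<dots> \<le> \<omega> * (1 / 2)"
          using card \<omega> m1 m(3) by (intro mult_mono) (auto simp: field_simps)
        finally show ?thesis by simp
      qed
      moreover have "measure lborel (\<Union>z\<in>Z. cball z r) \<le> (\<Sum>z\<in>Z. measure lborel (cball z r))"
        by (rule measure_UNION_le[OF fin]) auto
      then have "measure lborel (\<Union>z\<in>Z. cball z r) \<le> real (card Z) * (\<omega> * r ^ ?d)"
        using r by (simp add: content_cball \<omega>_def)
      moreover have "measure lborel \<Omega> = measure lborel (ball (0::'a) 1) - measure lborel (\<Union>z\<in>Z. cball z r)"
        unfolding \<Omega>_def using emeasure_lborel_ball_finite[of "0::'a" 1] inside fin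
        by (intro measure_Diff) auto
      moreover have "measure lborel (ball (0::'a) 1) = \<omega>"
        by (simp add: content_ball \<omega>_def)
      ultimately show ?thesis
        by linarith
    qed
    have tor: "torsion \<Omega> \<le> A0\<^sup>2 / real m"
    proof -
      \<comment> \<open>Chosen as r/(d h), so that the hole in \<open>perforated_integral_le\<close>
        has radius r. Then \<eta>^(d-1) = h/d^(d-1), and h over the root of this is again of order
        sqrt h.\<close>
      define \<eta> where "\<eta> = 1 / (real ?d * real m)"
      have \<eta>: "0 < \<eta>" "\<eta> \<le> 1"
        using m1 mult_mono[of 1 "real ?d" 1 "real m"] by (auto simp: \<eta>_def)
      have \<eta>r: "\<eta> * (real ?d * h) = r"
        by (simp add: \<eta>_def rh)
      have \<eta>h: "real ?d * h * sqrt (\<omega> / \<eta> ^ (?d - 1)) = real ?d * sqrt (\<omega> * real ?d ^ (?d - 1)) * sqrt h"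
      proof -
        have e: "\<omega> / \<eta> ^ (?d - 1) = \<omega> * real ?d ^ (?d - 1) / h"
          by (simp add: \<eta>_def h_def power_one_over power_mult_distrib)
        have "real ?d * h * (s / sqrt h) = real ?d * s * (h / sqrt h)" for s
          by simp
        then show ?thesis
          unfolding e real_sqrt_divide using h by (simp only: real_div_sqrt less_imp_le)
      qed
      have est: "(LBINT x. \<phi> x) \<le> (A0 * sqrt h) * L2_norm lborel (grad \<phi>)" if \<phi>: "\<phi> \<in> test_functions \<Omega>" for \<phi>
      proof -
        have "\<Omega> \<inter> ball z (\<eta> * (real ?d * h)) = {}" if "z \<in> Z" for z
          using that unfolding \<eta>r \<Omega>_def by auto
        from perforated_integral_le[OF h dh \<eta> \<phi> sub this[unfolded Z_def], folded \<omega>_def]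
        have "(LBINT x. \<phi> x) \<le> (real ?d * h * sqrt (\<omega> / \<eta> ^ (?d - 1))
            + 2 * sqrt (2 * real ?d * \<omega> * 2 ^ (?d - 1) * (real ?d * h))) * L2_norm lborel (grad \<phi>)" .
        also have "real ?d * h * sqrt (\<omega> / \<eta> ^ (?d - 1)) + 2 * sqrt (2 * real ?d * \<omega> * 2 ^ (?d - 1) * (real ?d * h)) = A0 * sqrt h"
          unfolding \<eta>h A0_def mult.assoc[symmetric] by (simp add: real_sqrt_mult distrib_right)
        finally show ?thesis .
      qed
      have "torsion \<Omega> \<le> (A0 * sqrt h)\<^sup>2"
        by (rule torsion_le[OF bd(1) bounded est])
      also have "\<dots> = A0\<^sup>2 * h"
        using h by (simp add: power_mult_distrib)
      also have "\<dots> \<le> A0\<^sup>2 * (1 / real m)"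
        using hm by (intro mult_left_mono) auto
      finally show ?thesis by simp
    qed
    show ?thesis
      using bd(1,3) bounded per vol tor by blast
  qed
  then show ?thesis
    using that[of "A0\<^sup>2" P] unfolding \<omega>_def by auto
qed

section \<open>The two sequences and the extremal values\<close>

theorem theorem2p1:
  assumes "DIM('a::euclidean_space) \<ge> 2"
  shows "(\<exists>(\<Omega>1 :: nat \<Rightarrow> 'a set) (\<Omega>2 :: nat \<Rightarrow> 'a set).
            (\<forall>n. \<Omega>1 n \<in> A_all \<and> smooth_boundary (\<Omega>1 n) \<and> perimeter (\<Omega>1 n) < \<infinity>) \<and>
            (\<forall>n. \<Omega>2 n \<in> A_all \<and> smooth_boundary (\<Omega>2 n) \<and> perimeter (\<Omega>2 n) < \<infinity>) \<and>
            (\<forall>q>0. ((\<lambda>n. F q (\<Omega>1 n)) \<longlonglongrightarrow> 0) \<and> ((\<lambda>n. F q (\<Omega>2 n)) \<longlonglongrightarrow> \<infinity>))) \<and>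
         (\<forall>q>0. Inf {F q \<Omega> | \<Omega> :: 'a set. \<Omega> \<in> A_all \<and> smooth_boundary \<Omega>} = 0 \<and>
                Sup {F q \<Omega> | \<Omega> :: 'a set. \<Omega> \<in> A_all \<and> smooth_boundary \<Omega>} = \<infinity>)"
proof -
  let ?d = "DIM('a)"
  define \<omega> where "\<omega> = unit_ball_vol ?d"
  have \<omega>: "\<omega> > 0" by (simp add: \<omega>_def)
  have A_all: "\<Omega> \<in> A_all" "measure lborel \<Omega> > 0" if "open \<Omega>" "bounded \<Omega>" "measure lborel \<Omega> > 0" for \<Omega> :: "'a set"
    using that emeasure_bounded_finite[of \<Omega>] by (auto simp: A_all_def)
  have real_perimeter: "\<exists>p\<ge>0. perimeter \<Omega> = ereal p" if "perimeter \<Omega> < \<infinity>" for \<Omega> :: "'a set"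
    using that perimeter_nonneg[of \<Omega>] by (cases "perimeter \<Omega>") auto

  obtain C P :: real where "C \<ge> 0" and perforated':
    "\<And>m::nat. m \<ge> 8 \<Longrightarrow> real m \<ge> real ?d \<Longrightarrow> real m \<ge> 2 * unit_ball_vol ?d \<Longrightarrow>
      \<exists>\<Omega>::'a set. open \<Omega> \<and> bounded \<Omega> \<and> smooth_boundary \<Omega> \<and> perimeter \<Omega> \<le> ereal P \<and>
        measure lborel \<Omega> \<ge> unit_ball_vol ?d / 2 \<and> torsion \<Omega> \<le> C / real m"
    by (rule ex_perforated_ball[OF assms]) (rule that)
  note perforated = perforated'[folded \<omega>_def]
  \<comment> \<open>An index beyond all three thresholds on m; shifting by it gives a domain for
    every n.\<close>
  obtain m0 :: nat where m0: "8 + real ?d + 2 * \<omega> \<le> real m0"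
    using real_arch_simple by blast
  have "\<exists>\<Omega>::'a set. open \<Omega> \<and> bounded \<Omega> \<and> smooth_boundary \<Omega> \<and> perimeter \<Omega> \<le> ereal P \<and>
        measure lborel \<Omega> \<ge> \<omega> / 2 \<and> torsion \<Omega> \<le> C / real (n + m0)" for n
  proof (rule perforated)
    have "8 \<le> real (n + m0)" using m0 \<omega> by simp
    then show "8 \<le> n + m0" by linarith
  qed (use m0 \<omega> in auto)
  then obtain \<Omega>1 :: "nat \<Rightarrow> 'a set" where \<Omega>1: "\<And>n. open (\<Omega>1 n)" "\<And>n. bounded (\<Omega>1 n)"
    "\<And>n. smooth_boundary (\<Omega>1 n)" "\<And>n. perimeter (\<Omega>1 n) \<le> ereal P"
    "\<And>n. measure lborel (\<Omega>1 n) \<ge> \<omega> / 2" "\<And>n. torsion (\<Omega>1 n) \<le> C / real (n + m0)"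
    by metis
  have V1: "measure lborel (\<Omega>1 n) > 0" for n
    using \<Omega>1(5)[of n] \<omega> by linarith
  have P1: "perimeter (\<Omega>1 n) < \<infinity>" for n
    using \<Omega>1(4)[of n] by (rule le_less_trans) simp
  have lim1: "(\<lambda>n. F q (\<Omega>1 n)) \<longlonglongrightarrow> 0" if "q > 0" for q
  proof -
    \<comment> \<open>Finite perimeters make F_q a real quotient, squeezed between 0 and P (C/(n +
      m0))^q / (\<omega>/2)^\<alpha>.\<close>
    obtain p where p: "\<And>n. p n \<ge> 0" "\<And>n. perimeter (\<Omega>1 n) = ereal (p n)"
      using real_perimeter[OF P1] by metis
    have pP: "p n \<le> P" for n using \<Omega>1(4)[of n] p(2)[of n] by simp
    let ?\<alpha> = "alpha TYPE('a) q"
    have \<alpha>: "?\<alpha> > 0" by (rule alpha_pos[OF assms that])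
    have "(\<lambda>n. p n * torsion (\<Omega>1 n) powr q / measure lborel (\<Omega>1 n) powr ?\<alpha>) \<longlonglongrightarrow> 0"
    proof (rule tendsto_sandwich[OF _ _ tendsto_const])
      show "\<forall>\<^sub>F n in sequentially. 0 \<le> p n * torsion (\<Omega>1 n) powr q / measure lborel (\<Omega>1 n) powr ?\<alpha>"
        using p(1) by (intro always_eventually allI divide_nonneg_nonneg mult_nonneg_nonneg) auto
      have "p n * torsion (\<Omega>1 n) powr q / measure lborel (\<Omega>1 n) powr ?\<alpha>
          \<le> P * (C / real (n + m0)) powr q / (\<omega> / 2) powr ?\<alpha>" for n
      proof (rule frac_le)
        show "p n * torsion (\<Omega>1 n) powr q \<le> P * (C / real (n + m0)) powr q"
          using p(1)[of n] pP[of n] \<Omega>1(6)[of n] torsion_nonneg[OF \<Omega>1(1,2)] that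
          by (intro mult_mono powr_mono2) auto
        show "(\<omega> / 2) powr ?\<alpha> \<le> measure lborel (\<Omega>1 n) powr ?\<alpha>"
          using \<Omega>1(5) \<omega> \<alpha> by (intro powr_mono2) auto
        show "0 \<le> P * (C / real (n + m0)) powr q"
          using p(1)[of n] pP[of n] by (intro mult_nonneg_nonneg) auto
      qed (use \<omega> in auto)
      then show "\<forall>\<^sub>F n in sequentially. p n * torsion (\<Omega>1 n) powr q / measure lborel (\<Omega>1 n) powr ?\<alpha>
          \<le> P * (C / real (n + m0)) powr q / (\<omega> / 2) powr ?\<alpha>"
        by simp
      have "(\<lambda>n. C / real (n + m0)) \<longlonglongrightarrow> 0"
        using LIMSEQ_ignore_initial_segment[OF lim_const_over_n] by simp
      then have "(\<lambda>n. (C / real (n + m0)) powr q) \<longlonglongrightarrow> 0"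
        by (rule tendsto_zero_powrI[OF _ tendsto_const]) (use \<open>C \<ge> 0\<close> that in auto)
      then have "(\<lambda>n. P * (C / real (n + m0)) powr q / (\<omega> / 2) powr ?\<alpha>) \<longlonglongrightarrow> P * 0 / (\<omega> / 2) powr ?\<alpha>"
        by (intro tendsto_intros) (use \<omega> in auto)
      then show "(\<lambda>n. P * (C / real (n + m0)) powr q / (\<omega> / 2) powr ?\<alpha>) \<longlonglongrightarrow> 0"
        by simp
    qed
    then have "(\<lambda>n. ereal (p n * torsion (\<Omega>1 n) powr q / measure lborel (\<Omega>1 n) powr ?\<alpha>)) \<longlonglongrightarrow> ereal 0"
      by (rule tendsto_ereal)
    then show ?thesis
      unfolding F_eq[OF p(2) V1] zero_ereal_def .
  qed

  define K where "K = real ?d * \<omega> / 2"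
  have K: "K > 0" using \<omega> by (simp add: K_def)
  have "\<forall>n::nat. \<exists>\<Omega>::'a set. open \<Omega> \<and> bounded \<Omega> \<and> ball 0 1 \<subseteq> \<Omega> \<and> smooth_boundary \<Omega> \<and>
    perimeter \<Omega> < \<infinity> \<and> ereal (K * real n) \<le> perimeter \<Omega> \<and> measure lborel \<Omega> \<le> 2 * \<omega>"
    unfolding K_def \<omega>_def by (rule allI) (rule ex_domain_large_perimeter)
  then obtain \<Omega>2 :: "nat \<Rightarrow> 'a set" where \<Omega>2: "\<And>n. open (\<Omega>2 n)" "\<And>n. bounded (\<Omega>2 n)"
    "\<And>n. ball 0 1 \<subseteq> \<Omega>2 n" "\<And>n. smooth_boundary (\<Omega>2 n)" "\<And>n. perimeter (\<Omega>2 n) < \<infinity>"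
    "\<And>n. ereal (K * real n) \<le> perimeter (\<Omega>2 n)" "\<And>n. measure lborel (\<Omega>2 n) \<le> 2 * \<omega>"
    by metis
  have V2: "measure lborel (\<Omega>2 n) > 0" for n
  proof -
    have "measure lborel (ball (0::'a) 1) \<le> measure lborel (\<Omega>2 n)"
      using \<Omega>2(1,3) emeasure_bounded_finite[OF \<Omega>2(2)] by (intro measure_mono_fmeasurable fmeasurableI) auto
    moreover have "measure lborel (ball (0::'a) 1) = \<omega>"
      by (simp add: content_ball \<omega>_def)
    ultimately show ?thesis using \<omega> by linarith
  qed
  obtain T where T: "T > 0" "\<And>n. torsion (\<Omega>2 n) \<ge> T"
    using torsion_lower_bound \<Omega>2(1,2,3) by metis
  have lim2: "(\<lambda>n. F q (\<Omega>2 n)) \<longlonglongrightarrow> \<infinity>" if "q > 0" for q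
  proof -
    obtain p where p: "\<And>n. p n \<ge> 0" "\<And>n. perimeter (\<Omega>2 n) = ereal (p n)"
      using real_perimeter[OF \<Omega>2(5)] by metis
    have pK: "K * real n \<le> p n" for n using \<Omega>2(6)[of n] p(2)[of n] by simp
    let ?\<alpha> = "alpha TYPE('a) q"
    have \<alpha>: "?\<alpha> > 0" by (rule alpha_pos[OF assms that])
    \<comment> \<open>Perimeter at least K n, torsion at least T and volume at most 2 \<omega>
      together give F_q \<ge> c n.\<close>
    define c where "c = K * T powr q / (2 * \<omega>) powr ?\<alpha>"
    have c: "c > 0" using K T \<omega> by (simp add: c_def)
    have le: "c * real n \<le> p n * torsion (\<Omega>2 n) powr q / measure lborel (\<Omega>2 n) powr ?\<alpha>" for n
    proof -
      have "c * real n = (K * real n) * T powr q / (2 * \<omega>) powr ?\<alpha>" by (simp add: c_def)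
      also have "\<dots> \<le> p n * torsion (\<Omega>2 n) powr q / measure lborel (\<Omega>2 n) powr ?\<alpha>"
      proof (rule frac_le)
        show "K * real n * T powr q \<le> p n * torsion (\<Omega>2 n) powr q"
          using pK T p(1) that by (intro mult_mono powr_mono2) auto
        show "measure lborel (\<Omega>2 n) powr ?\<alpha> \<le> (2 * \<omega>) powr ?\<alpha>"
          using \<Omega>2(7) \<alpha> by (intro powr_mono2) auto
        show "0 < measure lborel (\<Omega>2 n) powr ?\<alpha>" using V2[of n] by simp
      qed (use p(1) in auto)
      finally show ?thesis .
    qed
    have "filterlim (\<lambda>n. c * real n) at_top sequentially"
      using c by (intro filterlim_tendsto_pos_mult_at_top[OF tendsto_const]) (auto simp: filterlim_real_sequentially)
    then have "filterlim (\<lambda>n. p n * torsion (\<Omega>2 n) powr q / measure lborel (\<Omega>2 n) powr ?\<alpha>) at_top sequentially"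
      by (rule filterlim_at_top_mono) (use le in auto)
    then show ?thesis
      unfolding F_eq[OF p(2) V2] by (simp add: tendsto_PInfty_eq_at_top)
  qed

  have A1: "\<Omega>1 n \<in> A_all" and A2: "\<Omega>2 n \<in> A_all" for n
    by (rule A_all(1)[OF \<Omega>1(1,2) V1] A_all(1)[OF \<Omega>2(1,2) V2])+
  let ?S = "\<lambda>q. {F q \<Omega> | \<Omega> :: 'a set. \<Omega> \<in> A_all \<and> smooth_boundary \<Omega>}"
  have inf_0: "Inf (?S q) = 0" if "q > 0" for q
  proof (rule antisym)
    have "Inf (?S q) \<le> F q (\<Omega>1 n)" for n
      using A1 \<Omega>1(3) by (intro Inf_lower) blast
    then show "Inf (?S q) \<le> 0"
      by (intro LIMSEQ_le_const[OF lim1[OF that]]) blast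
    show "0 \<le> Inf (?S q)"
      using F_nonneg by (intro Inf_greatest) blast
  qed
  have sup_infinity: "Sup (?S q) = \<infinity>" if "q > 0" for q
  proof -
    have "F q (\<Omega>2 n) \<le> Sup (?S q)" for n
      using A2 \<Omega>2(4) by (intro Sup_upper) blast
    then have "\<infinity> \<le> Sup (?S q)"
      by (intro LIMSEQ_le_const2[OF lim2[OF that]]) blast
    then show ?thesis by simp
  qed
  have "\<forall>n. \<Omega>1 n \<in> A_all \<and> smooth_boundary (\<Omega>1 n) \<and> perimeter (\<Omega>1 n) < \<infinity>"
    "\<forall>n. \<Omega>2 n \<in> A_all \<and> smooth_boundary (\<Omega>2 n) \<and> perimeter (\<Omega>2 n) < \<infinity>"
    using A1 A2 \<Omega>1(3) \<Omega>2(4) P1 \<Omega>2(5) by simp_all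
  moreover have "\<forall>q>0. ((\<lambda>n. F q (\<Omega>1 n)) \<longlonglongrightarrow> 0) \<and> ((\<lambda>n. F q (\<Omega>2 n)) \<longlonglongrightarrow> \<infinity>)"
    using lim1 lim2 by simp
  moreover have "\<forall>q>0. Inf (?S q) = 0 \<and> Sup (?S q) = \<infinity>"
    using inf_0 sup_infinity by simp
  ultimately show ?thesis
    by (intro conjI exI)
qed

end
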